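(* For every complex $\lambda$, $\mathbf E\,e^{\lambda Y_n}=\mathbf E\,e^{\lambda Y}+O(n^{-1/2})$. Explicitly, with $\lambda_1:=\operatorname{Re}\lambda$, for all $n\ge1$, $$\big|\mathbf Ee^{\lambda Y_n}-\mathbf Ee^{\lambda Y}\big|\le 3|\lambda|\exp\Big[\max\Big(24\big(\tfrac{n+1}{n}\big)^2\lambda_1^2,\;e^{2\frac{n+1}{n}\lambda_1}\Big)\Big]\,n^{-1/2}.$$
   Context: Let $X_n$ be the number of comparisons used by randomized Quicksort (uniform random pivot) on $n$ distinct numbers. Equivalently, $X_0=0$ and $$X_n\stackrel{d}{=}X_{U_n-1}+X^*_{n-U_n}+n-1,$$ with $U_n$ uniform on $\{1,\dots,n\}$, $X_j^*\stackrel{d}{=}X_j$, all independent. Let $\mu_n=\mathbf EX_n=2(n+1)H_n-4n$, where $H_n=\sum_{k\le n}1/k$, and $Y_n:=(X_n-\mu_n)/n$. $Y$ is the distributional limit of $Y_n$. Its law is the unique law with mean $0$ and finite variance satisfying $Y\stackrel{d}{=}UY+(1-U)Y^*+C(U)$, where $U\sim\mathrm{unif}(0,1)$, $Y^*\stackrel{d}{=}Y$, $U,Y,Y^*$ are independent, and $C(u)=2u\ln u+2(1-u)\ln(1-u)+1$. The moment generating function $\mathbf Ee^{tY}$ is finite for all real $t$. *)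

theory Defs
  imports "HOL-Probability.Probability"
begin

text \<open>Law of the number of comparisons X_n of randomized Quicksort (uniform random pivot),
  given by the distributional recursion X_0 = 0,
  X_n = X_(U_n - 1) + X'_(n - U_n) + n - 1, U_n uniform on 1..n, all independent.\<close>

function quicksort_pmf :: "nat \<Rightarrow> nat pmf" where
  "quicksort_pmf 0 = return_pmf 0"
| "quicksort_pmf (Suc m) =
     bind_pmf (pmf_of_set {1..Suc m}) (\<lambda>u.
     bind_pmf (quicksort_pmf (u - 1)) (\<lambda>a.
     bind_pmf (quicksort_pmf (Suc m - u)) (\<lambda>b.
     return_pmf (a + b + (Suc m - 1)))))"
  by pat_completeness auto
termination
  by (relation "Wellfounded.measure id") (auto simp: set_pmf_of_set)

definition qs_mean :: "nat \<Rightarrow> real" where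
  "qs_mean n = 2 * (real n + 1) * harm n - 4 * real n"

definition qs_mgf :: "nat \<Rightarrow> complex \<Rightarrow> complex" where
  "qs_mgf n l = measure_pmf.expectation (quicksort_pmf n)
      (\<lambda>x. exp (l * complex_of_real ((real x - qs_mean n) / real n)))"

definition qs_C :: "real \<Rightarrow> real" where
  "qs_C u = 2 * u * ln u + 2 * (1 - u) * ln (1 - u) + 1"

text \<open>M is the law of Y: a probability law on the reals with mean 0 and finite variance
  satisfying Y = U Y + (1-U) Y' + C(U) in distribution (U uniform on (0,1), U, Y, Y' independent).
  This characterizes the limit law uniquely.\<close>
definition quicksort_limit_law :: "real measure \<Rightarrow> bool" where
  "quicksort_limit_law M \<longleftrightarrow>
     prob_space M \<and> sets M = sets borel \<and>
     integrable M (\<lambda>y. y) \<and> integrable M (\<lambda>y. y\<^sup>2) \<and> (\<integral>y. y \<partial>M) = 0 \<and>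
     distr (uniform_measure lborel {0<..<1::real} \<Otimes>\<^sub>M (M \<Otimes>\<^sub>M M)) borel
        (\<lambda>(u, y, y'). u * y + (1 - u) * y' + qs_C u) = M"

end

theory Submission
  imports Defs "HOL-Real_Asymp.Real_Asymp"
begin

text \<open>
  Write $Z_n = (X_n - \mu_n)/(n+1)$. Splitting at the pivot turns $\mathbf{E} e^{s Z_n}$ into an average
  over $k < n$ of products of two such terms at $s p_k$ and $s (1 - p_k)$, $p_k = (k+1)/(n+1)$, times
  $e^{s c_k}$ for a discrete toll $c_k$. An induction on this recursion gives $\mathbf{E} e^{s Z_n} \le e^{b(s)}$
  for all $n$, where $b(s)$ is $12 s^2$ up to $s = 5$ and $\max(12 s^2, 2 e^s)$ beyond.

  $X_n$ and $Y$ are coupled recursively: a uniform $U$ with $k/n \le U \le (k+1)/n$ selects the pivot of rank $k+1$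
  and also splits $Y$ in its fixed point equation. With $e_n$ the second moment of $X_n - \mu_n - (n+1) Y$,
  centring makes all cross terms vanish except those caused by $\mathbf{E}(U \mid k) \ne p_k$, so that
  $e_n \le (2/n) S_n + \kappa \sqrt{S_n / n} + O(1)$ with $S_n = \sum_{k<n} e_k$. The constants are
  good enough for $\|Y_n - Y\|_2 \le 3 n^{-1/2}$. Passing to the limit transfers the bound $e^{b(s)}$ to $Y$, and
  $|e^z - e^w| \le |z - w| (e^{\Re z} + e^{\Re w}) / 2$ with the Cauchy-Schwarz inequality concludes.
\<close>

section \<open>The centred number of comparisons\<close>

text \<open>Dividing by n+1 instead of n makes the weights (k+1)/(n+1) and (n-k)/(n+1) of the two
  subproblems add up to 1, so the recursion for Z_n is exact; the price is the factor (n+1)/n in the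
  final exponents. The obstacle in the coupling is that a uniform U and n equally likely pivots
  force cells of length 1/n: given k, the mean of U is (k+1/2)/n and not p_k. Multiplied by n+1 this
  bias is still below 1/2, so the surviving cross terms are of lower order. They bring in kappa with
  kappa^2 = 16 * (5/9) / 12 = 20/27, where 5/9 bounds the variance of Y and 1/12 the mean square of
  the bias. The O(1) term is 112/27 from comparing the tolls plus 10/27 from the mean square of
  (n+1)(p_k - U). The final 3 has to exceed the square root of the slope 8 obtained for e_n and to
  leave room for replacing (n+1) Y by n Y. Cauchy-Schwarz squares the exponentials, so moment
  generating functions appear at twice the argument; the square root afterwards halves 12 (2x)^2 and
  2 e^(2x) to 24 x^2 and e^(2x).\<close>

declare quicksort_pmf.simps(2) [simp del]

text \<open>Indexed by the number k of keys below the pivot. Packing the two independent subproblems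
  into \<open>pair_pmf\<close> is what later lets expectations of products factor.\<close>

lemma quicksort_pmf_Suc:
  "quicksort_pmf (Suc m) = bind_pmf (pmf_of_set {..<Suc m}) (\<lambda>k.
     map_pmf (\<lambda>(a, b). a + b + m) (pair_pmf (quicksort_pmf k) (quicksort_pmf (m - k))))"
proof -
  have 1: "pmf_of_set {1..Suc m} = map_pmf Suc (pmf_of_set {..<Suc m})"
    by (subst map_pmf_of_set_inj) (auto simp: image_Suc_lessThan)
  show ?thesis
    unfolding quicksort_pmf.simps(2) 1 bind_map_pmf
    by (simp add: pair_pmf_def map_pmf_def bind_assoc_pmf bind_return_pmf)
qed

lemma finite_set_quicksort_pmf [simp]: "finite (set_pmf (quicksort_pmf n))"
proof (induction n rule: less_induct)
  case (less n)
  show ?case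
  proof (cases n)
    case (Suc m)
    have "finite (set_pmf (quicksort_pmf k))" if "k \<le> m" for k using less Suc that by auto
    then show ?thesis
      unfolding Suc quicksort_pmf_Suc by (auto simp: set_pmf_of_set lessThan_Suc)
  qed auto
qed

lemma integrable_quicksort_pmf [simp]:
  "integrable (measure_pmf (quicksort_pmf n)) (f :: nat \<Rightarrow> 'b :: {banach, second_countable_topology})"
  by (rule integrable_measure_pmf_finite) simp

lemma expectation_quicksort_pmf_Suc:
  fixes f :: "nat \<Rightarrow> real"
  shows "measure_pmf.expectation (quicksort_pmf (Suc m)) f
   = (\<Sum>k<Suc m. measure_pmf.expectation (pair_pmf (quicksort_pmf k) (quicksort_pmf (m - k)))
        (\<lambda>(a, b). f (a + b + m))) / real (Suc m)"
  unfolding quicksort_pmf_Suc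
  by (subst pmf_expectation_bind_pmf_of_set)
     (auto simp: case_prod_beta' sum_divide_distrib sum_distrib_left divide_inverse mult.commute
       simp del: sum.lessThan_Suc intro!: sum.cong)

section \<open>The centred toll and its mean\<close>

definition qs_toll :: "nat \<Rightarrow> nat \<Rightarrow> real" where
  "qs_toll n k = (real n - 1 + qs_mean k + qs_mean (n - Suc k) - qs_mean n) / real (Suc n)"

definition qs_node :: "nat \<Rightarrow> nat \<Rightarrow> real" where
  "qs_node n k = real (Suc k) / real (Suc n)"

text \<open>The discrete counterpart of u ln u: at u = p_k the logarithm becomes H_(k+1) - H_(n+1).
  The toll is assembled from it exactly as \<open>qs_C\<close> is from u ln u.\<close>

definition toll_part :: "nat \<Rightarrow> nat \<Rightarrow> real" where
  "toll_part n k = qs_node n k * (harm (Suc k) - harm (Suc n))"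

lemma qs_node_reflect: "k < n \<Longrightarrow> qs_node n (n - Suc k) = 1 - qs_node n k"
  by (simp add: qs_node_def field_simps of_nat_diff)

lemma qs_node_bounds: "k < n \<Longrightarrow> 0 < qs_node n k" "k < n \<Longrightarrow> qs_node n k < 1"
  by (simp_all add: qs_node_def)

lemma qs_mean_Suc: "qs_mean n = 2 * (real n + 1) * harm (Suc n) - 4 * real n - 2"
  by (simp add: qs_mean_def harm_Suc field_simps)

text \<open>With the means written through H_(n+1), the identity (k+1) + (n-k) = n+1 lets the term
  (n+1) H_(n+1) be shared between the two subproblems, and the remaining constants add up to exactly
  n+1.\<close>

lemma qs_toll_eq:
  assumes "k < n"
  shows "qs_toll n k = 1 + 2 * toll_part n k + 2 * toll_part n (n - Suc k)"
proof -
  have 1: "real (Suc n) * toll_part n k = (real k + 1) * (harm (Suc k) - harm (Suc n))"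
    by (simp add: toll_part_def qs_node_def)
  have 2: "real (Suc n) * toll_part n (n - Suc k) = (real n - real k) * (harm (n - k) - harm (Suc n))"
    using assms by (simp add: toll_part_def qs_node_def Suc_diff_Suc of_nat_diff)
  have "real (Suc n) * qs_toll n k = real n - 1 + qs_mean k + qs_mean (n - Suc k) - qs_mean n"
    by (simp add: qs_toll_def)
  also have "\<dots> = real (Suc n) + 2 * (real (Suc n) * toll_part n k) + 2 * (real (Suc n) * toll_part n (n - Suc k))"
    unfolding 1 2 qs_mean_Suc using assms by (simp add: of_nat_diff Suc_diff_Suc algebra_simps)
  also have "\<dots> = real (Suc n) * (1 + 2 * toll_part n k + 2 * toll_part n (n - Suc k))"
    by (simp add: algebra_simps)
  finally have "real (Suc n) * qs_toll n k = real (Suc n) * (1 + 2 * toll_part n k + 2 * toll_part n (n - Suc k))" .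
  then show ?thesis by (metis mult_cancel_left of_nat_0_eq_iff nat.distinct(1))
qed

text \<open>Going from n to n+1 raises every gap by 1/(n+2), and the gap of the new last index was 0
  before, so the increment is a sum of consecutive integers divided by n+2.\<close>

lemma sum_mult_harm_gap:
  "(\<Sum>k<n. real (Suc k) * (harm (Suc n) - harm (Suc k))) = real n * real (Suc n) / 4"
proof (induction n)
  case (Suc n)
  have "(\<Sum>k<Suc n. real (Suc k) * (harm (Suc (Suc n)) - harm (Suc k))) 
    = (\<Sum>k<Suc n. real (Suc k) * (harm (Suc n) - harm (Suc k)) + real (Suc k) / real (Suc (Suc n)))"
    by (intro sum.cong) (auto simp: harm_Suc[of "Suc n"] divide_inverse algebra_simps)
  also have "\<dots> = real n * real (Suc n) / 4 + (\<Sum>k<Suc n. real (Suc k)) / real (Suc (Suc n))"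
    by (simp add: sum.distrib sum_divide_distrib add_divide_distrib Suc.IH del: of_nat_Suc)
  also have "(\<Sum>k<Suc n. real (Suc k)) = real (Suc n) * real (Suc (Suc n)) / 2"
    by (induction n) (auto simp: field_simps)
  finally show ?case by (simp add: field_simps del: sum.lessThan_Suc of_nat_Suc) (simp add: algebra_simps)
qed simp

lemma sum_toll_part: "(\<Sum>k<n. toll_part n k) = - real n / 4"
proof -
  have "(\<Sum>k<n. toll_part n k) = - (\<Sum>k<n. real (Suc k) * (harm (Suc n) - harm (Suc k))) / real (Suc n)"
    unfolding toll_part_def qs_node_def sum_negf[symmetric] sum_divide_distrib
    by (intro sum.cong refl) (simp add: field_simps)
  also have "\<dots> = - (real n * real (Suc n) / 4) / real (Suc n)"
    unfolding sum_mult_harm_gap ..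
  finally show ?thesis by (simp del: of_nat_Suc)
qed

text \<open>The recursion of the means in disguise. It yields E X_n = mu_n in
  \<open>expectation_quicksort_pmf\<close> and cancels the first-order term in
  \<open>sum_exp_toll_small\<close>.\<close>

lemma sum_qs_toll: "(\<Sum>k<n. qs_toll n k) = 0"
proof -
  have "(\<Sum>k<n. qs_toll n k) = (\<Sum>k<n. 1 + 2 * toll_part n k + 2 * toll_part n (n - Suc k))"
    by (intro sum.cong) (auto simp: qs_toll_eq)
  also have "\<dots> = real n + 2 * (\<Sum>k<n. toll_part n k) + 2 * (\<Sum>k<n. toll_part n (n - Suc k))"
    by (simp add: sum.distrib sum_distrib_left)
  also have "(\<Sum>k<n. toll_part n (n - Suc k)) = (\<Sum>k<n. toll_part n k)"
    by (rule sum.nat_diff_reindex)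
  finally show ?thesis by (simp add: sum_toll_part)
qed

section \<open>Pointwise bounds for the toll\<close>

lemma harm_diff_le_ln:
  assumes "0 < j" "j \<le> n"
  shows "harm n - harm j \<le> ln (real n / real j)"
  using assms(2)
proof (induction n rule: dec_induct)
  case base
  then show ?case using assms by simp
next
  case (step n)
  have "0 < n" using step assms by linarith
  have "ln (1 - 1 / real (Suc n)) \<le> - (1 / real (Suc n))"
    using ln_le_minus_one[of "1 - 1 / real (Suc n)"] \<open>0 < n\<close> by simp
  moreover have "ln (1 - 1 / real (Suc n)) = ln (real n) - ln (real (Suc n))"
    using \<open>0 < n\<close> by (subst ln_divide_pos[symmetric]) (auto simp: field_simps)
  ultimately show ?case
    using step assms \<open>0 < n\<close> by (simp add: harm_Suc ln_div inverse_eq_divide)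
qed

text \<open>Binary entropy in nats; the limiting toll is C(u) = 1 - 2
  \<open>entropy2 u\<close>.\<close>

definition entropy2 :: "real \<Rightarrow> real" where
  "entropy2 p = - p * ln p - (1 - p) * ln (1 - p)"

text \<open>Gibbs' inequality against the uniform law on two points: ln x <= x - 1 is used at 1/(2p)
  and 1/(2(1-p)), and the weighted right-hand sides cancel.\<close>

lemma entropy2_le_ln2:
  assumes "0 < p" "p < 1"
  shows "entropy2 p \<le> ln 2"
proof -
  have "p * ln (1 / (2 * p)) \<le> p * (1 / (2 * p) - 1)"
    using assms by (intro mult_left_mono ln_le_minus_one) auto
  moreover have "(1 - p) * ln (1 / (2 * (1 - p))) \<le> (1 - p) * (1 / (2 * (1 - p)) - 1)"
    using assms by (intro mult_left_mono ln_le_minus_one) auto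
  moreover have "ln (1 / (2 * p)) = - ln 2 - ln p" "ln (1 / (2 * (1 - p))) = - ln 2 - ln (1 - p)"
    using assms by (simp_all only: ln_div ln_mult ln_one) simp_all
  moreover have "p * (1 / (2 * p) - 1) = 1 / 2 - p" "(1 - p) * (1 / (2 * (1 - p)) - 1) = p - 1 / 2"
    using assms by (simp_all add: field_simps)
  ultimately have "p * (- ln 2 - ln p) + (1 - p) * (- ln 2 - ln (1 - p)) \<le> 0"
    by (simp only:)
  then show ?thesis by (simp add: entropy2_def algebra_simps)
qed

text \<open>With a = sqrt p and b = sqrt (1-p), the inequality ln (1/x) <= 1/x - 1 at a and b bounds
  the entropy by 2(a + b - 1), and (1-a)(1-b) >= 0 says that a + b - 1 <= ab. A square root is the
  shape with which a square can be completed for negative s.\<close>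

lemma entropy2_le_sqrt:
  assumes "0 < p" "p < 1"
  shows "entropy2 p \<le> 2 * sqrt (p * (1 - p))"
proof -
  define a b where "a = sqrt p" and "b = sqrt (1 - p)"
  have ab: "0 < a" "0 < b" "a\<^sup>2 = p" "b\<^sup>2 = 1 - p" "a\<^sup>2 + b\<^sup>2 = 1"
    using assms by (auto simp: a_def b_def)
  have lnx: "- (x\<^sup>2) * ln (x\<^sup>2) \<le> 2 * (x - x\<^sup>2)" if "0 < x" for x :: real
  proof -
    have "ln (1 / x) \<le> 1 / x - 1" using that by (intro ln_le_minus_one) auto
    then have "2 * x\<^sup>2 * ln (1 / x) \<le> 2 * x\<^sup>2 * (1 / x - 1)"
      by (intro mult_left_mono) auto
    moreover have "ln (x\<^sup>2) = 2 * ln x" "ln (1 / x) = - ln x"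
      using that by (simp_all add: ln_realpow ln_div)
    moreover have "2 * x\<^sup>2 * (1 / x - 1) = 2 * (x - x\<^sup>2)"
      using that by (simp add: power2_eq_square field_simps)
    ultimately show ?thesis by simp
  qed
  have ab1: "a < 1" "b < 1" using assms by (auto simp: a_def b_def)
  have "entropy2 p \<le> 2 * (a - a\<^sup>2) + 2 * (b - b\<^sup>2)"
    using lnx[OF ab(1)] lnx[OF ab(2)] unfolding ab(3,4) entropy2_def by (simp add: algebra_simps)
  also have "\<dots> \<le> 2 * (a * b)"
  proof -
    have "0 \<le> (1 - a) * (1 - b)" using ab1 by simp
    then show ?thesis using ab(5) by (simp add: algebra_simps)
  qed
  also have "a * b = sqrt (p * (1 - p))" by (simp add: a_def b_def real_sqrt_mult)
  finally show ?thesis .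
qed

lemma qs_toll_le_1:
  assumes "k < n"
  shows "qs_toll n k \<le> 1"
proof -
  have "toll_part n j \<le> 0" if "j < n" for j
  proof -
    have "harm (Suc j) \<le> (harm (Suc n) :: real)" using that by (intro harm_mono) auto
    then show ?thesis using qs_node_bounds[OF that] by (auto simp: toll_part_def intro!: mult_nonneg_nonpos)
  qed
  from this[of k] this[of "n - Suc k"] show ?thesis using assms by (simp add: qs_toll_eq)
qed

lemma toll_part_ge:
  assumes "k < n"
  shows "toll_part n k \<ge> qs_node n k * ln (qs_node n k)"
proof -
  have "harm (Suc n) - harm (Suc k) \<le> - ln (qs_node n k)"
    using harm_diff_le_ln[of "Suc k" "Suc n"] assms by (simp add: qs_node_def ln_div)
  then show ?thesis using qs_node_bounds[OF assms]
    by (auto simp: toll_part_def intro!: mult_left_mono)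
qed

lemma qs_toll_ge_entropy:
  assumes "k < n"
  shows "qs_toll n k \<ge> 1 - 2 * entropy2 (qs_node n k)"
  using toll_part_ge[OF assms] toll_part_ge[of "n - Suc k" n] assms
  by (simp add: qs_toll_eq entropy2_def qs_node_reflect)

text \<open>The constant comes from 1 - 2 ln 2 >= 1 - 50/36, which is just above -2/5.\<close>

lemma qs_toll_ge: "k < n \<Longrightarrow> qs_toll n k \<ge> - (2 / 5)"
  using qs_toll_ge_entropy[of k n] entropy2_le_ln2[OF qs_node_bounds, of k n] ln2_le_25_over_36
  by linarith

lemma qs_toll_ge_sqrt: "k < n \<Longrightarrow> qs_toll n k \<ge> 1 - 4 * sqrt (qs_node n k * (1 - qs_node n k))"
  using qs_toll_ge_entropy[of k n] entropy2_le_sqrt[OF qs_node_bounds, of k n]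
  by linarith

lemma sum_qs_node_mult: "(\<Sum>k<n. qs_node n k * (1 - qs_node n k)) = real n * (real n + 2) / (6 * (real n + 1))"
proof -
  \<comment> \<open>N is kept independent of the upper limit m so that induction on m goes
    through.\<close>
  have "(\<Sum>k<m. real (Suc k) * (N - real (Suc k))) = N * real m * (real m + 1) / 2 - real m * (real m + 1) * (2 * real m + 1) / 6" for N m
    by (induction m) (auto simp: field_simps)
  from this[of "real (Suc n)" n]
  have *: "(\<Sum>k<n. real (Suc k) * (real (Suc n) - real (Suc k))) = real n * (real n + 1) * (real n + 2) / 6"
    by (simp only:) (simp add: field_simps)
  have "(\<Sum>k<n. qs_node n k * (1 - qs_node n k)) = (\<Sum>k<n. real (Suc k) * (real (Suc n) - real (Suc k))) / (real n + 1)^2"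
    unfolding sum_divide_distrib
    by (intro sum.cong refl) (simp add: qs_node_def field_simps power2_eq_square)
  also have "\<dots> = real n * (real n + 2) / (6 * (real n + 1))"
    unfolding * by (simp add: divide_simps power2_eq_square)
  finally show ?thesis .
qed

section \<open>The recursion for the moment generating function\<close>

definition centered_mgf :: "nat \<Rightarrow> real \<Rightarrow> real" where
  "centered_mgf n s = measure_pmf.expectation (quicksort_pmf n)
     (\<lambda>x. exp (s * ((real x - qs_mean n) / real (Suc n))))"

lemma expectation_pair_pmf_mult:
  fixes f g :: "nat \<Rightarrow> real"
  shows "measure_pmf.expectation (pair_pmf (quicksort_pmf i) (quicksort_pmf j)) (\<lambda>(a, b). f a * g b)
    = measure_pmf.expectation (quicksort_pmf i) f * measure_pmf.expectation (quicksort_pmf j) g"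
proof -
  have "pair_pmf (quicksort_pmf i) (quicksort_pmf j)
      = bind_pmf (quicksort_pmf i) (\<lambda>a. map_pmf (Pair a) (quicksort_pmf j))"
    by (simp add: pair_pmf_def map_pmf_def)
  then show ?thesis
    by (simp add: pmf_expectation_bind[where A = "set_pmf (quicksort_pmf i)"]
        integral_measure_pmf_real[where A = "set_pmf (quicksort_pmf i)"] sum_distrib_left ac_simps)
qed

lemma centered_mgf_rec:
  assumes "0 < n"
  shows "centered_mgf n s = (\<Sum>k<n. centered_mgf k (s * qs_node n k) * centered_mgf (n - Suc k) (s * (1 - qs_node n k))
           * exp (s * qs_toll n k)) / real n"
proof -
  obtain m where m: "n = Suc m" using assms gr0_conv_Suc by blast
  have "measure_pmf.expectation (pair_pmf (quicksort_pmf k) (quicksort_pmf (m - k)))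
     (\<lambda>(a, b). exp (s * ((real (a + b + m) - qs_mean n) / real (Suc n)))) =
     centered_mgf k (s * qs_node n k) * centered_mgf (n - Suc k) (s * (1 - qs_node n k)) * exp (s * qs_toll n k)"
    if "k < n" for k
  proof -
    have eq: "s * ((real (a + b + m) - qs_mean n) / real (Suc n))
       = (s * qs_node n k) * ((real a - qs_mean k) / real (Suc k))
       + (s * (1 - qs_node n k)) * ((real b - qs_mean (n - Suc k)) / real (Suc (n - Suc k)))
       + s * qs_toll n k" for a b
    proof -
      have 1: "qs_node n k * ((real a - qs_mean k) / real (Suc k)) = (real a - qs_mean k) / real (Suc n)"
        by (simp add: qs_node_def)
      have 2: "(1 - qs_node n k) * ((real b - qs_mean (n - Suc k)) / real (Suc (n - Suc k)))
          = (real b - qs_mean (n - Suc k)) / real (Suc n)"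
        unfolding qs_node_reflect[OF that, symmetric] by (simp add: qs_node_def)
      have "(real (a + b + m) - qs_mean n) / real (Suc n) = (real a - qs_mean k) / real (Suc n)
          + (real b - qs_mean (n - Suc k)) / real (Suc n) + qs_toll n k"
        by (simp add: qs_toll_def m add_divide_distrib[symmetric] diff_divide_distrib[symmetric] algebra_simps)
      then show ?thesis using 1 2 by (simp only: mult.assoc distrib_left)
    qed
    show ?thesis
      unfolding eq exp_add centered_mgf_def expectation_pair_pmf_mult[symmetric]
      by (simp add: m case_prod_beta')
  qed
  then show ?thesis
    unfolding m centered_mgf_def[of "Suc m"]
    by (subst expectation_quicksort_pmf_Suc) (auto simp del: sum.lessThan_Suc intro!: sum.cong)
qed

lemma centered_mgf_0 [simp]: "centered_mgf 0 s = 1"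
  by (simp add: centered_mgf_def qs_mean_def harm_def)

lemma centered_mgf_nonneg: "0 \<le> centered_mgf n s"
  by (simp add: centered_mgf_def)

section \<open>Bounding the moment generating function\<close>

text \<open>For x >= 0 Taylor's formula is applied to e^(-x), whose cubic polynomial is a lower
  bound free of any unknown remainder. Its product with the claimed bound for e^x is 1 + x^2 (1/6 -
  x/3 + x^2/6 - x^3/9), and the factor in brackets drops to 1/375 at x = 3/5, so this argument
  hardly reaches further.\<close>

lemma exp_le_quadratic:
  fixes x :: real
  assumes "x \<le> 3 / 5"
  shows "exp x \<le> 1 + x + 2 / 3 * x\<^sup>2"
proof (cases "0 \<le> x")
  case True
  obtain t where t: "exp (- x) = (\<Sum>m<4. (- x) ^ m / fact m) + exp t / fact 4 * (- x) ^ 4"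
    using Maclaurin_exp_le[of "- x" 4] by blast
  have "exp t / fact 4 * (- x) ^ 4 \<ge> 0" by simp
  then have 1: "exp (- x) \<ge> 1 - x + x\<^sup>2 / 2 - x ^ 3 / 6"
    using t by (simp add: numeral_eq_Suc)
  \<comment> \<open>Both this estimate of x^2 and the following one of x^3 are equalities at the
    critical end x = 3/5.\<close>
  have "0 \<le> (3 / 5 - x) * (1 - x)" using True assms by simp
  then have a: "x\<^sup>2 \<ge> 8 / 5 * x - 3 / 5" by (simp add: power2_eq_square field_simps)
  have b: "x ^ 3 \<le> 9 / 25 * x"
  proof -
    have "x\<^sup>2 \<le> (3 / 5)\<^sup>2" using True assms by (intro power_mono) auto
    then have "x * x\<^sup>2 \<le> x * (9 / 25)" using True by (intro mult_left_mono) (auto simp: power2_eq_square)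
    then show ?thesis by (simp add: power3_eq_cube power2_eq_square)
  qed
  have q: "0 \<le> 1 / 6 - x / 3 + x\<^sup>2 / 6 - x ^ 3 / 9"
    using a b assms by simp
  have "1 \<le> 1 + x\<^sup>2 * (1 / 6 - x / 3 + x\<^sup>2 / 6 - x ^ 3 / 9)"
    using q by (simp add: mult_nonneg_nonneg)
  also have "\<dots> = (1 + x + 2 / 3 * x\<^sup>2) * (1 - x + x\<^sup>2 / 2 - x ^ 3 / 6)"
    by (simp add: algebra_simps power2_eq_square power3_eq_cube)
  also have "\<dots> \<le> (1 + x + 2 / 3 * x\<^sup>2) * exp (- x)"
    using 1 True by (intro mult_left_mono) auto
  finally show ?thesis by (simp add: exp_minus field_simps)
next
  case False
  obtain t where t: "exp x = (\<Sum>m<3. x ^ m / fact m) + exp t / fact 3 * x ^ 3"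
    using Maclaurin_exp_le[of x 3] by blast
  have "exp t / fact 3 * x ^ 3 \<le> 0" using False by (intro mult_nonneg_nonpos) (auto simp: power3_eq_cube mult_nonneg_nonpos mult_nonpos_nonpos)
  then have "exp x \<le> 1 + x + x\<^sup>2 / 2"
    using t by (simp add: numeral_eq_Suc)
  also have "\<dots> \<le> 1 + x + 2 / 3 * x\<^sup>2" by simp
  finally show ?thesis .
qed

section \<open>Arguments near 0\<close>

lemma qs_node_mult_bounds:
  assumes "k < n"
  shows "0 \<le> qs_node n k * (1 - qs_node n k)" "qs_node n k * (1 - qs_node n k) \<le> 1 / 4"
proof -
  show "0 \<le> qs_node n k * (1 - qs_node n k)" using qs_node_bounds[OF assms] by simp
  have "0 \<le> (qs_node n k - 1 / 2)\<^sup>2" by simp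
  then show "qs_node n k * (1 - qs_node n k) \<le> 1 / 4" by (simp add: power2_eq_square algebra_simps)
qed

text \<open>The subtracted term is what the trial exponent 3 s^2 loses by splitting, since p^2 +
  (1-p)^2 = 1 - 2p(1-p). The quadratic bound for exp is made linear in the toll c and in q = p(1-p),
  so that the sum over k is settled by sum c = 0 and sum q >= n/6.\<close>

lemma sum_exp_toll_small:
  assumes s: "- (2 / 5) \<le> s" "s \<le> 3 / 5"
  shows "(\<Sum>k<n. exp (s * qs_toll n k - 6 * s\<^sup>2 * (qs_node n k * (1 - qs_node n k)))) \<le> real n"
proof -
  define q where "q k = qs_node n k * (1 - qs_node n k)" for k
  have s2: "s\<^sup>2 \<le> (3 / 5)\<^sup>2" using s by (intro abs_le_square_iff[THEN iffD1]) auto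
  have term_le: "exp (s * qs_toll n k - 6 * s\<^sup>2 * q k) \<le> 1 + (s * qs_toll n k - 6 * s\<^sup>2 * q k)
      + 2 / 3 * s\<^sup>2 * (2 / 5 + 3 / 5 * qs_toll n k + 156 / 25 * q k)" if k: "k < n" for k
  proof -
    define c where "c = qs_toll n k"
    have c: "- (2 / 5) \<le> c" "c \<le> 1" using qs_toll_ge[OF k] qs_toll_le_1[OF k] by (auto simp: c_def)
    have q: "0 \<le> q k" "q k \<le> 1 / 4" using qs_node_mult_bounds[OF k] by (auto simp: q_def)
    have qq: "s\<^sup>2 * (q k)\<^sup>2 \<le> s\<^sup>2 * (q k / 4)"
      using q by (intro mult_left_mono) (auto simp: power2_eq_square intro: mult_left_mono[of "q k" "1/4" "q k", simplified])
    have "s * c \<le> 3 / 5"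
    proof (cases "0 \<le> s")
      case True
      then have "s * c \<le> s * 1" using c by (intro mult_left_mono) auto
      then show ?thesis using s by simp
    next
      case False
      then have "s * c \<le> s * (- (2 / 5))" using c by (intro mult_left_mono_neg) auto
      then show ?thesis using s by simp
    qed
    moreover have "0 \<le> 6 * s\<^sup>2 * q k" using q by simp
    ultimately have ub: "exp (s * c - 6 * s\<^sup>2 * q k) \<le> 1 + (s * c - 6 * s\<^sup>2 * q k) + 2 / 3 * (s * c - 6 * s\<^sup>2 * q k)\<^sup>2"
      by (intro exp_le_quadratic) linarith
    have "(s * c - 6 * s\<^sup>2 * q k)\<^sup>2 = s\<^sup>2 * (c\<^sup>2 - 12 * (s * c) * q k + 36 * (s\<^sup>2 * (q k)\<^sup>2))"
      by (simp add: power2_eq_square algebra_simps)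
    also have "\<dots> \<le> s\<^sup>2 * (2 / 5 + 3 / 5 * c + 156 / 25 * q k)"
    proof (rule mult_left_mono)
      \<comment> \<open>The toll lies in [-2/5, 1], and the chord of c^2 over this interval is
        linear in c.\<close>
      have "0 \<le> (1 - c) * (c + 2 / 5)" using c by simp
      then have "c\<^sup>2 \<le> 2 / 5 + 3 / 5 * c" by (simp add: power2_eq_square field_simps)
      \<comment> \<open>The term 9 s^2 q stems from 36 s^2 q^2 with q <= 1/4. The value 156/25 is
        the worst case s = -2/5, c = 1.\<close>
      moreover have "- 12 * (s * c) * q k + 9 * s\<^sup>2 * q k \<le> 156 / 25 * q k"
      proof -
        have "- 12 * (s * c) + 9 * s\<^sup>2 \<le> 156 / 25"
        proof (cases "0 \<le> s")
          case True
          then have "s * (- c) \<le> s * (2 / 5)" using c by (intro mult_left_mono) auto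
          then show ?thesis using s s2 by (simp add: power2_eq_square)
        next
          case False
          then have "(- s) * c \<le> (- s) * 1" using c by (intro mult_left_mono) auto
          moreover have "s\<^sup>2 \<le> (2 / 5)\<^sup>2" using s False by (intro abs_le_square_iff[THEN iffD1]) auto
          ultimately show ?thesis using s by (simp add: power2_eq_square)
        qed
        then have "(- 12 * (s * c) + 9 * s\<^sup>2) * q k \<le> 156 / 25 * q k" using q by (intro mult_right_mono)
        then show ?thesis by (simp add: algebra_simps)
      qed
      ultimately show "c\<^sup>2 - 12 * (s * c) * q k + 36 * (s\<^sup>2 * (q k)\<^sup>2) \<le> 2 / 5 + 3 / 5 * c + 156 / 25 * q k"
        using qq by linarith
    qed simp
    finally show ?thesis using ub unfolding c_def[symmetric] by linarith
  qed
  have "(\<Sum>k<n. exp (s * qs_toll n k - 6 * s\<^sup>2 * q k)) \<le> (\<Sum>k<n. 1 + (s * qs_toll n k - 6 * s\<^sup>2 * q k)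
      + 2 / 3 * s\<^sup>2 * (2 / 5 + 3 / 5 * qs_toll n k + 156 / 25 * q k))"
    by (intro sum_mono term_le) auto
  also have "\<dots> = (\<Sum>k<n. 1 + 4 / 15 * s\<^sup>2 + (s + 2 / 5 * s\<^sup>2) * qs_toll n k - 46 / 25 * s\<^sup>2 * q k)"
    by (intro sum.cong) (auto simp: algebra_simps)
  also have "\<dots> = real n * (1 + 4 / 15 * s\<^sup>2) + (s + 2 / 5 * s\<^sup>2) * (\<Sum>k<n. qs_toll n k) - 46 / 25 * s\<^sup>2 * (\<Sum>k<n. q k)"
    by (simp add: sum.distrib sum_subtractf sum_distrib_left)
  also have "\<dots> = real n + s\<^sup>2 * (4 / 15 * real n - 46 / 25 * (\<Sum>k<n. q k))"
    by (simp add: sum_qs_toll algebra_simps)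
  also have "\<dots> \<le> real n"
  proof -
    \<comment> \<open>Here 4/15 = (2/3)(2/5) competes with 46/25 = 6 - (2/3)(156/25) times the
      average of q, which is at least 1/6.\<close>
    have "(\<Sum>k<n. q k) \<ge> real n / 6"
      unfolding q_def sum_qs_node_mult by (simp add: divide_simps) (simp add: algebra_simps)
    then have "4 / 15 * real n - 46 / 25 * (\<Sum>k<n. q k) \<le> 0" by simp
    then show ?thesis by (simp add: mult_nonneg_nonpos)
  qed
  finally show ?thesis by (simp add: q_def)
qed

text \<open>The set S must be closed under shrinking towards 0 because the recursion evaluates the
  trial exponent at s p and s (1-p). The disjunction in \<open>step\<close> lets a bound obtained
  elsewhere take over on a part of S.\<close>

lemma centered_mgf_le_by_induction:
  assumes base: "0 \<le> \<beta> 0" "\<And>s. s \<in> S \<Longrightarrow> 0 \<le> \<beta> s"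
    and scale: "\<And>s p. s \<in> S \<Longrightarrow> 0 \<le> p \<Longrightarrow> p \<le> 1 \<Longrightarrow> s * p \<in> S"
    and step: "\<And>n s. 0 < n \<Longrightarrow> s \<in> S \<Longrightarrow>
      (\<Sum>k<n. exp (\<beta> (s * qs_node n k) + \<beta> (s * (1 - qs_node n k)) + s * qs_toll n k)) \<le> real n * exp (\<beta> s)
      \<or> centered_mgf n s \<le> exp (\<beta> s)"
    and "s \<in> S"
  shows "centered_mgf n s \<le> exp (\<beta> s)"
  using \<open>s \<in> S\<close>
proof (induction n arbitrary: s rule: less_induct)
  case (less n)
  show ?case
  proof (cases "n = 0")
    case True
    then show ?thesis using base less.prems by simp
  next
    case False
    from step[of n s] False less.prems consider "centered_mgf n s \<le> exp (\<beta> s)"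
      | "(\<Sum>k<n. exp (\<beta> (s * qs_node n k) + \<beta> (s * (1 - qs_node n k)) + s * qs_toll n k)) \<le> real n * exp (\<beta> s)"
      by blast
    then show ?thesis
    proof cases
      case 2
      have "real n * centered_mgf n s = (\<Sum>k<n. centered_mgf k (s * qs_node n k) * centered_mgf (n - Suc k) (s * (1 - qs_node n k))
           * exp (s * qs_toll n k))"
        using centered_mgf_rec[of n s] False by simp
      also have "\<dots> \<le> (\<Sum>k<n. exp (\<beta> (s * qs_node n k)) * exp (\<beta> (s * (1 - qs_node n k))) * exp (s * qs_toll n k))"
        using less qs_node_bounds
        by (intro sum_mono mult_right_mono mult_mono less.IH scale centered_mgf_nonneg) (auto intro: less_imp_le)
      also have "\<dots> \<le> real n * exp (\<beta> s)"
        using 2 by (simp add: exp_add mult.assoc)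
      finally show ?thesis using False by simp
    qed
  qed
qed

text \<open>Near $0$ the first-order term of $e^{s c_k}$ must cancel through $\sum_k c_k = 0$; the pointwise bounds used for the other $s$ are too weak there.\<close>

lemma centered_mgf_le_small:
  assumes "- (2 / 5) \<le> s" "s \<le> 3 / 5"
  shows "centered_mgf n s \<le> exp (3 * s\<^sup>2)"
proof (rule centered_mgf_le_by_induction[where \<beta> = "\<lambda>s. 3 * s\<^sup>2" and S = "{- (2 / 5)..3 / 5}"])
  fix s p :: real assume s: "s \<in> {- (2 / 5)..3 / 5}" and p: "0 \<le> p" "p \<le> 1"
  show "s * p \<in> {- (2 / 5)..3 / 5}"
  proof (cases "0 \<le> s")
    case True
    then have "0 \<le> s * p" "s * p \<le> s" using p by (auto simp: mult_left_le)
    then show ?thesis using s by auto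
  next
    case False
    then have "s * p \<le> 0" "s * p \<ge> s * 1" using p by (auto simp: mult_nonpos_nonneg intro: mult_left_mono_neg)
    then show ?thesis using s by auto
  qed
next
  fix n :: nat and s :: real assume n: "0 < n" and s: "s \<in> {- (2 / 5)..3 / 5}"
  have "(\<Sum>k<n. exp (3 * (s * qs_node n k)\<^sup>2 + 3 * (s * (1 - qs_node n k))\<^sup>2 + s * qs_toll n k))
     = exp (3 * s\<^sup>2) * (\<Sum>k<n. exp (s * qs_toll n k - 6 * s\<^sup>2 * (qs_node n k * (1 - qs_node n k))))"
    unfolding sum_distrib_left exp_add[symmetric]
    by (intro sum.cong refl arg_cong[where f = exp]) (simp add: power2_eq_square algebra_simps)
  also have "\<dots> \<le> exp (3 * s\<^sup>2) * real n"
    using s by (intro mult_left_mono sum_exp_toll_small) auto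
  finally show "(\<Sum>k<n. exp (3 * (s * qs_node n k)\<^sup>2 + 3 * (s * (1 - qs_node n k))\<^sup>2 + s * qs_toll n k)) \<le> real n * exp (3 * s\<^sup>2)
     \<or> centered_mgf n s \<le> exp (3 * s\<^sup>2)" by (simp add: mult.commute)
qed (use assms in auto)

text \<open>On [3/5, 5] the term 2 e^s stays below 12 s^2, but near 0 it is larger. The threshold 5
  therefore keeps the exponent quadratic around 0, where \<open>log_mgf_bound_scale\<close> forces
  the value 0, and still makes it the maximum of both terms from 3/5 on.\<close>

definition log_mgf_bound :: "real \<Rightarrow> real" where
  "log_mgf_bound s = (if s \<le> 5 then 12 * s\<^sup>2 else max (12 * s\<^sup>2) (2 * exp s))"

text \<open>After taking square roots the convex function e^(x/2) is compared with the linear sqrt 6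
  * x, so the two endpoints decide. At 5 this is tight: e^5 is about 148.4, against 150.\<close>

lemma exp_le_6_square:
  fixes x :: real
  assumes "3 / 5 \<le> x" "x \<le> 5"
  shows "exp x \<le> 6 * x\<^sup>2"
proof -
  define t where "t = (x - 3 / 5) / (22 / 5)"
  have t: "0 \<le> t" "t \<le> 1" "x / 2 = (1 - t) * (3 / 10) + t * (5 / 2)" "x = (1 - t) * (3 / 5) + t * 5"
    using assms by (auto simp: t_def field_simps)
  have e5: "exp (5::real) \<le> 150"
  proof -
    have "exp (5::real) = exp 1 ^ 5" by (simp add: exp_of_nat_mult[symmetric])
    also have "\<dots> \<le> (272 / 100) ^ 5" using e_less_272 by (intro power_mono) auto
    also have "\<dots> \<le> 150" by (simp add: power_numeral_reduce field_simps)
    finally show ?thesis .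
  qed
  have "(exp (5 / 2))\<^sup>2 \<le> (sqrt 6 * 5 :: real)\<^sup>2"
    using e5 by (simp add: exp_double[symmetric] power_mult_distrib)
  then have 1: "exp (5 / 2) \<le> sqrt 6 * (5::real)" by (rule power2_le_imp_le) auto
  have "exp (3 / 5 :: real) \<le> 1 + 3 / 5 + (3 / 5)\<^sup>2" by (rule exp_bound) auto
  then have "(exp (3 / 10))\<^sup>2 \<le> (sqrt 6 * (3 / 5) :: real)\<^sup>2"
    by (simp add: exp_double[symmetric] power_mult_distrib) (simp add: power2_eq_square)
  then have 2: "exp (3 / 10) \<le> sqrt 6 * (3 / 5 :: real)" by (rule power2_le_imp_le) auto
  have "exp (x / 2) \<le> (1 - t) * exp (3 / 10) + t * exp (5 / 2)"
    unfolding t(3) using convex_onD[OF exp_convex, of t "3 / 10" "5 / 2"] t(1,2) by simp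
  also have "\<dots> \<le> (1 - t) * (sqrt 6 * (3 / 5)) + t * (sqrt 6 * 5)"
    using t 1 2 by (intro add_mono mult_left_mono) auto
  also have "\<dots> = sqrt 6 * x" by (subst t(4)) (simp add: algebra_simps)
  finally have "(exp (x / 2))\<^sup>2 \<le> (sqrt 6 * x)\<^sup>2" by (intro power_mono) auto
  then show ?thesis by (simp add: exp_double[symmetric] power_mult_distrib)
qed

section \<open>Scaling, convexity and gap of the exponent\<close>

lemma log_mgf_bound_ge_quad: "12 * s\<^sup>2 \<le> log_mgf_bound s"
  by (simp add: log_mgf_bound_def)

lemma log_mgf_bound_nonneg: "0 \<le> log_mgf_bound s"
  using log_mgf_bound_ge_quad[of s] by (meson order_trans zero_le_mult_iff zero_le_numeral zero_le_power2)

lemma log_mgf_bound_eq_max: "1 \<le> s \<Longrightarrow> log_mgf_bound s = max (12 * s\<^sup>2) (2 * exp s)"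
  using exp_le_6_square[of s] by (auto simp: log_mgf_bound_def)

text \<open>For the exponential term, exp y >= 1 + y at y = x (1 - \<theta>) reduces the claim to (1
  - \<theta>) (\<theta> x - 1) >= 0, and there \<theta> x > 5.\<close>

lemma log_mgf_bound_scale:
  assumes "0 \<le> \<theta>" "\<theta> \<le> 1" "0 \<le> x"
  shows "log_mgf_bound (\<theta> * x) \<le> \<theta> * log_mgf_bound x"
proof -
  have quad: "12 * (\<theta> * x)\<^sup>2 \<le> \<theta> * (12 * x\<^sup>2)"
  proof -
    have "\<theta> * (\<theta> * x\<^sup>2) \<le> 1 * (\<theta> * x\<^sup>2)" using assms by (intro mult_right_mono) auto
    then show ?thesis by (simp add: power2_eq_square algebra_simps)
  qed
  also have "\<dots> \<le> \<theta> * log_mgf_bound x" using assms log_mgf_bound_ge_quad by (intro mult_left_mono)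
  finally have q: "12 * (\<theta> * x)\<^sup>2 \<le> \<theta> * log_mgf_bound x" .
  show ?thesis
  proof (cases "\<theta> * x \<le> 5")
    case True
    then show ?thesis using q by (simp add: log_mgf_bound_def)
  next
    case False
    then have x: "5 < x" using mult_right_mono[of \<theta> 1 x] assms by linarith
    have "1 \<le> \<theta> * (1 + x * (1 - \<theta>))"
    proof -
      have "(1 - \<theta>) * 1 \<le> (1 - \<theta>) * (\<theta> * x)" using False assms by (intro mult_left_mono) auto
      then show ?thesis by (simp add: algebra_simps)
    qed
    also have "\<dots> \<le> \<theta> * exp (x * (1 - \<theta>))"
      using assms by (intro mult_left_mono exp_ge_add_one_self)
    finally have "exp (\<theta> * x) * 1 \<le> exp (\<theta> * x) * (\<theta> * exp (x * (1 - \<theta>)))"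
      by (intro mult_left_mono) auto
    also have "\<dots> = \<theta> * exp x" by (simp add: exp_add[symmetric] algebra_simps)
    finally have "2 * exp (\<theta> * x) \<le> \<theta> * (2 * exp x)" by simp
    also have "\<dots> \<le> \<theta> * log_mgf_bound x" using x assms by (intro mult_left_mono) (auto simp: log_mgf_bound_def)
    finally show ?thesis using q False by (simp add: log_mgf_bound_def)
  qed
qed

text \<open>Up to s = 5 the whole segment from s/2 to s lies in the quadratic range; beyond, both of
  its ends exceed 1, where the exponent is a maximum of convex functions.\<close>

lemma log_mgf_bound_convex_half:
  assumes "0 \<le> \<theta>" "\<theta> \<le> 1" "0 \<le> s"
  shows "log_mgf_bound ((1 - \<theta>) * s + \<theta> * (s / 2)) \<le> (1 - \<theta>) * log_mgf_bound s + \<theta> * log_mgf_bound (s / 2)"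
proof -
  define y where "y = (1 - \<theta>) * s + \<theta> * (s / 2)"
  have quad: "12 * y\<^sup>2 \<le> (1 - \<theta>) * (12 * s\<^sup>2) + \<theta> * (12 * (s / 2)\<^sup>2)"
  proof -
    have "0 \<le> \<theta> * (1 - \<theta>) * s\<^sup>2" using assms by simp
    then show ?thesis by (simp add: y_def power2_eq_square algebra_simps)
  qed
  also have "\<dots> \<le> (1 - \<theta>) * log_mgf_bound s + \<theta> * log_mgf_bound (s / 2)"
    using assms by (intro add_mono mult_left_mono log_mgf_bound_ge_quad) auto
  finally have q: "12 * y\<^sup>2 \<le> (1 - \<theta>) * log_mgf_bound s + \<theta> * log_mgf_bound (s / 2)" .
  show ?thesis
  proof (cases "s \<le> 5")
    case True
    have "y \<le> s" using assms by (simp add: y_def algebra_simps)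
    then show ?thesis using q True by (simp add: log_mgf_bound_def y_def)
  next
    case False
    have "exp y \<le> (1 - \<theta>) * exp s + \<theta> * exp (s / 2)"
      unfolding y_def using convex_onD[OF exp_convex, of \<theta> s "s / 2"] assms by simp
    then have "2 * exp y \<le> (1 - \<theta>) * (2 * exp s) + \<theta> * (2 * exp (s / 2))" by simp
    also have "\<dots> \<le> (1 - \<theta>) * log_mgf_bound s + \<theta> * log_mgf_bound (s / 2)"
      using assms False by (intro add_mono mult_left_mono) (auto simp: log_mgf_bound_eq_max)
    finally show ?thesis using q by (simp add: log_mgf_bound_def y_def)
  qed
qed

text \<open>The origin of 12 and 3/5: for s <= 5 the difference D = 2 b(s) - 4 b(s/2) equals 12 s^2,
  so D >= 2 e^s is \<open>exp_le_6_square\<close>, and D >= 4 holds from 1/sqrt 3 on. For s > 5, if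
  the quadratic term dominates at s/2 then D = 2 b(s) - 12 s^2 >= b(s); otherwise 4 e^(s/2) <= e^s
  is used.\<close>

lemma log_mgf_bound_gap:
  assumes "3 / 5 \<le> s"
  shows "2 * exp s \<le> 2 * log_mgf_bound s - 4 * log_mgf_bound (s / 2)" "4 \<le> 2 * log_mgf_bound s - 4 * log_mgf_bound (s / 2)"
proof -
  have "2 * exp s \<le> 2 * log_mgf_bound s - 4 * log_mgf_bound (s / 2) \<and> 4 \<le> 2 * log_mgf_bound s - 4 * log_mgf_bound (s / 2)"
  proof (cases "s \<le> 5")
    case True
    have "(3 / 5)\<^sup>2 \<le> s\<^sup>2" using assms by (intro power_mono) auto
    then have "4 \<le> 12 * s\<^sup>2" by (simp add: power2_eq_square)
    then show ?thesis using True assms exp_le_6_square[of s] by (simp add: log_mgf_bound_def power2_eq_square)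
  next
    case False
    have e2: "4 \<le> exp (s / 2)"
    proof -
      have "(2::real) ^ 2 \<le> exp 1 ^ 2" using exp_ge_add_one_self[of "1::real"] by (intro power_mono) auto
      also have "\<dots> = exp (2::real)" by (simp add: exp_of_nat_mult[symmetric])
      also have "\<dots> \<le> exp (s / 2)" using False by simp
      finally show ?thesis by simp
    qed
    then have "4 * exp (s / 2) \<le> exp (s / 2) * exp (s / 2)" by (intro mult_right_mono) auto
    then have e: "4 * exp (s / 2) \<le> exp s" by (simp add: exp_add[symmetric])
    have b: "log_mgf_bound s \<ge> 12 * s\<^sup>2" "log_mgf_bound s \<ge> 2 * exp s" using False by (auto simp: log_mgf_bound_def)
    have "log_mgf_bound (s / 2) = max (3 * s\<^sup>2) (2 * exp (s / 2))"
      using False by (subst log_mgf_bound_eq_max) (auto simp: power2_eq_square)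
    then show ?thesis using e e2 b by (auto simp: max_def)
  qed
  then show "2 * exp s \<le> 2 * log_mgf_bound s - 4 * log_mgf_bound (s / 2)" "4 \<le> 2 * log_mgf_bound s - 4 * log_mgf_bound (s / 2)" by auto
qed

lemma sum_power_Suc_le:
  fixes y :: real
  assumes "0 \<le> y" "y < 1"
  shows "(\<Sum>k<n. y ^ Suc k) \<le> y / (1 - y)"
proof -
  have "(\<Sum>k<n. y ^ Suc k) = y * ((1 - y ^ n) / (1 - y))"
    using assms by (simp add: sum_distrib_left[symmetric] sum_gp_strict)
  also have "\<dots> \<le> y * (1 / (1 - y))"
    using assms by (intro mult_left_mono divide_right_mono) auto
  finally show ?thesis by simp
qed

text \<open>By convexity, $b(s p) + b(s (1 - p)) \le b(s) - p D$ for $p \le 1/2$ with $D = 2 b(s) - 4 b(s/2)$, so the sum is dominated by two geometric series with ratio $e^{-D/(n+1)}$; this needs $2 e^s \le D$.\<close>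

lemma sum_exp_toll_large:
  assumes s: "3 / 5 \<le> s" and n: "0 < n"
  shows "(\<Sum>k<n. exp (log_mgf_bound (s * qs_node n k) + log_mgf_bound (s * (1 - qs_node n k)) + s * qs_toll n k)) \<le> real n * exp (log_mgf_bound s)"
proof -
  define D where "D = 2 * log_mgf_bound s - 4 * log_mgf_bound (s / 2)"
  define N where "N = real (Suc n)"
  define y where "y = exp (- D / N)"
  have D: "2 * exp s \<le> D" "4 \<le> D" using log_mgf_bound_gap[OF s] by (auto simp: D_def)
  have N: "0 < N" by (simp add: N_def)
  \<comment> \<open>With \<theta> = 2p the point s p is \<theta> (s/2), and s (1-p) is the mixture
    (1 - \<theta>) s + \<theta> (s/2).\<close>
  have gap: "log_mgf_bound (s * p) + log_mgf_bound (s * (1 - p)) \<le> log_mgf_bound s - p * D" if "0 \<le> p" "p \<le> 1 / 2" for p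
  proof -
    have "log_mgf_bound (s * p) \<le> 2 * p * log_mgf_bound (s / 2)"
      using log_mgf_bound_scale[of "2 * p" "s / 2"] that s by (simp add: mult.commute)
    moreover have "log_mgf_bound (s * (1 - p)) \<le> (1 - 2 * p) * log_mgf_bound s + 2 * p * log_mgf_bound (s / 2)"
      using log_mgf_bound_convex_half[of "2 * p" s] that s by (simp add: algebra_simps)
    ultimately show ?thesis by (simp add: D_def algebra_simps)
  qed
  have yp: "y ^ Suc k = exp (- (qs_node n k * D))" for k
    by (simp only: y_def exp_of_nat_mult[symmetric]) (simp add: qs_node_def N_def)
  have term_le: "exp (log_mgf_bound (s * qs_node n k) + log_mgf_bound (s * (1 - qs_node n k)) + s * qs_toll n k)
     \<le> exp (log_mgf_bound s) * exp s * (y ^ Suc k + y ^ Suc (n - Suc k))" if k: "k < n" for k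
  proof -
    have sc: "s * qs_toll n k \<le> s * 1" using qs_toll_le_1[OF k] s by (intro mult_left_mono) auto
    have "exp (log_mgf_bound (s * qs_node n k) + log_mgf_bound (s * (1 - qs_node n k)))
        \<le> exp (log_mgf_bound s) * (y ^ Suc k + y ^ Suc (n - Suc k))"
    proof (cases "qs_node n k \<le> 1 / 2")
      case True
      have "exp (log_mgf_bound (s * qs_node n k) + log_mgf_bound (s * (1 - qs_node n k))) \<le> exp (log_mgf_bound s) * y ^ Suc k"
        unfolding yp exp_add[symmetric] using gap[of "qs_node n k"] True qs_node_bounds[OF k] by simp
      also have "\<dots> \<le> exp (log_mgf_bound s) * (y ^ Suc k + y ^ Suc (n - Suc k))"
        by (intro mult_left_mono) (auto simp: y_def)
      finally show ?thesis .
    next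
      case False
      have "exp (log_mgf_bound (s * qs_node n k) + log_mgf_bound (s * (1 - qs_node n k))) \<le> exp (log_mgf_bound s) * y ^ Suc (n - Suc k)"
        unfolding yp exp_add[symmetric] using gap[of "1 - qs_node n k"] False qs_node_bounds[OF k]
        by (simp add: qs_node_reflect[OF k])
      also have "\<dots> \<le> exp (log_mgf_bound s) * (y ^ Suc k + y ^ Suc (n - Suc k))"
        by (intro mult_left_mono) (auto simp: y_def)
      finally show ?thesis .
    qed
    then have "exp (log_mgf_bound (s * qs_node n k) + log_mgf_bound (s * (1 - qs_node n k))) * exp (s * qs_toll n k)
        \<le> exp (log_mgf_bound s) * (y ^ Suc k + y ^ Suc (n - Suc k)) * exp s"
      using sc by (intro mult_mono) (auto simp: y_def)
    then show ?thesis by (simp add: exp_add ac_simps)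
  qed
  have "(\<Sum>k<n. exp (log_mgf_bound (s * qs_node n k) + log_mgf_bound (s * (1 - qs_node n k)) + s * qs_toll n k))
     \<le> (\<Sum>k<n. exp (log_mgf_bound s) * exp s * (y ^ Suc k + y ^ Suc (n - Suc k)))"
    by (intro sum_mono term_le) auto
  also have "\<dots> = exp (log_mgf_bound s) * exp s * ((\<Sum>k<n. y ^ Suc k) + (\<Sum>k<n. y ^ Suc (n - Suc k)))"
    by (simp only: sum.distrib[symmetric] sum_distrib_left)
  also have "(\<Sum>k<n. y ^ Suc (n - Suc k)) = (\<Sum>k<n. y ^ Suc k)"
    by (rule sum.nat_diff_reindex)
  also have "exp (log_mgf_bound s) * exp s * ((\<Sum>k<n. y ^ Suc k) + (\<Sum>k<n. y ^ Suc k)) \<le> exp (log_mgf_bound s) * real n"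
  proof -
    define z where "z = D / N"
    have z: "0 < z" using D N by (simp add: z_def)
    have "(\<Sum>k<n. y ^ Suc k) \<le> y / (1 - y)"
      using z by (intro sum_power_Suc_le) (auto simp: y_def z_def)
    also have "\<dots> = 1 / (exp z - 1)"
      using z by (simp add: y_def z_def exp_minus field_simps)
    \<comment> \<open>The first-order bound 1/z would give D/z = n+1, which is too large. The
      quadratic term makes up for the excess once n D >= 2 (n+1), and D >= 4 ensures this.\<close>
    also have "\<dots> \<le> 1 / (z + z\<^sup>2 / 2)"
    proof -
      have "1 + z + z\<^sup>2 / 2 \<le> exp z" using z by (intro exp_lower_Taylor_quadratic) auto
      moreover have "0 < z + z\<^sup>2 / 2" using z by (simp add: add_pos_nonneg)
      ultimately show ?thesis using z by (intro divide_left_mono mult_pos_pos) linarith+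
    qed
    finally have sm: "(\<Sum>k<n. y ^ Suc k) \<le> 1 / (z + z\<^sup>2 / 2)" .
    have "exp s * ((\<Sum>k<n. y ^ Suc k) + (\<Sum>k<n. y ^ Suc k)) = 2 * exp s * (\<Sum>k<n. y ^ Suc k)" by simp
    also have "\<dots> \<le> D * (1 / (z + z\<^sup>2 / 2))"
      using sm D by (intro mult_mono) (auto simp: y_def intro!: sum_nonneg)
    also have "\<dots> \<le> real n"
    proof -
      have "real n * 4 \<le> real n * D" using D by (intro mult_left_mono) auto
      moreover have "2 * N \<le> real n * 4" using n by (simp add: N_def)
      ultimately have "2 * N \<le> real n * D" by linarith
      then have "N * (2 * N) \<le> 2 * N * real n + real n * D"
        by (simp add: N_def algebra_simps)
      then have "D * (N * (2 * N)) \<le> D * (2 * N * real n + real n * D)"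
        using D by (intro mult_left_mono) auto
      then have "D \<le> real n * (z + z\<^sup>2 / 2)"
        using N by (simp add: z_def power2_eq_square field_simps)
      moreover have "0 < z + z\<^sup>2 / 2" using z by (simp add: add_pos_nonneg)
      ultimately show ?thesis by (simp add: divide_le_eq)
    qed
    finally show ?thesis by (simp add: mult.assoc)
  qed
  finally show ?thesis by (simp add: mult.commute)
qed

lemma centered_mgf_le: "centered_mgf n s \<le> exp (log_mgf_bound s)"
proof (rule centered_mgf_le_by_induction[where \<beta> = log_mgf_bound and S = UNIV])
  fix n :: nat and s :: real assume n: "0 < n"
  consider "s < - (2 / 5)" | "- (2 / 5) \<le> s" "s \<le> 3 / 5" | "3 / 5 \<le> s" by linarith
  then show "(\<Sum>k<n. exp (log_mgf_bound (s * qs_node n k) + log_mgf_bound (s * (1 - qs_node n k)) + s * qs_toll n k)) \<le> real n * exp (log_mgf_bound s)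
      \<or> centered_mgf n s \<le> exp (log_mgf_bound s)"
  proof cases
    case 1
    \<comment> \<open>For negative s each summand alone is at most e^(b(s)): the loss 24 s^2 p (1-p)
      of the quadratic exponent outweighs s times the toll.\<close>
    have "log_mgf_bound (s * qs_node n k) + log_mgf_bound (s * (1 - qs_node n k)) + s * qs_toll n k \<le> log_mgf_bound s" if k: "k < n" for k
    proof -
      define p where "p = qs_node n k"
      have p: "0 < p" "p < 1" using qs_node_bounds[OF k] by (auto simp: p_def)
      define w where "w = sqrt (p * (1 - p))"
      have w: "0 \<le> w" "w\<^sup>2 = p * (1 - p)" using p by (auto simp: w_def)
      have neg: "s * p \<le> 5" "s * (1 - p) \<le> 5" "s \<le> 5"
        using 1 p mult_nonpos_nonneg[of s p] mult_nonpos_nonneg[of s "1 - p"] by auto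
      have "s * qs_toll n k \<le> s * (1 - 4 * w)"
        using 1 qs_toll_ge_sqrt[OF k] by (intro mult_left_mono_neg) (auto simp: w_def p_def)
      also have "s * (1 - 4 * w) \<le> 24 * s\<^sup>2 * w\<^sup>2"
      proof -
        \<comment> \<open>Completing the square gives -4 s w <= 24 s^2 w^2 + 1/6, and s < -2/5
          absorbs the 1/6.\<close>
        have "0 \<le> (12 * (s * w) + 1)\<^sup>2" by simp
        then have "24 * (s * w) + 1 + 144 * (s * w)\<^sup>2 \<ge> 0" by (simp add: power2_eq_square algebra_simps)
        then show ?thesis using 1 by (simp add: power2_eq_square algebra_simps)
      qed
      finally have "s * qs_toll n k \<le> 24 * s\<^sup>2 * (p * (1 - p))" using w by simp
      then show ?thesis using neg unfolding p_def[symmetric]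
        by (simp add: log_mgf_bound_def power2_eq_square algebra_simps)
    qed
    then have "(\<Sum>k<n. exp (log_mgf_bound (s * qs_node n k) + log_mgf_bound (s * (1 - qs_node n k)) + s * qs_toll n k))
       \<le> (\<Sum>k<n. exp (log_mgf_bound s))" by (intro sum_mono) auto
    then show ?thesis by simp
  next
    case 2
    have "centered_mgf n s \<le> exp (3 * s\<^sup>2)" using 2 by (rule centered_mgf_le_small)
    also have "\<dots> \<le> exp (log_mgf_bound s)" using log_mgf_bound_ge_quad[of s] zero_le_power2[of s] unfolding exp_le_cancel_iff by linarith
    finally show ?thesis by simp
  next
    case 3
    then show ?thesis using sum_exp_toll_large[OF _ n] by blast
  qed
qed (auto simp: log_mgf_bound_nonneg)

section \<open>Harmonic sums and logarithms\<close>

lemma sum_Suc_real: "(\<Sum>k<n. real (Suc k)) = real n * (real n + 1) / 2"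
  by (induction n) (auto simp: field_simps)

lemma sum_Suc_real_square: "(\<Sum>k<n. (real (Suc k))\<^sup>2) = real n * (real n + 1) * (2 * real n + 1) / 6"
  by (induction n) (auto simp: field_simps power2_eq_square)

lemma sum_square_harm_gap:
  "(\<Sum>k<n. (real (Suc k))\<^sup>2 * (harm (Suc n) - harm (Suc k))) = real n * (real n + 1) * (4 * real n + 5) / 36"
proof (induction n)
  case (Suc n)
  have "(\<Sum>k<Suc n. (real (Suc k))\<^sup>2 * (harm (Suc (Suc n)) - harm (Suc k))) 
    = (\<Sum>k<Suc n. (real (Suc k))\<^sup>2 * (harm (Suc n) - harm (Suc k)) + (real (Suc k))\<^sup>2 / real (Suc (Suc n)))"
    by (intro sum.cong) (auto simp: harm_Suc[of "Suc n"] divide_inverse algebra_simps)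
  also have "\<dots> = (\<Sum>k<Suc n. (real (Suc k))\<^sup>2 * (harm (Suc n) - harm (Suc k)))
      + (\<Sum>k<Suc n. (real (Suc k))\<^sup>2) / real (Suc (Suc n))"
    by (simp only: sum.distrib sum_divide_distrib)
  also have "(\<Sum>k<Suc n. (real (Suc k))\<^sup>2 * (harm (Suc n) - harm (Suc k))) = real n * (real n + 1) * (4 * real n + 5) / 36"
    using Suc.IH by simp
  also have "real n * (real n + 1) * (4 * real n + 5) / 36 + (\<Sum>k<Suc n. (real (Suc k))\<^sup>2) / real (Suc (Suc n))
     = real (Suc n) * (real (Suc n) + 1) * (4 * real (Suc n) + 5) / 36"
    unfolding sum_Suc_real_square by (simp add: divide_simps) (simp add: algebra_simps)
  finally show ?case .
qed simp

text \<open>The induction step expands the square of a gap increased by 1/(n+2); the cross term is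
  \<open>sum_square_harm_gap\<close>. Dividing the resulting polynomials by n+2 leaves the remainder
  -1/6 each time, and these remainders accumulate to the harmonic term.\<close>

lemma sum_square_harm_gap_square:
  "(\<Sum>k<n. (real (Suc k))\<^sup>2 * (harm (Suc n) - harm (Suc k))\<^sup>2)
    = real n * (real n + 1) * (4 * real n + 5) / 54 - real n * (real n + 1) / 4 + (real n + 1)\<^sup>2 / 6 - harm (Suc n) / 6"
proof (induction n)
  case (Suc n)
  define N where "N = real (Suc (Suc n))"
  have N: "N = real n + 2" "N > 0" by (auto simp: N_def)
  have "(\<Sum>k<Suc n. (real (Suc k))\<^sup>2 * (harm (Suc (Suc n)) - harm (Suc k))\<^sup>2)
    = (\<Sum>k<Suc n. (real (Suc k))\<^sup>2 * (harm (Suc n) - harm (Suc k))\<^sup>2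
        + 2 / N * ((real (Suc k))\<^sup>2 * (harm (Suc n) - harm (Suc k))) + (real (Suc k))\<^sup>2 / N\<^sup>2)"
    by (intro sum.cong refl)
       (simp add: harm_Suc[of "Suc n"] N_def[symmetric] inverse_eq_divide power2_eq_square algebra_simps del: of_nat_Suc)
  also have "\<dots> = (\<Sum>k<Suc n. (real (Suc k))\<^sup>2 * (harm (Suc n) - harm (Suc k))\<^sup>2)
       + 2 / N * (\<Sum>k<Suc n. (real (Suc k))\<^sup>2 * (harm (Suc n) - harm (Suc k))) + (\<Sum>k<Suc n. (real (Suc k))\<^sup>2) / N\<^sup>2"
    by (simp only: sum.distrib sum_divide_distrib sum_distrib_left)
  also have "(\<Sum>k<Suc n. (real (Suc k))\<^sup>2 * (harm (Suc n) - harm (Suc k))\<^sup>2) = real n * (real n + 1) * (4 * real n + 5) / 54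
      - real n * (real n + 1) / 4 + (real n + 1)\<^sup>2 / 6 - harm (Suc n) / 6"
    using Suc.IH by simp
  also have "(\<Sum>k<Suc n. (real (Suc k))\<^sup>2 * (harm (Suc n) - harm (Suc k))) = real n * (real n + 1) * (4 * real n + 5) / 36"
    using sum_square_harm_gap[of n] by simp
  also have "(\<Sum>k<Suc n. (real (Suc k))\<^sup>2) / N\<^sup>2 = (real n + 1) * (2 * real n + 3) / (6 * N)"
    unfolding sum_Suc_real_square N(1) by (simp add: power2_eq_square divide_simps) (simp add: algebra_simps)
  also have "2 / N * (real n * (real n + 1) * (4 * real n + 5) / 36) = real n * (real n + 1) * (4 * real n + 5) / (18 * N)"
    by simp
  also have "real n * (real n + 1) * (4 * real n + 5) / 54 - real n * (real n + 1) / 4 + (real n + 1)\<^sup>2 / 6 - harm (Suc n) / 6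
       + real n * (real n + 1) * (4 * real n + 5) / (18 * N) + (real n + 1) * (2 * real n + 3) / (6 * N)
     = real (Suc n) * (real (Suc n) + 1) * (4 * real (Suc n) + 5) / 54 - real (Suc n) * (real (Suc n) + 1) / 4
       + (real (Suc n) + 1)\<^sup>2 / 6 - (harm (Suc n) + 1 / N) / 6"
    unfolding N(1) by (simp add: divide_simps power2_eq_square) (simp add: algebra_simps)
  also have "harm (Suc n) + 1 / N = harm (Suc (Suc n))" by (simp add: harm_Suc[of "Suc n"] N_def inverse_eq_divide)
  finally show ?case .
qed (simp add: harm_expand)

text \<open>The right-hand side is 2 artanh t and the left-hand side the beginning of its power
  series; the derivatives differ by 2 x^4 / (1 - x^2).\<close>

lemma ln_ratio_ge_cubic:
  fixes t :: real
  assumes "0 \<le> t" "t < 1"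
  shows "2 * t + 2 / 3 * t ^ 3 \<le> ln (1 + t) - ln (1 - t)"
proof -
  define \<phi> where "\<phi> x = ln (1 + x) - ln (1 - x) - 2 * x - 2 / 3 * x ^ 3" for x :: real
  have "\<phi> 0 \<le> \<phi> t"
  proof (rule DERIV_nonneg_imp_nondecreasing[OF assms(1)])
    fix x assume x: "0 \<le> x" "x \<le> t"
    have "(\<phi> has_real_derivative (1 / (1 + x) + 1 / (1 - x) - 2 - 2 * x\<^sup>2)) (at x)"
      unfolding \<phi>_def using x assms by (auto intro!: derivative_eq_intros simp: power2_eq_square)
    moreover have "1 / (1 + x) + 1 / (1 - x) - 2 - 2 * x\<^sup>2 = 2 * x ^ 4 / ((1 + x) * (1 - x))"
      using x assms by (simp add: divide_simps) (simp add: algebra_simps power2_eq_square power4_eq_xxxx)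
    ultimately show "\<exists>y. (\<phi> has_real_derivative y) (at x) \<and> 0 \<le> y"
      using x assms by auto
  qed
  then show ?thesis by (simp add: \<phi>_def)
qed

lemma ln_Suc_bounds:
  assumes "0 < i"
  shows "ln (real (Suc i)) - ln (real i) \<le> (1 / real i + 1 / real (Suc i)) / 2"
    and "ln (real (Suc i)) - ln (real i) \<ge> (1 / real i + 1 / real (Suc i)) / 2 - (1 / (real i)\<^sup>2 - 1 / (real (Suc i))\<^sup>2) / 12"
proof -
  show "ln (real (Suc i)) - ln (real i) \<le> (1 / real i + 1 / real (Suc i)) / 2"
    using ln_inverse_approx_le[of "real i" 1] assms by (simp add: inverse_eq_divide add.commute)
  \<comment> \<open>Chosen so that (i+1)/i = (1+t)/(1-t); the lower bound becomes a rational
    function of t, to be compared with the series of artanh.\<close>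
  define t where "t = 1 / (2 * real i + 1)"
  have t: "0 < t" "t < 1" using assms by (auto simp: t_def)
  have i: "real i = (1 - t) / (2 * t)" "real (Suc i) = (1 + t) / (2 * t)"
    using assms by (auto simp: t_def field_simps)
  have "(1 / real i + 1 / real (Suc i)) / 2 - (1 / (real i)\<^sup>2 - 1 / (real (Suc i))\<^sup>2) / 12
     = 2 * t / (1 - t\<^sup>2) - 4 / 3 * t ^ 3 / (1 - t\<^sup>2)\<^sup>2"
  proof -
    have "1 - t\<^sup>2 = (1 - t) * (1 + t)" by (simp add: power2_eq_square algebra_simps)
    then show ?thesis unfolding i using t
      by (simp add: divide_simps power2_eq_square) (simp add: algebra_simps power3_eq_cube)
  qed
  also have "\<dots> \<le> 2 * t + 2 / 3 * t ^ 3"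
  proof -
    have t2: "0 < 1 - t\<^sup>2" using t by (simp add: power_less_one_iff abs_square_less_1)
    have "(2 * t + 2 / 3 * t ^ 3) * (1 - t\<^sup>2)\<^sup>2 - (2 * t * (1 - t\<^sup>2) - 4 / 3 * t ^ 3) = 2 / 3 * t ^ 5 * (1 + t\<^sup>2)"
      by (simp add: power2_eq_square power_numeral_reduce algebra_simps)
    moreover have "0 \<le> 2 / 3 * t ^ 5 * (1 + t\<^sup>2)" using t by simp
    ultimately have "2 * t * (1 - t\<^sup>2) - 4 / 3 * t ^ 3 \<le> (2 * t + 2 / 3 * t ^ 3) * (1 - t\<^sup>2)\<^sup>2"
      by linarith
    then have "(2 * t * (1 - t\<^sup>2) - 4 / 3 * t ^ 3) / (1 - t\<^sup>2)\<^sup>2 \<le> 2 * t + 2 / 3 * t ^ 3"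
      using t2 by (subst pos_divide_le_eq) auto
    moreover have "(2 * t * (1 - t\<^sup>2) - 4 / 3 * t ^ 3) / (1 - t\<^sup>2)\<^sup>2 = 2 * t / (1 - t\<^sup>2) - 4 / 3 * t ^ 3 / (1 - t\<^sup>2)\<^sup>2"
      using t2 by (simp add: diff_divide_distrib power2_eq_square)
    ultimately show ?thesis by simp
  qed
  also have "\<dots> \<le> ln (1 + t) - ln (1 - t)" using t by (intro ln_ratio_ge_cubic) auto
  also have "\<dots> = ln (real (Suc i)) - ln (real i)"
    unfolding i using t by (simp add: ln_div)
  finally show "ln (real (Suc i)) - ln (real i) \<ge> (1 / real i + 1 / real (Suc i)) / 2 - (1 / (real i)\<^sup>2 - 1 / (real (Suc i))\<^sup>2) / 12" .
qed

text \<open>The trapezoidal rule with the first Euler-Maclaurin correction.\<close>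

lemma ln_quotient_harm_bounds:
  assumes "0 < j" "j \<le> n"
  shows "ln (real n) - ln (real j) \<le> harm n - harm j + (1 / real j - 1 / real n) / 2"
    and "ln (real n) - ln (real j) \<ge> harm n - harm j + (1 / real j - 1 / real n) / 2 - (1 / (real j)\<^sup>2 - 1 / (real n)\<^sup>2) / 12"
  using assms(2)
proof (induction n rule: dec_induct)
  case (step n)
  have n: "0 < n" using step assms by linarith
  {
    case 1
    then show ?case using step.IH(1) ln_Suc_bounds(1)[OF n]
      by (simp add: harm_Suc inverse_eq_divide algebra_simps add_divide_distrib diff_divide_distrib del: of_nat_Suc)
  next
    case 2
    then show ?case using step.IH(2) ln_Suc_bounds(2)[OF n]
      by (simp add: harm_Suc inverse_eq_divide algebra_simps add_divide_distrib diff_divide_distrib del: of_nat_Suc)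
  }
qed simp_all

text \<open>The gap has n - k terms, each at least 1/(n+1). In \<open>log_term_lower_bound\<close>
  this makes the Euler-Maclaurin corrections add up to at most n/24.\<close>

lemma harm_gap_weight_le:
  assumes "k < n"
  shows "1 - (harm (Suc n) - harm (Suc k)) \<le> qs_node n k"
proof -
  have "real m / (real j + real m) \<le> harm (j + m) - harm j" if "0 < j" for j m
  proof (induction m)
    case (Suc m)
    have "real (Suc m) / (real j + real (Suc m)) = real m / (real j + real m + 1) + 1 / (real j + real m + 1)"
      by (simp add: add_divide_distrib add_ac)
    also have "real m / (real j + real m + 1) \<le> real m / (real j + real m)"
      using that by (intro divide_left_mono) auto
    finally show ?case using Suc.IH by (simp add: harm_Suc inverse_eq_divide add_ac)
  qed simp
  from this[of "Suc k" "n - k"] have "real (n - k) / real (Suc n) \<le> harm (Suc n) - harm (Suc k)"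
    using assms by (simp add: of_nat_diff)
  then show ?thesis using assms by (simp add: qs_node_def of_nat_diff field_simps)
qed

section \<open>The toll function\<close>

definition xlnx :: "real \<Rightarrow> real" where
  "xlnx u = u * ln u"

lemma continuous_on_xlnx: "continuous_on {0..} xlnx"
proof -
  have "continuous (at x within {0..}) xlnx" if "0 \<le> x" for x
  proof (cases "x = 0")
    case True
    have "((\<lambda>x::real. x * ln x) \<longlongrightarrow> 0) (at_right 0)" by real_asymp
    moreover have "at 0 within {0..} = at_right (0::real)"
      by (rule at_within_Ici_at_right)
    ultimately show ?thesis unfolding True continuous_within xlnx_def by simp
  next
    case False
    then show ?thesis using that unfolding xlnx_def by (intro continuous_intros) auto
  qed
  then show ?thesis by (auto simp: continuous_on_eq_continuous_within)
qed

definition xlnx_prim :: "real \<Rightarrow> real" where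
  "xlnx_prim u = u\<^sup>2 * (ln u / 2 - 1 / 4)"

definition xlnx_sq_prim :: "real \<Rightarrow> real" where
  "xlnx_sq_prim u = u ^ 3 * ((ln u)\<^sup>2 / 3 - 2 / 9 * ln u + 2 / 27)"

lemma has_integral_xlnx:
  assumes "0 \<le> a" "a \<le> b"
  shows "(xlnx has_integral (xlnx_prim b - xlnx_prim a)) {a..b}"
proof (rule fundamental_theorem_of_calculus_interior[OF assms(2)])
  \<comment> \<open>Written through \<open>xlnx\<close>, the primitive inherits continuity at 0;
    derivatives are asked for in the open interval.\<close>
  have "continuous_on {a..b} (\<lambda>u. u * xlnx u / 2 - u\<^sup>2 / 4)"
    using assms by (intro continuous_intros continuous_on_subset[OF continuous_on_xlnx]) auto
  then show "continuous_on {a..b} xlnx_prim"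
    by (simp add: xlnx_prim_def[abs_def] xlnx_def power2_eq_square algebra_simps)
  fix x assume "x \<in> {a<..<b}"
  then have "0 < x" using assms by auto
  then show "(xlnx_prim has_vector_derivative xlnx x) (at x)"
    unfolding has_real_derivative_iff_has_vector_derivative[symmetric] xlnx_prim_def[abs_def] xlnx_def
    by (auto intro!: derivative_eq_intros simp: power2_eq_square field_simps)
qed

lemma has_integral_xlnx_sq:
  assumes "0 \<le> a" "a \<le> b"
  shows "((\<lambda>u. (xlnx u)\<^sup>2) has_integral (xlnx_sq_prim b - xlnx_sq_prim a)) {a..b}"
proof (rule fundamental_theorem_of_calculus_interior[OF assms(2)])
  have "continuous_on {a..b} (\<lambda>u. u * (xlnx u)\<^sup>2 / 3 - 2 / 9 * u\<^sup>2 * xlnx u + 2 / 27 * u ^ 3)"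
    using assms by (intro continuous_intros continuous_on_subset[OF continuous_on_xlnx]) auto
  then show "continuous_on {a..b} xlnx_sq_prim"
    by (simp add: xlnx_sq_prim_def[abs_def] xlnx_def power2_eq_square power3_eq_cube algebra_simps)
  fix x assume "x \<in> {a<..<b}"
  then have "0 < x" using assms by auto
  then show "(xlnx_sq_prim has_vector_derivative (xlnx x)\<^sup>2) (at x)"
    unfolding has_real_derivative_iff_has_vector_derivative[symmetric] xlnx_sq_prim_def[abs_def] xlnx_def
    by (auto intro!: derivative_eq_intros simp: power2_eq_square power3_eq_cube field_simps)
qed

lemma has_integral_reflect_01:
  fixes h :: "real \<Rightarrow> real"
  assumes "(h has_integral I) {a..b}"
  shows "((\<lambda>u. h (1 - u)) has_integral I) {1 - b..1 - a}"
proof -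
  have "((\<lambda>x. h (x + 1)) has_integral I) {a - 1..b - 1}"
    using has_integral_affinity'[of h I a b 1 1] assms by simp
  then have "((\<lambda>x. h (- x + 1)) has_integral I) {- (b - 1)..- (a - 1)}"
    using has_integral_reflect_real[of "\<lambda>x. h (x + 1)" I "b - 1" "a - 1"] by simp
  then show ?thesis by (simp add: algebra_simps)
qed

lemma qs_C_eq: "qs_C u = 1 + 2 * xlnx u + 2 * xlnx (1 - u)"
  by (simp add: qs_C_def xlnx_def)

lemma continuous_on_qs_C: "continuous_on {0..1} qs_C"
proof -
  have "continuous_on {0..1} (\<lambda>u. xlnx (1 - u))"
    by (rule continuous_on_compose2[OF continuous_on_xlnx]) (auto intro!: continuous_intros)
  then show ?thesis unfolding qs_C_eq[abs_def]
    by (intro continuous_intros continuous_on_subset[OF continuous_on_xlnx]) auto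
qed

text \<open>The mixed term 8ab with a = u ln u and b = (1-u) ln (1-u) is replaced by 4a^2 + 4b^2.
  Its integral would bring in pi^2, whereas now the value is 1 - 2 + 16 * (2/27) = 5/27.\<close>

lemma integral_qs_C_sq_le: "integral {0..1} (\<lambda>u. (qs_C u)\<^sup>2) \<le> 5 / 27"
proof -
  have f: "(xlnx has_integral (- 1 / 4)) {0..1}" "((\<lambda>u. (xlnx u)\<^sup>2) has_integral 2 / 27) {0..1}"
    using has_integral_xlnx[of 0 1] has_integral_xlnx_sq[of 0 1]
    by (simp_all add: xlnx_prim_def xlnx_sq_prim_def)
  note f' = has_integral_reflect_01[OF f(1)] has_integral_reflect_01[OF f(2)]
  have one: "((\<lambda>u. 1 :: real) has_integral 1) {0..1::real}" using has_integral_const_real[of "1::real" 0 1] by simp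
  have up: "((\<lambda>u. 1 + 4 * xlnx u + 4 * xlnx (1 - u) + (8 * (xlnx u)\<^sup>2 + 8 * (xlnx (1 - u))\<^sup>2)) has_integral
     (1 + 4 * (- 1 / 4) + 4 * (- 1 / 4) + (8 * (2 / 27) + 8 * (2 / 27)))) {0..1}"
    using f f' one by (intro has_integral_add has_integral_mult_right) auto
  have "(\<lambda>u. (qs_C u)\<^sup>2) integrable_on {0..1}"
    by (intro integrable_continuous_real continuous_intros continuous_on_qs_C)
  then have "((\<lambda>u. (qs_C u)\<^sup>2) has_integral integral {0..1} (\<lambda>u. (qs_C u)\<^sup>2)) {0..1}"
    by (rule integrable_integral)
  from has_integral_le[OF this up] show ?thesis
  proof -
    assume a: "(\<And>x. x \<in> {0..1} \<Longrightarrow> (qs_C x)\<^sup>2 \<le> 1 + 4 * xlnx x + 4 * xlnx (1 - x) + (8 * (xlnx x)\<^sup>2 + 8 * (xlnx (1 - x))\<^sup>2))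
      \<Longrightarrow> integral {0..1} (\<lambda>u. (qs_C u)\<^sup>2) \<le> 1 + 4 * (- 1 / 4) + 4 * (- 1 / 4) + (8 * (2 / 27) + 8 * (2 / 27))"
    have "(1 + 2 * a + 2 * b)\<^sup>2 \<le> 1 + 4 * a + 4 * b + (8 * a\<^sup>2 + 8 * b\<^sup>2)" for a b :: real
    proof -
      have "0 \<le> 4 * (a - b)\<^sup>2" by simp
      then show ?thesis by (simp add: power2_eq_square algebra_simps)
    qed
    then have "integral {0..1} (\<lambda>u. (qs_C u)\<^sup>2) \<le> 1 + 4 * (- 1 / 4) + 4 * (- 1 / 4) + (8 * (2 / 27) + 8 * (2 / 27))"
      by (intro a) (simp add: qs_C_eq)
    then show ?thesis by simp
  qed
qed

section \<open>Summation by parts for the toll\<close>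

lemma sum_by_parts:
  fixes g F :: "nat \<Rightarrow> real"
  shows "(\<Sum>k<m. g k * (F (Suc k) - F k)) = g m * F m - g 0 * F 0 - (\<Sum>k<m. (g (Suc k) - g k) * F (Suc k))"
  by (induction m) (auto simp: algebra_simps)

lemma sum_toll_part_xlnx_prim:
  assumes "0 < n"
  shows "2 * (real n)\<^sup>2 * real (Suc n) * (\<Sum>k<n. toll_part n k * (xlnx_prim (real (Suc k) / real n) - xlnx_prim (real k / real n)))
     = (\<Sum>k<n. (1 - (harm (Suc n) - harm (Suc k))) * (real (Suc k))\<^sup>2 * (ln (real n) - ln (real (Suc k)) + 1 / 2))"
proof -
  have g: "toll_part n (Suc k) - toll_part n k = (1 - (harm (Suc n) - harm (Suc k))) / real (Suc n)" for k
  proof -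
    have "real (Suc (Suc k)) * harm (Suc (Suc k)) = real (Suc (Suc k)) * harm (Suc k) + (1::real)"
      by (subst harm_Suc) (simp add: field_simps)
    then have "real (Suc (Suc k)) * (harm (Suc (Suc k)) - harm (Suc n)) - real (Suc k) * (harm (Suc k) - harm (Suc n))
      = 1 - (harm (Suc n) - harm (Suc k))" by (simp add: algebra_simps)
    then show ?thesis by (simp add: toll_part_def qs_node_def diff_divide_distrib[symmetric] del: of_nat_Suc)
  qed
  have P: "xlnx_prim (real (Suc k) / real n) = - (real (Suc k))\<^sup>2 / (2 * (real n)\<^sup>2) * (ln (real n) - ln (real (Suc k)) + 1 / 2)" for k
    using assms by (simp add: xlnx_prim_def ln_div power_divide field_simps del: of_nat_Suc)
  \<comment> \<open>There are no boundary terms: \<open>toll_part n n\<close> vanishes because its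
    harmonic gap is empty, and \<open>xlnx_prim 0\<close> is 0.\<close>
  have "(\<Sum>k<n. toll_part n k * (xlnx_prim (real (Suc k) / real n) - xlnx_prim (real k / real n)))
    = - (\<Sum>k<n. (toll_part n (Suc k) - toll_part n k) * xlnx_prim (real (Suc k) / real n))"
    by (subst sum_by_parts[where F = "\<lambda>k. xlnx_prim (real k / real n)"]) (simp add: toll_part_def xlnx_prim_def)
  also have "\<dots> = (\<Sum>k<n. (1 - (harm (Suc n) - harm (Suc k))) * (real (Suc k))\<^sup>2 * (ln (real n) - ln (real (Suc k)) + 1 / 2)
       / (2 * (real n)\<^sup>2 * real (Suc n)))"
    unfolding g P sum_negf[symmetric] by (intro sum.cong refl) (simp add: field_simps del: of_nat_Suc)
  finally show ?thesis using assms by (simp add: sum_divide_distrib[symmetric] del: of_nat_Suc)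
qed


text \<open>The weight 1 - h changes sign with k. Where it is nonnegative the lower Euler-Maclaurin
  bound applies, and its correction costs (1-h)/12 <= j/(12(n+1)); where it is negative the upper
  trapezoidal bound applies. The gap h ends at H_(n+1) while the logarithm ends at n, hence the
  1/(n+1) in B.\<close>

lemma log_term_lower_bound:
  assumes k: "k < n"
  defines "h \<equiv> harm (Suc n) - harm (Suc k)" and "j \<equiv> real (Suc k)"
  shows "(1 - h) * (j\<^sup>2 * h + (1 / 2 - 1 / (real n + 1) - 1 / (2 * real n)) * j\<^sup>2 + j / 2) - j / (12 * (real n + 1))
    \<le> (1 - h) * j\<^sup>2 * (ln (real n) - ln j + 1 / 2)"
proof -
  define B where "B = h - 1 / (real n + 1) + 1 / (2 * j) - 1 / (2 * real n)"
  have j: "0 < j" by (simp add: j_def)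
  have "harm n - harm (Suc k) = h - 1 / (real n + 1)"
    by (simp add: h_def harm_Suc[of n] inverse_eq_divide add.commute)
  then have B: "harm n - harm (Suc k) + (1 / j - 1 / real n) / 2 = B"
    by (simp add: B_def diff_divide_distrib)
  have up: "ln (real n) - ln j \<le> B"
    using ln_quotient_harm_bounds(1)[of "Suc k" n] k B by (simp add: j_def)
  have lo: "B - 1 / (12 * j\<^sup>2) \<le> ln (real n) - ln j"
  proof -
    have "(1 / j\<^sup>2 - 1 / (real n)\<^sup>2) / 12 \<le> 1 / (12 * j\<^sup>2)" by (simp add: diff_divide_distrib mult.commute)
    then show ?thesis using ln_quotient_harm_bounds(2)[of "Suc k" n] k B unfolding j_def by linarith
  qed
  have eq: "(1 - h) * j\<^sup>2 * (B + 1 / 2) = (1 - h) * (j\<^sup>2 * h + (1 / 2 - 1 / (real n + 1) - 1 / (2 * real n)) * j\<^sup>2 + j / 2)"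
  proof -
    have "j\<^sup>2 * (1 / (2 * j)) = j / 2" using j by (simp add: power2_eq_square)
    moreover have "j\<^sup>2 * (h - a + w - b + 1 / 2) = j\<^sup>2 * h + (1 / 2 - a - b) * j\<^sup>2 + j\<^sup>2 * w" for a b w
      by (simp add: algebra_simps)
    ultimately show ?thesis unfolding B_def mult.assoc by metis
  qed
  show ?thesis
  proof (cases "0 \<le> 1 - h")
    case True
    have "1 - h \<le> j / (real n + 1)"
      using harm_gap_weight_le[OF k] by (simp add: h_def j_def qs_node_def add.commute)
    then have "(1 - h) / 12 \<le> j / (real n + 1) / 12" by (rule divide_right_mono) simp
    then have "(1 - h) / 12 \<le> j / (12 * (real n + 1))" by (simp only: divide_divide_eq_left mult.commute)
    moreover have "(1 - h) * j\<^sup>2 * (B - 1 / (12 * j\<^sup>2) + 1 / 2) \<le> (1 - h) * j\<^sup>2 * (ln (real n) - ln j + 1 / 2)"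
      using True lo by (intro mult_left_mono) auto
    moreover have "(1 - h) * j\<^sup>2 * (B - 1 / (12 * j\<^sup>2) + 1 / 2) = (1 - h) * j\<^sup>2 * (B + 1 / 2) - (1 - h) / 12"
      using j by (simp add: field_simps)
    ultimately show ?thesis unfolding eq[symmetric] by linarith
  next
    case False
    have "(1 - h) * j\<^sup>2 * (B + 1 / 2) \<le> (1 - h) * j\<^sup>2 * (ln (real n) - ln j + 1 / 2)"
      using False up by (intro mult_left_mono_neg) (auto simp: mult_nonpos_nonneg)
    moreover have "0 \<le> j / (12 * (real n + 1))" using j by simp
    ultimately show ?thesis unfolding eq[symmetric] by linarith
  qed
qed

lemma sum_log_term_lower_bound:
  fixes n :: nat
  assumes "0 < n"
  defines "x \<equiv> real n"
  defines "S1 \<equiv> x * (x + 1) * (4 * x + 5) / 36"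
    and "S2 \<equiv> (\<Sum>k<n. (real (Suc k))\<^sup>2 * (harm (Suc n) - harm (Suc k))\<^sup>2)"
  shows "S1 - S2 + (1 / 2 - 1 / (x + 1) - 1 / (2 * x)) * (x * (x + 1) * (2 * x + 1) / 6 - S1) + x * (x + 1) / 8 - x / 24
    \<le> (\<Sum>k<n. (1 - (harm (Suc n) - harm (Suc k))) * (real (Suc k))\<^sup>2 * (ln (real n) - ln (real (Suc k)) + 1 / 2))"
proof -
  define h :: "nat \<Rightarrow> real" where "h k = harm (Suc n) - harm (Suc k)" for k
  define j where "j k = real (Suc k)" for k
  define c where "c = 1 / 2 - 1 / (x + 1) - 1 / (2 * x)"
  have "(\<Sum>k<n. (1 - h k) * ((j k)\<^sup>2 * h k + c * (j k)\<^sup>2 + j k / 2) - j k / (12 * (x + 1)))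
    = (\<Sum>k<n. (j k)\<^sup>2 * h k - (j k)\<^sup>2 * (h k)\<^sup>2 + c * ((j k)\<^sup>2 - (j k)\<^sup>2 * h k) + (j k - j k * h k) / 2 - j k / (12 * (x + 1)))"
    by (intro sum.cong refl) (simp add: algebra_simps power2_eq_square diff_divide_distrib)
  also have "\<dots> = (\<Sum>k<n. (j k)\<^sup>2 * h k) - (\<Sum>k<n. (j k)\<^sup>2 * (h k)\<^sup>2) + c * ((\<Sum>k<n. (j k)\<^sup>2) - (\<Sum>k<n. (j k)\<^sup>2 * h k))
     + ((\<Sum>k<n. j k) - (\<Sum>k<n. j k * h k)) / 2 - (\<Sum>k<n. j k) / (12 * (x + 1))"
    by (simp only: sum.distrib sum_subtractf sum_distrib_left[symmetric] sum_divide_distrib[symmetric])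
  also have "\<dots> = S1 - S2 + c * (x * (x + 1) * (2 * x + 1) / 6 - S1) + x * (x + 1) / 8 - x / 24"
  proof -
    have "(\<Sum>k<n. j k * h k) = x * (x + 1) / 4" "(\<Sum>k<n. (j k)\<^sup>2 * h k) = S1"
      "(\<Sum>k<n. j k) = x * (x + 1) / 2" "(\<Sum>k<n. (j k)\<^sup>2) = x * (x + 1) * (2 * x + 1) / 6"
      using sum_mult_harm_gap[of n] sum_square_harm_gap[of n] sum_Suc_real[of n] sum_Suc_real_square[of n]
      by (simp_all add: h_def j_def x_def S1_def)
    moreover have "x * (x + 1) / 2 / (12 * (x + 1)) = x / 24" using assms(1) by (simp add: x_def divide_simps)
    moreover have "(\<Sum>k<n. (j k)\<^sup>2 * (h k)\<^sup>2) = S2" by (simp add: S2_def h_def j_def)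
    ultimately show ?thesis by (simp only:) simp
  qed
  finally have "S1 - S2 + c * (x * (x + 1) * (2 * x + 1) / 6 - S1) + x * (x + 1) / 8 - x / 24
    = (\<Sum>k<n. (1 - h k) * ((j k)\<^sup>2 * h k + c * (j k)\<^sup>2 + j k / 2) - j k / (12 * (x + 1)))" ..
  also have "\<dots> \<le> (\<Sum>k<n. (1 - h k) * (j k)\<^sup>2 * (ln (real n) - ln (j k) + 1 / 2))"
    unfolding h_def j_def c_def x_def by (intro sum_mono log_term_lower_bound) auto
  finally show ?thesis by (simp add: h_def j_def c_def)
qed

section \<open>Discrete and limiting toll compared cell by cell\<close>

definition qs_cell :: "nat \<Rightarrow> nat \<Rightarrow> real set" where
  "qs_cell n k = {real k / real n..real (Suc k) / real n}"

lemma qs_cell_subset: "k < n \<Longrightarrow> qs_cell n k \<subseteq> {0..1}"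
  by (auto simp: qs_cell_def field_simps intro: order_trans[rotated] order_trans)

lemma continuous_on_qs_cell_qs_C: "k < n \<Longrightarrow> continuous_on (qs_cell n k) qs_C"
  by (rule continuous_on_subset[OF continuous_on_qs_C qs_cell_subset])

lemma continuous_on_qs_cell_xlnx: "k < n \<Longrightarrow> continuous_on (qs_cell n k) xlnx"
  by (rule continuous_on_subset[OF continuous_on_xlnx]) (use qs_cell_subset[of k n] in fastforce)

lemma integrable_on_qs_cell:
  "continuous_on (qs_cell n k) (g :: real \<Rightarrow> real) \<Longrightarrow> g integrable_on qs_cell n k"
  unfolding qs_cell_def by (rule integrable_continuous_real)

text \<open>The squared distance is expanded, and summation by parts moves the differences from the primitive of $u \ln u$ to the harmonic numbers; after replacing the logarithms by harmonic numbers only polynomial sums are left.\<close>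

lemma sum_integral_toll_part_le:
  assumes n: "0 < n"
  shows "(\<Sum>k<n. integral (qs_cell n k) (\<lambda>u. (toll_part n k - xlnx u)\<^sup>2)) \<le> 7 / 27 / (real n + 1)\<^sup>2"
proof -
  define x where "x = real n"
  have x: "1 \<le> x" using n by (simp add: x_def)
  define S2 where "S2 = (\<Sum>k<n. (real (Suc k))\<^sup>2 * (harm (Suc n) - harm (Suc k))\<^sup>2)"
  define R where "R = (\<Sum>k<n. (1 - (harm (Suc n) - harm (Suc k))) * (real (Suc k))\<^sup>2 * (ln (real n) - ln (real (Suc k)) + 1 / 2))"
  define J where "J = (\<Sum>k<n. integral (qs_cell n k) (\<lambda>u. (toll_part n k - xlnx u)\<^sup>2))"
  define P where "P k = xlnx_prim (real k / real n)" for k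
  define Q where "Q k = xlnx_sq_prim (real k / real n)" for k
  have cell: "integral (qs_cell n k) (\<lambda>u. (toll_part n k - xlnx u)\<^sup>2)
      = (toll_part n k)\<^sup>2 / x - 2 * (toll_part n k * (P (Suc k) - P k)) + (Q (Suc k) - Q k)" for k
  proof -
    have le: "0 \<le> real k / real n" "real k / real n \<le> real (Suc k) / real n"
      by (auto intro: divide_right_mono)
    have one: "((\<lambda>u. (toll_part n k)\<^sup>2) has_integral (toll_part n k)\<^sup>2 / x) {real k / real n..real (Suc k) / real n}"
      using has_integral_const_real[of "(toll_part n k)\<^sup>2" "real k / real n" "real (Suc k) / real n"] le n
      by (simp add: x_def add_divide_distrib)
    have "((\<lambda>u. (toll_part n k)\<^sup>2 - 2 * toll_part n k * xlnx u + (xlnx u)\<^sup>2) has_integral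
       ((toll_part n k)\<^sup>2 / x - 2 * toll_part n k * (P (Suc k) - P k) + (Q (Suc k) - Q k))) {real k / real n..real (Suc k) / real n}"
      unfolding P_def Q_def
      by (intro has_integral_add has_integral_diff one has_integral_mult_right has_integral_xlnx has_integral_xlnx_sq le)
    then show ?thesis unfolding qs_cell_def
      by (intro integral_unique) (simp add: power2_diff algebra_simps)
  qed
  have "J = (\<Sum>k<n. (toll_part n k)\<^sup>2) / x - 2 * (\<Sum>k<n. toll_part n k * (P (Suc k) - P k)) + (Q n - Q 0)"
    unfolding J_def cell by (simp only: sum.distrib sum_subtractf sum_distrib_left[symmetric] sum_divide_distrib[symmetric])
      (simp only: sum_subtractf[symmetric] sum_lessThan_telescope)
  also have "(\<Sum>k<n. (toll_part n k)\<^sup>2) = S2 / (x + 1)\<^sup>2"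
    unfolding S2_def sum_divide_distrib toll_part_def qs_node_def
    by (intro sum.cong refl) (simp add: x_def power2_eq_square field_simps)
  also have "(\<Sum>k<n. toll_part n k * (P (Suc k) - P k)) = R / (2 * x\<^sup>2 * (x + 1))"
  proof -
    have "2 * x\<^sup>2 * (x + 1) * (\<Sum>k<n. toll_part n k * (P (Suc k) - P k)) = R"
      using sum_toll_part_xlnx_prim[OF n] unfolding P_def R_def x_def by (simp add: add.commute)
    moreover have "2 * x\<^sup>2 * (x + 1) \<noteq> 0" using x by simp
    ultimately show ?thesis by (metis nonzero_mult_div_cancel_left)
  qed
  also have "Q n - Q 0 = 2 / 27" using n by (simp add: Q_def xlnx_sq_prim_def)
  finally have J: "J = S2 / (x + 1)\<^sup>2 / x - 2 * (R / (2 * x\<^sup>2 * (x + 1))) + 2 / 27" .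
  define S1 where "S1 = x * (x + 1) * (4 * x + 5) / 36"
  define L where "L = S1 - S2 + (1 / 2 - 1 / (x + 1) - 1 / (2 * x)) * (x * (x + 1) * (2 * x + 1) / 6 - S1) + x * (x + 1) / 8 - x / 24"
  have R: "L \<le> R" using sum_log_term_lower_bound[OF n] by (simp add: L_def R_def S1_def S2_def x_def)
  have S2: "S2 \<le> x * (x + 1) * (4 * x + 5) / 54 - x * (x + 1) / 4 + (x + 1)\<^sup>2 / 6 - 1 / 4"
  proof -
    \<comment> \<open>The negative harmonic term of S2 is estimated through H_2 = 3/2, which gives
      the 1/4.\<close>
    have "harm (Suc 1) \<le> (harm (Suc n) :: real)" using n by (intro harm_mono) auto
    moreover have "harm (Suc 1) = (3 / 2 :: real)" by (simp add: harm_def)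
    ultimately have "3 / 2 \<le> (harm (Suc n) :: real)" by simp
    then show ?thesis unfolding S2_def sum_square_harm_gap_square x_def by simp
  qed
  have "(x + 1)\<^sup>2 * x\<^sup>2 * J = x * S2 - (x + 1) * R + 2 / 27 * (x + 1)\<^sup>2 * x\<^sup>2"
    unfolding J using x by (simp add: divide_simps power2_eq_square) (simp add: algebra_simps)
  also have "\<dots> \<le> x * S2 - (x + 1) * L + 2 / 27 * (x + 1)\<^sup>2 * x\<^sup>2"
    using R x by (intro add_right_mono diff_left_mono mult_left_mono) auto
  \<comment> \<open>L contains -S2, so in total S2 has the positive coefficient 2x+1 and its upper
    bound can be inserted.\<close>
  also have "\<dots> = (2 * x + 1) * S2 - (x + 1) * (L + S2) + 2 / 27 * (x + 1)\<^sup>2 * x\<^sup>2"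
    by (simp add: algebra_simps)
  also have "\<dots> \<le> (2 * x + 1) * (x * (x + 1) * (4 * x + 5) / 54 - x * (x + 1) / 4 + (x + 1)\<^sup>2 / 6 - 1 / 4)
      - (x + 1) * (L + S2) + 2 / 27 * (x + 1)\<^sup>2 * x\<^sup>2"
    using S2 x by (intro add_right_mono diff_right_mono mult_left_mono) auto
  also have "L + S2 = S1 + (1 / 2 - 1 / (x + 1) - 1 / (2 * x)) * (x * (x + 1) * (2 * x + 1) / 6 - S1) + x * (x + 1) / 8 - x / 24"
    by (simp add: L_def)
  \<comment> \<open>All terms of order x^4 and x^3 cancel here; this is why the squared distance is
    of order 1/n^2, and 7/27 is the leading coefficient left over.\<close>
  also have "(2 * x + 1) * (x * (x + 1) * (4 * x + 5) / 54 - x * (x + 1) / 4 + (x + 1)\<^sup>2 / 6 - 1 / 4)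
      - (x + 1) * (S1 + (1 / 2 - 1 / (x + 1) - 1 / (2 * x)) * (x * (x + 1) * (2 * x + 1) / 6 - S1) + x * (x + 1) / 8 - x / 24)
      + 2 / 27 * (x + 1)\<^sup>2 * x\<^sup>2 = 7 / 27 * x\<^sup>2 - 13 / 216 * x - 5 / 72"
    unfolding S1_def using x by (simp add: divide_simps power2_eq_square) (simp add: algebra_simps)
  also have "\<dots> \<le> 7 / 27 * x\<^sup>2" using x by simp
  finally have "(x + 1)\<^sup>2 * J * x\<^sup>2 \<le> 7 / 27 * x\<^sup>2" by (simp add: ac_simps)
  then have "(x + 1)\<^sup>2 * J \<le> 7 / 27" using x by (simp add: mult_le_cancel_right)
  then show ?thesis using x by (simp add: J_def x_def field_simps)
qed

text \<open>The toll differs from C by twice the error of \<open>toll_part\<close> at k plus twice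
  the mirrored error at n-1-k. By (2(a+b))^2 <= 8(a^2+b^2) both halves contribute the same sum,
  whence 16 * (7/27) = 112/27.\<close>

lemma sum_integral_toll_diff_le:
  assumes n: "0 < n"
  shows "(\<Sum>k<n. integral (qs_cell n k) (\<lambda>u. ((real n + 1) * (qs_toll n k - qs_C u))\<^sup>2)) \<le> 112 / 27"
proof -
  define N where "N = real n + 1"
  define I where "I k = integral (qs_cell n k) (\<lambda>u. (toll_part n k - xlnx u)\<^sup>2)" for k
  have int: "((\<lambda>u. (toll_part n k - xlnx u)\<^sup>2) has_integral I k) (qs_cell n k)" if "k < n" for k
    unfolding I_def
    by (intro integrable_integral integrable_on_qs_cell continuous_intros continuous_on_qs_cell_xlnx that)
  have "integral (qs_cell n k) (\<lambda>u. (N * (qs_toll n k - qs_C u))\<^sup>2) \<le> 8 * N\<^sup>2 * (I k + I (n - Suc k))" if k: "k < n" for k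
  proof -
    define k' where "k' = n - Suc k"
    have k': "k' < n" using k by (simp add: k'_def)
    have refl_cell: "{1 - real (Suc k') / real n..1 - real k' / real n} = qs_cell n k"
      using k by (simp add: qs_cell_def k'_def of_nat_diff field_simps)
    have int': "((\<lambda>u. (toll_part n k' - xlnx (1 - u))\<^sup>2) has_integral I k') (qs_cell n k)"
      using has_integral_reflect_01[of "\<lambda>u. (toll_part n k' - xlnx u)\<^sup>2" "I k'" "real k' / real n" "real (Suc k') / real n"]
        int[OF k'] unfolding refl_cell by (simp add: qs_cell_def)
    have up: "((\<lambda>u. 8 * N\<^sup>2 * ((toll_part n k - xlnx u)\<^sup>2 + (toll_part n k' - xlnx (1 - u))\<^sup>2)) has_integral (8 * N\<^sup>2 * (I k + I k'))) (qs_cell n k)"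
      by (intro has_integral_mult_right has_integral_add int k int')
    have "(\<lambda>u. (N * (qs_toll n k - qs_C u))\<^sup>2) integrable_on qs_cell n k"
      by (intro integrable_on_qs_cell continuous_intros continuous_on_qs_cell_qs_C k)
    moreover have "(N * (qs_toll n k - qs_C u))\<^sup>2 \<le> 8 * N\<^sup>2 * ((toll_part n k - xlnx u)\<^sup>2 + (toll_part n k' - xlnx (1 - u))\<^sup>2)" for u
    proof -
      define a b where "a = toll_part n k - xlnx u" and "b = toll_part n k' - xlnx (1 - u)"
      have "qs_toll n k - qs_C u = 2 * (a + b)"
        by (simp add: qs_toll_eq[OF k] qs_C_eq a_def b_def k'_def)
      moreover have "(2 * (a + b))\<^sup>2 \<le> 8 * (a\<^sup>2 + b\<^sup>2)"
        using zero_le_power2[of "a - b"] by (simp add: power2_eq_square algebra_simps)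
      ultimately have "N\<^sup>2 * (qs_toll n k - qs_C u)\<^sup>2 \<le> N\<^sup>2 * (8 * (a\<^sup>2 + b\<^sup>2))"
        by (intro mult_left_mono) auto
      then show ?thesis unfolding power_mult_distrib a_def b_def by (simp only: ac_simps)
    qed
    ultimately show ?thesis
      using up unfolding k'_def[symmetric] by (intro has_integral_le[OF integrable_integral up]) auto
  qed
  then have "(\<Sum>k<n. integral (qs_cell n k) (\<lambda>u. (N * (qs_toll n k - qs_C u))\<^sup>2)) \<le> (\<Sum>k<n. 8 * N\<^sup>2 * (I k + I (n - Suc k)))"
    by (intro sum_mono) auto
  also have "\<dots> = 8 * N\<^sup>2 * ((\<Sum>k<n. I k) + (\<Sum>k<n. I (n - Suc k)))"
    by (simp only: sum.distrib[symmetric] sum_distrib_left)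
  also have "(\<Sum>k<n. I (n - Suc k)) = (\<Sum>k<n. I k)" by (rule sum.nat_diff_reindex)
  also have "8 * N\<^sup>2 * ((\<Sum>k<n. I k) + (\<Sum>k<n. I k)) = 16 * N\<^sup>2 * (\<Sum>k<n. I k)" by simp
  also have "\<dots> \<le> 16 * N\<^sup>2 * (7 / 27 / N\<^sup>2)"
    unfolding I_def N_def by (intro mult_left_mono sum_integral_toll_part_le n) auto
  also have "\<dots> = 112 / 27" by (simp add: N_def)
  finally show ?thesis by (simp add: N_def)
qed

section \<open>Coupling with the limit law\<close>

lemma expectation_quicksort_pmf: "measure_pmf.expectation (quicksort_pmf n) real = qs_mean n"
proof (induction n rule: less_induct)
  case (less n)
  show ?case
  proof (cases n)
    case 0
    then show ?thesis by (simp add: qs_mean_def harm_def)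
  next
    case (Suc m)
    have add: "measure_pmf.expectation (pair_pmf (quicksort_pmf i) (quicksort_pmf j)) (\<lambda>(a, b). real (a + b + m))
       = measure_pmf.expectation (quicksort_pmf i) real + measure_pmf.expectation (quicksort_pmf j) real + real m" for i j
    proof -
      have fin: "finite (set_pmf (pair_pmf (quicksort_pmf i) (quicksort_pmf j)))" by simp
      have "measure_pmf.expectation (pair_pmf (quicksort_pmf i) (quicksort_pmf j)) (\<lambda>(a, b). real (a + b + m))
       = measure_pmf.expectation (pair_pmf (quicksort_pmf i) (quicksort_pmf j)) (\<lambda>x. real (fst x))
       + measure_pmf.expectation (pair_pmf (quicksort_pmf i) (quicksort_pmf j)) (\<lambda>x. real (snd x)) + real m"
        using fin by (simp add: case_prod_beta' integrable_measure_pmf_finite)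
      also have "measure_pmf.expectation (pair_pmf (quicksort_pmf i) (quicksort_pmf j)) (\<lambda>x. real (fst x))
         = measure_pmf.expectation (map_pmf fst (pair_pmf (quicksort_pmf i) (quicksort_pmf j))) real"
        by (simp only: integral_map_pmf)
      also have "measure_pmf.expectation (pair_pmf (quicksort_pmf i) (quicksort_pmf j)) (\<lambda>x. real (snd x))
         = measure_pmf.expectation (map_pmf snd (pair_pmf (quicksort_pmf i) (quicksort_pmf j))) real"
        by (simp only: integral_map_pmf)
      finally show ?thesis by (simp only: map_fst_pair_pmf map_snd_pair_pmf)
    qed
    have "measure_pmf.expectation (quicksort_pmf n) real * real n
       = (\<Sum>k<n. qs_mean k + qs_mean (n - Suc k) + real m)"
      unfolding Suc expectation_quicksort_pmf_Suc add
      by (simp add: Suc less.IH del: sum.lessThan_Suc of_nat_Suc)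
    also have "\<dots> = (\<Sum>k<n. real (Suc n) * qs_toll n k + qs_mean n)"
      by (intro sum.cong) (simp_all add: qs_toll_def Suc)
    also have "\<dots> = qs_mean n * real n"
      by (simp add: sum.distrib sum_distrib_left[symmetric] sum_qs_toll del: of_nat_Suc)
    finally show ?thesis using Suc by simp
  qed
qed

section \<open>Second moments of independent centred sums\<close>

lemma integral_mult_sq_le:
  fixes f g :: "'a \<Rightarrow> real"
  assumes [measurable]: "f \<in> borel_measurable M" "g \<in> borel_measurable M"
    and f: "integrable M (\<lambda>x. (f x)\<^sup>2)" and g: "integrable M (\<lambda>x. (g x)\<^sup>2)"
  shows "integrable M (\<lambda>x. f x * g x)"
    and "\<bar>\<integral>x. f x * g x \<partial>M\<bar> \<le> sqrt (\<integral>x. (f x)\<^sup>2 \<partial>M) * sqrt (\<integral>x. (g x)\<^sup>2 \<partial>M)"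
proof -
  show fg: "integrable M (\<lambda>x. f x * g x)"
  proof (rule Bochner_Integration.integrable_bound[OF Bochner_Integration.integrable_add[OF f g]])
    have "\<bar>a * b\<bar> \<le> a\<^sup>2 + b\<^sup>2" for a b :: real
      using sum_squares_bound[of "\<bar>a\<bar>" "\<bar>b\<bar>"] mult_nonneg_nonneg[of "\<bar>a\<bar>" "\<bar>b\<bar>"]
      unfolding abs_mult power2_abs by linarith
    then show "AE x in M. norm (f x * g x) \<le> norm ((f x)\<^sup>2 + (g x)\<^sup>2)" by (auto intro!: AE_I2)
  qed simp
  define A B C where "A = (\<integral>x. (f x)\<^sup>2 \<partial>M)" and "B = (\<integral>x. f x * g x \<partial>M)" and "C = (\<integral>x. (g x)\<^sup>2 \<partial>M)"
  have q: "0 \<le> A - 2 * t * B + t\<^sup>2 * C" for t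
  proof -
    have "0 \<le> (\<integral>x. (f x - t * g x)\<^sup>2 \<partial>M)" by simp
    also have "\<dots> = (\<integral>x. (f x)\<^sup>2 - 2 * t * (f x * g x) + t\<^sup>2 * (g x)\<^sup>2 \<partial>M)"
      by (intro Bochner_Integration.integral_cong) (auto simp: power2_eq_square algebra_simps)
    also have "\<dots> = A - 2 * t * B + t\<^sup>2 * C" using f g fg by (simp add: A_def B_def C_def)
    finally show ?thesis .
  qed
  have AC: "0 \<le> A" "0 \<le> C" by (simp_all add: A_def C_def)
  have "B\<^sup>2 \<le> A * C"
  proof (cases "C = 0")
    case True
    have "B = 0"
    proof (rule ccontr)
      assume "B \<noteq> 0"
      \<comment> \<open>The test value t = (A+1)/B would make the quadratic polynomial of q equal to
        -A - 2.\<close>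
      then have "2 * ((A + 1) / B) * B = 2 * (A + 1)" by simp
      then show False using q[of "(A + 1) / B"] True AC by simp
    qed
    then show ?thesis using AC by simp
  next
    case False
    then show ?thesis using q[of "B / C"] AC by (simp add: field_simps power2_eq_square)
  qed
  then have "sqrt (B\<^sup>2) \<le> sqrt (A * C)" by (rule real_sqrt_le_mono)
  then show "\<bar>\<integral>x. f x * g x \<partial>M\<bar> \<le> sqrt (\<integral>x. (f x)\<^sup>2 \<partial>M) * sqrt (\<integral>x. (g x)\<^sup>2 \<partial>M)"
    by (simp add: A_def B_def C_def real_sqrt_mult)
qed

text \<open>The constant c stands for the part already produced by an inner integration, so that the
  identity can be applied twice in a row.\<close>

lemma (in prob_space) nn_integral_centered_sq:
  fixes f :: "'a \<Rightarrow> real"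
  assumes f: "integrable M f" "integrable M (\<lambda>x. (f x)\<^sup>2)" "expectation f = 0" and c: "0 \<le> c"
  shows "(\<integral>\<^sup>+x. ennreal ((a + f x)\<^sup>2 + c) \<partial>M) = ennreal (expectation (\<lambda>x. (f x)\<^sup>2) + a\<^sup>2 + c)"
proof -
  have eq: "(\<lambda>x. (a + f x)\<^sup>2 + c) = (\<lambda>x. (f x)\<^sup>2 + 2 * a * f x + (a\<^sup>2 + c))"
    by (auto simp: power2_eq_square algebra_simps)
  have "(\<integral>\<^sup>+x. ennreal ((a + f x)\<^sup>2 + c) \<partial>M) = ennreal (expectation (\<lambda>x. (a + f x)\<^sup>2 + c))"
    using f c by (intro nn_integral_eq_integral) (auto simp: eq)
  also have "expectation (\<lambda>x. (a + f x)\<^sup>2 + c) = expectation (\<lambda>x. (f x)\<^sup>2) + a\<^sup>2 + c"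
    unfolding eq using f by (simp add: prob_space)
  finally show ?thesis .
qed

text \<open>Independence takes the form of iterated integration, and centring removes every cross
  term. Nonnegative integrals fit \<open>nn_integral_qs_join\<close> and avoid integrability
  questions on a product.\<close>

lemma nn_integral_sum_centered_sq:
  fixes f :: "'a \<Rightarrow> real" and g :: "'b \<Rightarrow> real"
  assumes P: "prob_space P" "integrable P f" "integrable P (\<lambda>x. (f x)\<^sup>2)" "(\<integral>x. f x \<partial>P) = 0"
    and Q: "prob_space Q" "integrable Q g" "integrable Q (\<lambda>x. (g x)\<^sup>2)" "(\<integral>x. g x \<partial>Q) = 0"
  shows "(\<integral>\<^sup>+x. \<integral>\<^sup>+y. ennreal ((f x + g y + d)\<^sup>2) \<partial>Q \<partial>P) = ennreal ((\<integral>x. (f x)\<^sup>2 \<partial>P) + (\<integral>y. (g y)\<^sup>2 \<partial>Q) + d\<^sup>2)"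
proof -
  have "(\<integral>\<^sup>+y. ennreal ((f x + g y + d)\<^sup>2) \<partial>Q) = ennreal ((d + f x)\<^sup>2 + (\<integral>y. (g y)\<^sup>2 \<partial>Q))" for x
    using prob_space.nn_integral_centered_sq[OF Q order_refl, of "f x + d"] by (simp add: ac_simps)
  then have "(\<integral>\<^sup>+x. \<integral>\<^sup>+y. ennreal ((f x + g y + d)\<^sup>2) \<partial>Q \<partial>P) = (\<integral>\<^sup>+x. ennreal ((d + f x)\<^sup>2 + (\<integral>y. (g y)\<^sup>2 \<partial>Q)) \<partial>P)"
    by simp
  also have "\<dots> = ennreal ((\<integral>x. (f x)\<^sup>2 \<partial>P) + (\<integral>y. (g y)\<^sup>2 \<partial>Q) + d\<^sup>2)"
    using prob_space.nn_integral_centered_sq[OF P, of "\<integral>y. (g y)\<^sup>2 \<partial>Q" d] by (simp add: ac_simps)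
  finally show ?thesis .
qed

lemma emeasure_qs_cell: "0 < n \<Longrightarrow> emeasure lborel (qs_cell n k) = ennreal (1 / real n)"
  by (simp add: qs_cell_def divide_right_mono add_divide_distrib)

lemma qs_cell_borel [measurable]: "qs_cell n k \<in> sets borel"
  by (simp add: qs_cell_def)

lemma sum_nn_integral_qs_cell:
  assumes n: "0 < n" and [measurable]: "g \<in> borel_measurable borel"
  shows "(\<Sum>k<n. \<integral>\<^sup>+u. g u * indicator (qs_cell n k) u \<partial>lborel) = (\<integral>\<^sup>+u. g u * indicator {0<..<1} u \<partial>lborel)"
proof -
  have "(\<Sum>k<m. \<integral>\<^sup>+u. g u * indicator (qs_cell n k) u \<partial>lborel) = (\<integral>\<^sup>+u. g u * indicator {0<..<real m / real n} u \<partial>lborel)" for m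
  proof (induction m)
    case (Suc m)
    have "(\<Sum>k<Suc m. \<integral>\<^sup>+u. g u * indicator (qs_cell n k) u \<partial>lborel)
      = (\<integral>\<^sup>+u. g u * indicator {0<..<real m / real n} u + g u * indicator (qs_cell n m) u \<partial>lborel)"
      by (simp add: Suc nn_integral_add)
    also have "\<dots> = (\<integral>\<^sup>+u. g u * indicator {0<..<real (Suc m) / real n} u \<partial>lborel)"
    proof (rule nn_integral_cong_AE)
      have le: "real m / real n \<le> real (Suc m) / real n" "0 \<le> real m / real n" by (auto intro: divide_right_mono)
      show "AE u in lborel. g u * indicator {0<..<real m / real n} u + g u * indicator (qs_cell n m) u
        = g u * indicator {0<..<real (Suc m) / real n} u"
        using AE_lborel_singleton[of "0 :: real"] AE_lborel_singleton[of "real m / real n"] AE_lborel_singleton[of "real (Suc m) / real n"]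
      proof eventually_elim
        case (elim u)
        show ?case
        proof (cases "u \<in> qs_cell n m")
          case True
          then have "real m / real n \<le> u" by (simp add: qs_cell_def)
          then have "0 < u" using le(2) elim(1) by linarith
          moreover have "u < real (Suc m) / real n" using True elim(3) by (simp add: qs_cell_def)
          ultimately have "u \<notin> {0<..<real m / real n}" "u \<in> {0<..<real (Suc m) / real n}"
            using \<open>real m / real n \<le> u\<close> unfolding greaterThanLessThan_iff by linarith+
          then show ?thesis using True by simp
        next
          case False
          then have "u \<in> {0<..<real m / real n} \<longleftrightarrow> u \<in> {0<..<real (Suc m) / real n}"
            using elim le by (auto simp: qs_cell_def simp del: of_nat_Suc)
          then show ?thesis using False by (simp add: indicator_def)
        qed
      qed
    qed
    finally show ?case .
  qed simp
  from this[of n] show ?thesis using n by simp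
qed

section \<open>The recursive coupling\<close>

definition qs_glue :: "nat \<Rightarrow> real \<times> (real \<times> real) \<times> (real \<times> real) \<Rightarrow> real \<times> real" where
  "qs_glue n = (\<lambda>(u, (x, y), (x', y')). (x + x' + real n - 1, u * y + (1 - u) * y' + qs_C u))"

lemma qs_C_measurable [measurable]: "qs_C \<in> borel_measurable borel"
  unfolding qs_C_def[abs_def] by measurable

lemma qs_glue_measurable [measurable]:
  "qs_glue n \<in> borel \<Otimes>\<^sub>M ((borel \<Otimes>\<^sub>M borel) \<Otimes>\<^sub>M (borel \<Otimes>\<^sub>M borel)) \<rightarrow>\<^sub>M borel \<Otimes>\<^sub>M borel"
  unfolding qs_glue_def case_prod_unfold by measurable

definition qs_coupling :: "real measure \<Rightarrow> nat \<Rightarrow> (real \<times> real) measure \<Rightarrow> bool" where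
  "qs_coupling M n Q \<longleftrightarrow> prob_space Q \<and> sets Q = sets (borel \<Otimes>\<^sub>M borel) \<and>
     distr Q borel fst = distr (measure_pmf (quicksort_pmf n)) borel real \<and> distr Q borel snd = M"

text \<open>With k uniform and u uniform on its cell, u is uniform on the unit interval, as the
  fixed point equation demands, while k still decides which two smaller couplings are glued.\<close>

definition qs_join :: "nat \<Rightarrow> (nat \<Rightarrow> (real \<times> real) measure) \<Rightarrow> (real \<times> real) measure" where
  "qs_join n Q = bind (measure_pmf (pmf_of_set {..<n})) (\<lambda>k.
     distr (uniform_measure lborel (qs_cell n k) \<Otimes>\<^sub>M (Q k \<Otimes>\<^sub>M Q (n - Suc k))) (borel \<Otimes>\<^sub>M borel) (qs_glue n))"

lemma
  assumes n: "0 < n" and Q: "\<And>k. prob_space (Q k)" and sets_Q: "\<And>k. sets (Q k) = sets (borel \<Otimes>\<^sub>M borel)"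
  shows prob_space_qs_join: "prob_space (qs_join n Q)"
    and sets_qs_join: "sets (qs_join n Q) = sets (borel \<Otimes>\<^sub>M borel)"
    and nn_integral_qs_join: "h \<in> borel_measurable (borel \<Otimes>\<^sub>M borel) \<Longrightarrow>
      (\<integral>\<^sup>+x. h x \<partial>qs_join n Q) = (\<Sum>k<n. \<integral>\<^sup>+u. (\<integral>\<^sup>+\<omega>. \<integral>\<^sup>+\<omega>'. h (qs_glue n (u, \<omega>, \<omega>')) \<partial>Q (n - Suc k) \<partial>Q k)
         * indicator (qs_cell n k) u \<partial>lborel)"
proof -
  define N where "N k = distr (uniform_measure lborel (qs_cell n k) \<Otimes>\<^sub>M (Q k \<Otimes>\<^sub>M Q (n - Suc k))) (borel \<Otimes>\<^sub>M borel) (qs_glue n)" for k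
  note [measurable_cong] = sets_Q
  have U: "prob_space (uniform_measure lborel (qs_cell n k))" for k
    by (rule prob_space_uniform_measure) (use n in \<open>auto simp: emeasure_qs_cell ennreal_eq_0_iff\<close>)
  interpret Q: prob_space "Q k" for k by (rule Q)
  interpret QQ: pair_prob_space "Q k" "Q j" for k j ..
  interpret U: prob_space "uniform_measure lborel (qs_cell n k)" for k by (rule U)
  interpret UQ: pair_prob_space "uniform_measure lborel (qs_cell n k)" "Q k \<Otimes>\<^sub>M Q j" for k j ..
  have glue [measurable]: "qs_glue n \<in> uniform_measure lborel (qs_cell n k) \<Otimes>\<^sub>M (Q k \<Otimes>\<^sub>M Q (n - Suc k)) \<rightarrow>\<^sub>M borel \<Otimes>\<^sub>M borel" for k
    by measurable
  have N: "N k \<in> space (prob_algebra (borel \<Otimes>\<^sub>M borel))" for k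
    unfolding N_def space_prob_algebra by (auto intro!: UQ.prob_space_distr)
  have Nm: "N \<in> measure_pmf (pmf_of_set {..<n}) \<rightarrow>\<^sub>M prob_algebra (borel \<Otimes>\<^sub>M borel)"
    using N by auto
  have join: "qs_join n Q = bind (measure_pmf (pmf_of_set {..<n})) N"
    by (simp add: qs_join_def N_def[abs_def])
  have pmf: "measure_pmf (pmf_of_set {..<n}) \<in> space (prob_algebra (measure_pmf (pmf_of_set {..<n})))"
    by (simp add: space_prob_algebra measure_pmf.prob_space_axioms)
  show "prob_space (qs_join n Q)" unfolding join by (rule prob_space_bind'[OF pmf Nm])
  show "sets (qs_join n Q) = sets (borel \<Otimes>\<^sub>M borel)" unfolding join by (rule sets_bind'[OF pmf Nm])
  assume h [measurable]: "h \<in> borel_measurable (borel \<Otimes>\<^sub>M borel)"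
  have inner: "(\<integral>\<^sup>+x. h x \<partial>N k) = (\<integral>\<^sup>+u. (\<integral>\<^sup>+\<omega>. \<integral>\<^sup>+\<omega>'. h (qs_glue n (u, \<omega>, \<omega>')) \<partial>Q (n - Suc k) \<partial>Q k)
       * indicator (qs_cell n k) u \<partial>lborel) * ennreal (real n)" for k
  proof -
    have "(\<integral>\<^sup>+x. h x \<partial>N k) = (\<integral>\<^sup>+x. h (qs_glue n x) \<partial>(uniform_measure lborel (qs_cell n k) \<Otimes>\<^sub>M (Q k \<Otimes>\<^sub>M Q (n - Suc k))))"
      unfolding N_def by (rule nn_integral_distr) measurable
    also have "\<dots> = (\<integral>\<^sup>+u. \<integral>\<^sup>+w. h (qs_glue n (u, w)) \<partial>(Q k \<Otimes>\<^sub>M Q (n - Suc k)) \<partial>uniform_measure lborel (qs_cell n k))"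
      by (rule QQ.nn_integral_fst[symmetric]) measurable
    also have "\<dots> = (\<integral>\<^sup>+u. \<integral>\<^sup>+\<omega>. \<integral>\<^sup>+\<omega>'. h (qs_glue n (u, \<omega>, \<omega>')) \<partial>Q (n - Suc k) \<partial>Q k \<partial>uniform_measure lborel (qs_cell n k))"
      by (intro nn_integral_cong Q.nn_integral_fst[symmetric]) measurable
    also have "\<dots> = (\<integral>\<^sup>+u. (\<integral>\<^sup>+\<omega>. \<integral>\<^sup>+\<omega>'. h (qs_glue n (u, \<omega>, \<omega>')) \<partial>Q (n - Suc k) \<partial>Q k) * indicator (qs_cell n k) u \<partial>lborel) / ennreal (1 / real n)"
      using n by (subst nn_integral_uniform_measure) (auto simp: emeasure_qs_cell)
    also have "\<dots> = (\<integral>\<^sup>+u. (\<integral>\<^sup>+\<omega>. \<integral>\<^sup>+\<omega>'. h (qs_glue n (u, \<omega>, \<omega>')) \<partial>Q (n - Suc k) \<partial>Q k) * indicator (qs_cell n k) u \<partial>lborel) * ennreal (real n)"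
      using n by (simp add: divide_ennreal_def inverse_ennreal)
    finally show ?thesis .
  qed
  have "(\<integral>\<^sup>+x. h x \<partial>qs_join n Q) = (\<integral>\<^sup>+k. \<integral>\<^sup>+x. h x \<partial>N k \<partial>pmf_of_set {..<n})"
    unfolding join by (rule nn_integral_bind[OF h measurable_prob_algebraD[OF Nm]])
  also have "\<dots> = (\<Sum>k<n. \<integral>\<^sup>+x. h x \<partial>N k) / ennreal (real n)"
    using n by (subst nn_integral_pmf_of_set) (auto simp: lessThan_empty_iff ennreal_of_nat_eq_real_of_nat)
  \<comment> \<open>The probability 1/n of each pivot cancels the density n of u on its
    cell.\<close>
  also have "\<dots> = (\<Sum>k<n. \<integral>\<^sup>+u. (\<integral>\<^sup>+\<omega>. \<integral>\<^sup>+\<omega>'. h (qs_glue n (u, \<omega>, \<omega>')) \<partial>Q (n - Suc k) \<partial>Q k)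
         * indicator (qs_cell n k) u \<partial>lborel)"
    unfolding inner sum_distrib_right[symmetric] using n by (subst ennreal_mult_divide_eq) auto
  finally show "(\<integral>\<^sup>+x. h x \<partial>qs_join n Q) = (\<Sum>k<n. \<integral>\<^sup>+u. (\<integral>\<^sup>+\<omega>. \<integral>\<^sup>+\<omega>'. h (qs_glue n (u, \<omega>, \<omega>')) \<partial>Q (n - Suc k) \<partial>Q k)
         * indicator (qs_cell n k) u \<partial>lborel)" .
qed

lemma quicksort_limit_lawD:
  assumes "quicksort_limit_law M"
  shows "prob_space M" "sets M = sets borel" "integrable M (\<lambda>y. y)" "integrable M (\<lambda>y. y\<^sup>2)" "(\<integral>y. y \<partial>M) = 0"
    "distr (uniform_measure lborel {0<..<1::real} \<Otimes>\<^sub>M (M \<Otimes>\<^sub>M M)) borel (\<lambda>(u, y, y'). u * y + (1 - u) * y' + qs_C u) = M"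
  using assms by (simp_all add: quicksort_limit_law_def)

lemma nn_integral_limit_law:
  assumes M: "quicksort_limit_law M" and [measurable]: "h \<in> borel_measurable borel"
  shows "(\<integral>\<^sup>+y. h y \<partial>M) = (\<integral>\<^sup>+u. (\<integral>\<^sup>+y. \<integral>\<^sup>+y'. h (u * y + (1 - u) * y' + qs_C u) \<partial>M \<partial>M) * indicator {0<..<1} u \<partial>lborel)"
proof -
  note [measurable_cong] = quicksort_limit_lawD(2)[OF M]
  interpret M: prob_space M by (rule quicksort_limit_lawD(1)[OF M])
  interpret MM: pair_prob_space M M ..
  have "(\<integral>\<^sup>+y. h y \<partial>M) = (\<integral>\<^sup>+y. h y \<partial>distr (uniform_measure lborel {0<..<1::real} \<Otimes>\<^sub>M (M \<Otimes>\<^sub>M M)) borel (\<lambda>(u, y, y'). u * y + (1 - u) * y' + qs_C u))"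
    by (simp add: quicksort_limit_lawD(6)[OF M])
  also have "\<dots> = (\<integral>\<^sup>+x. (case x of (u, y, y') \<Rightarrow> h (u * y + (1 - u) * y' + qs_C u)) \<partial>(uniform_measure lborel {0<..<1::real} \<Otimes>\<^sub>M (M \<Otimes>\<^sub>M M)))"
    by (subst nn_integral_distr) (auto simp: case_prod_unfold)
  also have "\<dots> = (\<integral>\<^sup>+u. \<integral>\<^sup>+w. (case w of (y, y') \<Rightarrow> h (u * y + (1 - u) * y' + qs_C u)) \<partial>(M \<Otimes>\<^sub>M M) \<partial>uniform_measure lborel {0<..<1::real})"
    by (subst MM.nn_integral_fst[symmetric]) (auto simp: case_prod_unfold)
  also have "\<dots> = (\<integral>\<^sup>+u. \<integral>\<^sup>+y. \<integral>\<^sup>+y'. h (u * y + (1 - u) * y' + qs_C u) \<partial>M \<partial>M \<partial>uniform_measure lborel {0<..<1::real})"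
    by (intro nn_integral_cong, subst M.nn_integral_fst[symmetric]) (auto simp: case_prod_unfold)
  also have "\<dots> = (\<integral>\<^sup>+u. (\<integral>\<^sup>+y. \<integral>\<^sup>+y'. h (u * y + (1 - u) * y' + qs_C u) \<partial>M \<partial>M) * indicator {0<..<1} u \<partial>lborel)"
    by (subst nn_integral_uniform_measure) (auto simp: divide_ennreal_def)
  finally show ?thesis .
qed

context
  fixes M n Q
  assumes Q: "qs_coupling M n Q"
begin

lemma qs_couplingD: "prob_space Q" "sets Q = sets (borel \<Otimes>\<^sub>M borel)"
    "distr Q borel fst = distr (measure_pmf (quicksort_pmf n)) borel real" "distr Q borel snd = M"
  using Q by (simp_all add: qs_coupling_def)

lemma qs_coupling_measurable: "fst \<in> Q \<rightarrow>\<^sub>M borel" "snd \<in> Q \<rightarrow>\<^sub>M borel"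
  using measurable_fst[of borel borel] measurable_snd[of borel borel]
  by (simp_all add: measurable_cong_sets[OF qs_couplingD(2) refl])

lemma nn_integral_qs_coupling_fst:
  assumes "f \<in> borel_measurable borel"
  shows "(\<integral>\<^sup>+\<omega>. f (fst \<omega>) \<partial>Q) = (\<integral>\<^sup>+x. f (real x) \<partial>quicksort_pmf n)"
  using nn_integral_distr[OF qs_coupling_measurable(1), of f] nn_integral_distr[of real "measure_pmf (quicksort_pmf n)" borel f] assms
  by (simp add: qs_couplingD(3))

lemma nn_integral_qs_coupling_snd:
  assumes "f \<in> borel_measurable borel"
  shows "(\<integral>\<^sup>+\<omega>. f (snd \<omega>) \<partial>Q) = (\<integral>\<^sup>+y. f y \<partial>M)"
proof -
  have "f \<in> borel_measurable (distr Q borel snd)" using assms by simp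
  from nn_integral_distr[OF qs_coupling_measurable(2) this] show ?thesis
    unfolding qs_couplingD(4) by simp
qed

lemma integral_qs_coupling_fst:
  fixes f :: "real \<Rightarrow> 'b :: {banach, second_countable_topology}"
  assumes "f \<in> borel_measurable borel"
  shows "integrable Q (\<lambda>\<omega>. f (fst \<omega>))" "(\<integral>\<omega>. f (fst \<omega>) \<partial>Q) = measure_pmf.expectation (quicksort_pmf n) (\<lambda>x. f (real x))"
proof -
  have "integrable (distr Q borel fst) f"
    unfolding qs_couplingD(3) by (subst integrable_distr_eq) (use assms in auto)
  then show "integrable Q (\<lambda>\<omega>. f (fst \<omega>))"
    by (rule integrable_distr[OF qs_coupling_measurable(1)])
  show "(\<integral>\<omega>. f (fst \<omega>) \<partial>Q) = measure_pmf.expectation (quicksort_pmf n) (\<lambda>x. f (real x))"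
    using integral_distr[OF qs_coupling_measurable(1) assms] integral_distr[of real "measure_pmf (quicksort_pmf n)" borel f] assms
    by (simp add: qs_couplingD(3))
qed

lemma integral_qs_coupling_snd:
  fixes f :: "real \<Rightarrow> 'b :: {banach, second_countable_topology}"
  assumes "f \<in> borel_measurable borel"
  shows "integrable Q (\<lambda>\<omega>. f (snd \<omega>)) \<longleftrightarrow> integrable M f" "(\<integral>\<omega>. f (snd \<omega>) \<partial>Q) = (\<integral>y. f y \<partial>M)"
  using integrable_distr_eq[OF qs_coupling_measurable(2) assms] integral_distr[OF qs_coupling_measurable(2) assms]
  by (simp_all add: qs_couplingD(4))

end

text \<open>For the counts, u drops out of the inner integral and each cell contributes its length
  1/n. For the limit variable, both subpairs have second marginal M whatever k is, so the integrand
  depends on u alone and the cells reassemble to (0,1).\<close>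

lemma qs_coupling_join:
  assumes M: "quicksort_limit_law M" and n: "0 < n"
    and Q: "\<And>k. prob_space (Q k)" "\<And>k. sets (Q k) = sets (borel \<Otimes>\<^sub>M borel)"
    and coup: "\<And>k. k < n \<Longrightarrow> qs_coupling M k (Q k)"
  shows "qs_coupling M n (qs_join n Q)"
proof -
  note join = prob_space_qs_join[OF n Q] sets_qs_join[OF n Q] nn_integral_qs_join[OF n Q]
  interpret J: prob_space "qs_join n Q" by (rule join(1))
  have [measurable]: "fst \<in> qs_join n Q \<rightarrow>\<^sub>M borel" "snd \<in> qs_join n Q \<rightarrow>\<^sub>M borel"
    using measurable_fst[of borel borel] measurable_snd[of borel borel]
    by (simp_all add: measurable_cong_sets[OF join(2) refl])
  obtain m where m: "n = Suc m" using n gr0_conv_Suc by blast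
  have X: "distr (qs_join n Q) borel fst = distr (measure_pmf (quicksort_pmf n)) borel real"
  proof (rule measure_eqI)
    fix A assume "A \<in> sets (distr (qs_join n Q) borel fst)"
    then have A [measurable]: "A \<in> sets borel" by simp
    define c where "c k = (\<integral>\<^sup>+a. \<integral>\<^sup>+b. indicator A (real a + real b + real n - 1) \<partial>quicksort_pmf (n - Suc k) \<partial>quicksort_pmf k)" for k
    have "emeasure (distr (qs_join n Q) borel fst) A = (\<integral>\<^sup>+x. indicator A x \<partial>distr (qs_join n Q) borel fst)"
      by simp
    also have "\<dots> = (\<integral>\<^sup>+x. indicator A (fst x) \<partial>qs_join n Q)"
      by (rule nn_integral_distr) auto
    also have "\<dots> = (\<Sum>k<n. \<integral>\<^sup>+u. (\<integral>\<^sup>+\<omega>. \<integral>\<^sup>+\<omega>'. indicator A (fst (qs_glue n (u, \<omega>, \<omega>'))) \<partial>Q (n - Suc k) \<partial>Q k)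
         * indicator (qs_cell n k) u \<partial>lborel)"
      by (rule join(3)) measurable
    also have "\<dots> = (\<Sum>k<n. c k / ennreal (real n))"
    proof (intro sum.cong refl)
      fix k assume "k \<in> {..<n}"
      then have k: "k < n" "n - Suc k < n" by auto
      have "(\<integral>\<^sup>+\<omega>. \<integral>\<^sup>+\<omega>'. indicator A (fst (qs_glue n (u, \<omega>, \<omega>'))) \<partial>Q (n - Suc k) \<partial>Q k) = c k" for u
      proof -
        have "(\<integral>\<^sup>+\<omega>. \<integral>\<^sup>+\<omega>'. indicator A (fst (qs_glue n (u, \<omega>, \<omega>'))) \<partial>Q (n - Suc k) \<partial>Q k)
          = (\<integral>\<^sup>+\<omega>. \<integral>\<^sup>+\<omega>'. indicator A (fst \<omega> + fst \<omega>' + real n - 1) \<partial>Q (n - Suc k) \<partial>Q k)"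
          by (simp add: qs_glue_def case_prod_unfold)
        also have "\<dots> = (\<integral>\<^sup>+\<omega>. \<integral>\<^sup>+b. indicator A (fst \<omega> + real b + real n - 1) \<partial>quicksort_pmf (n - Suc k) \<partial>Q k)"
          by (intro nn_integral_cong nn_integral_qs_coupling_fst[OF coup[OF k(2)], of "\<lambda>x. indicator A (_ + x + real n - 1)"]) measurable
        also have "\<dots> = c k" unfolding c_def
          by (rule nn_integral_qs_coupling_fst[OF coup[OF k(1)], of "\<lambda>x. \<integral>\<^sup>+b. indicator A (x + real b + real n - 1) \<partial>quicksort_pmf (n - Suc k)"]) measurable
        finally show ?thesis .
      qed
      then have "(\<integral>\<^sup>+u. (\<integral>\<^sup>+\<omega>. \<integral>\<^sup>+\<omega>'. indicator A (fst (qs_glue n (u, \<omega>, \<omega>'))) \<partial>Q (n - Suc k) \<partial>Q k)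
         * indicator (qs_cell n k) u \<partial>lborel) = c k * ennreal (1 / real n)"
        using n by (simp add: nn_integral_cmult_indicator emeasure_qs_cell)
      then show "(\<integral>\<^sup>+u. (\<integral>\<^sup>+\<omega>. \<integral>\<^sup>+\<omega>'. indicator A (fst (qs_glue n (u, \<omega>, \<omega>'))) \<partial>Q (n - Suc k) \<partial>Q k)
         * indicator (qs_cell n k) u \<partial>lborel) = c k / ennreal (real n)"
        using n by (simp add: divide_ennreal_def inverse_ennreal inverse_eq_divide)
    qed
    also have "\<dots> = (\<Sum>k<n. c k) / ennreal (real n)"
      by (simp add: divide_ennreal_def sum_distrib_right)
    also have "\<dots> = (\<integral>\<^sup>+x. indicator A (real x) \<partial>quicksort_pmf n)"
      unfolding m quicksort_pmf_Suc c_def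
      by (simp add: nn_integral_pair_pmf' nn_integral_pmf_of_set ennreal_of_nat_eq_real_of_nat lessThan_empty_iff
          del: sum.lessThan_Suc of_nat_Suc) (simp add: m add.commute)
    also have "\<dots> = (\<integral>\<^sup>+x. indicator A x \<partial>distr (measure_pmf (quicksort_pmf n)) borel real)"
      by (rule nn_integral_distr[symmetric]) auto
    also have "\<dots> = emeasure (distr (measure_pmf (quicksort_pmf n)) borel real) A"
      by simp
    finally show "emeasure (distr (qs_join n Q) borel fst) A = emeasure (distr (measure_pmf (quicksort_pmf n)) borel real) A" .
  qed simp
  have Y: "distr (qs_join n Q) borel snd = M"
  proof (rule measure_eqI)
    fix A assume "A \<in> sets (distr (qs_join n Q) borel snd)"
    then have A [measurable]: "A \<in> sets borel" by simp
    note [measurable_cong] = quicksort_limit_lawD(2)[OF M]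
    interpret M: prob_space M by (rule quicksort_limit_lawD(1)[OF M])
    define G where "G u = (\<integral>\<^sup>+y. \<integral>\<^sup>+y'. indicator A (u * y + (1 - u) * y' + qs_C u) \<partial>M \<partial>M)" for u
    have [measurable]: "G \<in> borel_measurable borel" unfolding G_def[abs_def] by measurable
    have "emeasure (distr (qs_join n Q) borel snd) A = (\<integral>\<^sup>+x. indicator A x \<partial>distr (qs_join n Q) borel snd)"
      by simp
    also have "\<dots> = (\<integral>\<^sup>+x. indicator A (snd x) \<partial>qs_join n Q)"
      by (rule nn_integral_distr) auto
    also have "\<dots> = (\<Sum>k<n. \<integral>\<^sup>+u. (\<integral>\<^sup>+\<omega>. \<integral>\<^sup>+\<omega>'. indicator A (snd (qs_glue n (u, \<omega>, \<omega>'))) \<partial>Q (n - Suc k) \<partial>Q k)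
         * indicator (qs_cell n k) u \<partial>lborel)"
      by (rule join(3)) measurable
    also have "\<dots> = (\<Sum>k<n. \<integral>\<^sup>+u. G u * indicator (qs_cell n k) u \<partial>lborel)"
    proof (intro sum.cong refl)
      fix k assume "k \<in> {..<n}"
      then have k: "k < n" "n - Suc k < n" by auto
      have "(\<integral>\<^sup>+\<omega>. \<integral>\<^sup>+\<omega>'. indicator A (snd (qs_glue n (u, \<omega>, \<omega>'))) \<partial>Q (n - Suc k) \<partial>Q k) = G u" for u
      proof -
        have "(\<integral>\<^sup>+\<omega>. \<integral>\<^sup>+\<omega>'. indicator A (snd (qs_glue n (u, \<omega>, \<omega>'))) \<partial>Q (n - Suc k) \<partial>Q k)
          = (\<integral>\<^sup>+\<omega>. \<integral>\<^sup>+\<omega>'. indicator A (u * snd \<omega> + (1 - u) * snd \<omega>' + qs_C u) \<partial>Q (n - Suc k) \<partial>Q k)"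
          by (simp add: qs_glue_def case_prod_unfold)
        also have "\<dots> = (\<integral>\<^sup>+\<omega>. \<integral>\<^sup>+y'. indicator A (u * snd \<omega> + (1 - u) * y' + qs_C u) \<partial>M \<partial>Q k)"
          by (intro nn_integral_cong nn_integral_qs_coupling_snd[OF coup[OF k(2)], of "\<lambda>y. indicator A (_ + (1 - u) * y + qs_C u)"]) measurable
        also have "\<dots> = G u" unfolding G_def
          by (rule nn_integral_qs_coupling_snd[OF coup[OF k(1)], of "\<lambda>y. \<integral>\<^sup>+y'. indicator A (u * y + (1 - u) * y' + qs_C u) \<partial>M"]) measurable
        finally show ?thesis .
      qed
      then show "(\<integral>\<^sup>+u. (\<integral>\<^sup>+\<omega>. \<integral>\<^sup>+\<omega>'. indicator A (snd (qs_glue n (u, \<omega>, \<omega>'))) \<partial>Q (n - Suc k) \<partial>Q k)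
         * indicator (qs_cell n k) u \<partial>lborel) = (\<integral>\<^sup>+u. G u * indicator (qs_cell n k) u \<partial>lborel)" by simp
    qed
    also have "\<dots> = (\<integral>\<^sup>+u. G u * indicator {0<..<1} u \<partial>lborel)"
      by (rule sum_nn_integral_qs_cell[OF n]) measurable
    also have "\<dots> = (\<integral>\<^sup>+y. indicator A y \<partial>M)"
      unfolding G_def by (rule nn_integral_limit_law[OF M, symmetric]) measurable
    also have "\<dots> = emeasure M A" by simp
    finally show "emeasure (distr (qs_join n Q) borel snd) A = emeasure M A" .
  qed (simp add: quicksort_limit_lawD(2)[OF M])
  show ?thesis using join X Y by (simp add: qs_coupling_def)
qed

section \<open>Second moment of the coupled deviation\<close>

lemma nn_integral_qs_cell:
  assumes [measurable]: "G \<in> borel_measurable borel" and nonneg: "\<And>u. 0 \<le> G u" and I: "(G has_integral I) (qs_cell n k)"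
  shows "(\<integral>\<^sup>+u. ennreal (G u) * indicator (qs_cell n k) u \<partial>lborel) = ennreal I"
proof -
  have "(\<lambda>u. indicator (qs_cell n k) u * G u) = (\<lambda>u. if u \<in> qs_cell n k then G u else 0)" by auto
  then have "((\<lambda>u. indicator (qs_cell n k) u * G u) has_integral I) UNIV"
    using I by (simp only: has_integral_restrict_UNIV)
  then have "(\<integral>\<^sup>+u. ennreal (indicator (qs_cell n k) u * G u) \<partial>lborel) = ennreal I"
    by (intro nn_integral_has_integral_lborel) (auto simp: nonneg)
  moreover have "ennreal (indicator (qs_cell n k) u * G u) = ennreal (G u) * indicator (qs_cell n k) u" for u
    by (simp add: indicator_def)
  ultimately show ?thesis by simp
qed

text \<open>Scaled by n+1 to match the weights p_k. The final estimate concerns X_n - mu_n - n Y,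
  which is this deviation plus one more Y.\<close>

definition qs_dev :: "nat \<Rightarrow> real \<times> real \<Rightarrow> real" where
  "qs_dev n \<omega> = fst \<omega> - qs_mean n - (real n + 1) * snd \<omega>"

lemma qs_dev_measurable [measurable]: "qs_dev n \<in> borel_measurable (borel \<Otimes>\<^sub>M borel)"
  unfolding qs_dev_def[abs_def] by measurable

text \<open>The first subproblem has share p_k in the count but share u in Y. The mismatch (n+1)(p_k
  - u) hits the two copies of Y with opposite signs because the shares add up to 1 on both
  sides.\<close>

lemma qs_dev_glue:
  assumes "k < n"
  shows "qs_dev n (qs_glue n (u, \<omega>, \<omega>')) =
    (qs_dev k \<omega> + (real (Suc k) - (real n + 1) * u) * snd \<omega>)
    + (qs_dev (n - Suc k) \<omega>' - (real (Suc k) - (real n + 1) * u) * snd \<omega>')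
    + (real n + 1) * (qs_toll n k - qs_C u)"
proof -
  have t: "(real n + 1) * qs_toll n k = real n - 1 + qs_mean k + qs_mean (n - Suc k) - qs_mean n"
    by (simp add: qs_toll_def add.commute)
  have t2: "(real n + 1) * (qs_toll n k - qs_C u) = real n - 1 + qs_mean k + qs_mean (n - Suc k) - qs_mean n - (real n + 1) * qs_C u"
    by (simp only: right_diff_distrib t)
  have lhs: "qs_dev n (qs_glue n (u, \<omega>, \<omega>')) = fst \<omega> + fst \<omega>' + real n - 1 - qs_mean n
     - (real n + 1) * (u * snd \<omega> + (1 - u) * snd \<omega>' + qs_C u)"
    by (simp add: qs_dev_def qs_glue_def case_prod_unfold)
  have k: "real (n - Suc k) = real n - real k - 1" "real (Suc k) = real k + 1"
    using assms by (simp_all add: of_nat_diff)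
  have gen: "a + a' + x - 1 - m - (x + 1) * (u * s + (1 - u) * s' + c)
      = (a - p - (j + 1) * s + (j + 1 - (x + 1) * u) * s) + (a' - p' - (x - j - 1 + 1) * s' - (j + 1 - (x + 1) * u) * s')
        + (x - 1 + p + p' - m - (x + 1) * c)" for a a' x m s s' c p p' j :: real
    by algebra
  show ?thesis unfolding lhs t2 unfolding qs_dev_def k by (rule gen)
qed

lemma qs_coupling_dev:
  assumes M: "quicksort_limit_law M" and Q: "qs_coupling M n Q"
  shows "integrable Q (\<lambda>\<omega>. snd \<omega>)" "(\<integral>\<omega>. snd \<omega> \<partial>Q) = 0"
    "integrable Q (\<lambda>\<omega>. (snd \<omega>)\<^sup>2)" "(\<integral>\<omega>. (snd \<omega>)\<^sup>2 \<partial>Q) = (\<integral>y. y\<^sup>2 \<partial>M)"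
    "integrable Q (qs_dev n)" "(\<integral>\<omega>. qs_dev n \<omega> \<partial>Q) = 0" "integrable Q (\<lambda>\<omega>. (qs_dev n \<omega>)\<^sup>2)"
    "integrable Q (\<lambda>\<omega>. qs_dev n \<omega> * snd \<omega>)"
    "\<bar>\<integral>\<omega>. qs_dev n \<omega> * snd \<omega> \<partial>Q\<bar> \<le> sqrt (\<integral>\<omega>. (qs_dev n \<omega>)\<^sup>2 \<partial>Q) * sqrt (\<integral>y. y\<^sup>2 \<partial>M)"
proof -
  note [measurable_cong] = qs_couplingD(2)[OF Q]
  note fst_int = integral_qs_coupling_fst[OF Q, where 'b = real] and snd_int = integral_qs_coupling_snd[OF Q, where 'b = real]
  interpret Q: prob_space Q by (rule qs_couplingD(1)[OF Q])
  have b: "(\<lambda>y. y) \<in> borel_measurable (borel :: real measure)" "(\<lambda>y. y\<^sup>2) \<in> borel_measurable (borel :: real measure)"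
    by measurable
  show s: "integrable Q (\<lambda>\<omega>. snd \<omega>)" "(\<integral>\<omega>. snd \<omega> \<partial>Q) = 0"
    unfolding snd_int[OF b(1)] by (rule quicksort_limit_lawD(3,5)[OF M])+
  show s2: "integrable Q (\<lambda>\<omega>. (snd \<omega>)\<^sup>2)" "(\<integral>\<omega>. (snd \<omega>)\<^sup>2 \<partial>Q) = (\<integral>y. y\<^sup>2 \<partial>M)"
    unfolding snd_int[OF b(2)] by (rule quicksort_limit_lawD(4)[OF M] refl)+
  have f: "integrable Q (\<lambda>\<omega>. fst \<omega>)" "(\<integral>\<omega>. fst \<omega> \<partial>Q) = qs_mean n"
    using fst_int[OF b(1)] unfolding expectation_quicksort_pmf by blast+
  have f2: "integrable Q (\<lambda>\<omega>. (fst \<omega> - qs_mean n)\<^sup>2)"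
    by (rule fst_int(1)) measurable
  have fs: "integrable Q (\<lambda>\<omega>. (fst \<omega> - qs_mean n) * snd \<omega>)"
    by (rule integral_mult_sq_le(1)[OF _ _ f2 s2(1)]) measurable
  show d: "integrable Q (qs_dev n)" "(\<integral>\<omega>. qs_dev n \<omega> \<partial>Q) = 0"
    using f s by (simp_all add: qs_dev_def[abs_def] Q.prob_space)
  have "(\<lambda>\<omega>. (qs_dev n \<omega>)\<^sup>2) = (\<lambda>\<omega>. (fst \<omega> - qs_mean n)\<^sup>2 - 2 * (real n + 1) * ((fst \<omega> - qs_mean n) * snd \<omega>) + (real n + 1)\<^sup>2 * (snd \<omega>)\<^sup>2)"
    by (auto simp: qs_dev_def power2_eq_square algebra_simps)
  then show d2: "integrable Q (\<lambda>\<omega>. (qs_dev n \<omega>)\<^sup>2)"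
    using f2 fs s2 by simp
  show "integrable Q (\<lambda>\<omega>. qs_dev n \<omega> * snd \<omega>)"
    "\<bar>\<integral>\<omega>. qs_dev n \<omega> * snd \<omega> \<partial>Q\<bar> \<le> sqrt (\<integral>\<omega>. (qs_dev n \<omega>)\<^sup>2 \<partial>Q) * sqrt (\<integral>y. y\<^sup>2 \<partial>M)"
    using integral_mult_sq_le[OF _ _ d2 s2(1)] by (simp_all add: s2(2))
qed

lemma qs_coupling_dev_shift:
  assumes M: "quicksort_limit_law M" and Q: "qs_coupling M n Q"
  shows "integrable Q (\<lambda>\<omega>. qs_dev n \<omega> + d * snd \<omega>)" "(\<integral>\<omega>. qs_dev n \<omega> + d * snd \<omega> \<partial>Q) = 0"
    "integrable Q (\<lambda>\<omega>. (qs_dev n \<omega> + d * snd \<omega>)\<^sup>2)"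
    "(\<integral>\<omega>. (qs_dev n \<omega> + d * snd \<omega>)\<^sup>2 \<partial>Q) = (\<integral>\<omega>. (qs_dev n \<omega>)\<^sup>2 \<partial>Q) + 2 * d * (\<integral>\<omega>. qs_dev n \<omega> * snd \<omega> \<partial>Q) + d\<^sup>2 * (\<integral>y. y\<^sup>2 \<partial>M)"
proof -
  note D = qs_coupling_dev[OF M Q]
  show "integrable Q (\<lambda>\<omega>. qs_dev n \<omega> + d * snd \<omega>)" "(\<integral>\<omega>. qs_dev n \<omega> + d * snd \<omega> \<partial>Q) = 0"
    using D by simp_all
  have eq: "(\<lambda>\<omega>. (qs_dev n \<omega> + d * snd \<omega>)\<^sup>2) = (\<lambda>\<omega>. (qs_dev n \<omega>)\<^sup>2 + 2 * d * (qs_dev n \<omega> * snd \<omega>) + d\<^sup>2 * (snd \<omega>)\<^sup>2)"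
    by (auto simp: power2_eq_square algebra_simps)
  show "integrable Q (\<lambda>\<omega>. (qs_dev n \<omega> + d * snd \<omega>)\<^sup>2)"
    "(\<integral>\<omega>. (qs_dev n \<omega> + d * snd \<omega>)\<^sup>2 \<partial>Q) = (\<integral>\<omega>. (qs_dev n \<omega>)\<^sup>2 \<partial>Q) + 2 * d * (\<integral>\<omega>. qs_dev n \<omega> * snd \<omega> \<partial>Q) + d\<^sup>2 * (\<integral>y. y\<^sup>2 \<partial>M)"
    unfolding eq using D by simp_all
qed

lemma has_integral_real_FTC:
  fixes f F :: "real \<Rightarrow> real"
  assumes "a \<le> b" "\<And>x. (F has_real_derivative f x) (at x)"
  shows "(f has_integral (F b - F a)) {a..b}"
  using assms by (intro fundamental_theorem_of_calculus)
    (auto simp: has_real_derivative_iff_has_vector_derivative[symmetric] intro: has_field_derivative_at_within)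

text \<open>Multiplied by n, the first integral is (n+1)(p_k - E(U | k)), the bias that keeps cross
  terms alive; it stays below 1/2 in modulus although the factor n+1 grows.\<close>

lemma qs_cell_shift_integrals:
  fixes k n :: nat
  assumes "0 < n"
  defines "\<delta> \<equiv> \<lambda>u. real (Suc k) - (real n + 1) * u"
  shows "(\<delta> has_integral (1 / 2 - (real k + 1 / 2) / real n) / real n) (qs_cell n k)"
    and "((\<lambda>u. (\<delta> u)\<^sup>2) has_integral ((real n - real k) ^ 3 + (real k + 1) ^ 3) / (3 * (real n + 1) * (real n) ^ 3)) (qs_cell n k)"
proof -
  define x N K where "x = real n" and "N = x + 1" and "K = real (Suc k)"
  have x: "0 < x" "0 < N" "real n = x" "x + 1 = N" using assms by (auto simp: x_def N_def)
  have k: "real k = K - 1" by (simp add: K_def)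
  have "(\<delta> has_integral (K * (K / x) - N * (K / x)\<^sup>2 / 2 - (K * ((K - 1) / x) - N * ((K - 1) / x)\<^sup>2 / 2))) {(K - 1) / x..K / x}"
    unfolding \<delta>_def K_def[symmetric] x(3) x(4)
    by (rule has_integral_real_FTC[of _ _ "\<lambda>u. K * u - N * u\<^sup>2 / 2"])
      (use x in \<open>auto intro!: derivative_eq_intros divide_right_mono\<close>)
  moreover have "K * (K / x) - N * (K / x)\<^sup>2 / 2 - (K * ((K - 1) / x) - N * ((K - 1) / x)\<^sup>2 / 2) = (1 / 2 - (real k + 1 / 2) / real n) / real n"
    unfolding k x(3) using x(1) by (simp add: N_def field_simps power2_eq_square)
  ultimately show "(\<delta> has_integral (1 / 2 - (real k + 1 / 2) / real n) / real n) (qs_cell n k)"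
    unfolding qs_cell_def K_def[symmetric] k x(3) by simp
  have "((\<lambda>u. (\<delta> u)\<^sup>2) has_integral (- ((K - N * (K / x)) ^ 3) / (3 * N) - (- ((K - N * ((K - 1) / x)) ^ 3) / (3 * N)))) {(K - 1) / x..K / x}"
    unfolding \<delta>_def K_def[symmetric] x(3) x(4)
    by (rule has_integral_real_FTC[of _ _ "\<lambda>u. - ((K - N * u) ^ 3) / (3 * N)"])
      (use x(1,2) in \<open>auto intro!: derivative_eq_intros divide_right_mono simp: field_simps\<close>)
  moreover have "- ((K - N * (K / x)) ^ 3) / (3 * N) - (- ((K - N * ((K - 1) / x)) ^ 3) / (3 * N))
     = ((real n - real k) ^ 3 + (real k + 1) ^ 3) / (3 * (real n + 1) * (real n) ^ 3)"
  proof -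
    have 1: "K - N * (K / x) = - (K / x)" using x(1) by (simp add: N_def field_simps)
    have 2: "K - N * ((K - 1) / x) = (x - (K - 1)) / x" using x(1) by (simp add: N_def field_simps)
    show ?thesis unfolding 1 2 k x(3) x(4) using x(1,2)
      by (simp add: power_divide add_divide_distrib add.commute mult.commute)
  qed
  ultimately show "((\<lambda>u. (\<delta> u)\<^sup>2) has_integral ((real n - real k) ^ 3 + (real k + 1) ^ 3) / (3 * (real n + 1) * (real n) ^ 3)) (qs_cell n k)"
    unfolding qs_cell_def K_def[symmetric] k x(3) by (simp only:)
qed

lemma sum_cubes: "(\<Sum>k<n. (real k + 1) ^ 3) = (real n)\<^sup>2 * (real n + 1)\<^sup>2 / 4"
  by (induction n) (auto simp: field_simps power2_eq_square power3_eq_cube)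

lemma sum_shift_sq: 
  assumes "0 < n"
  shows "(\<Sum>k<n. ((real n - real k) ^ 3 + (real k + 1) ^ 3) / (3 * (real n + 1) * (real n) ^ 3)) = (real n + 1) / (6 * real n)"
proof -
  have "(\<Sum>k<n. (real n - real k) ^ 3) = (\<Sum>k<n. (real (n - Suc k) + 1) ^ 3)"
    by (intro sum.cong) (auto simp: of_nat_diff)
  also have "\<dots> = (\<Sum>k<n. (real k + 1) ^ 3)"
    by (rule sum.nat_diff_reindex[of "\<lambda>k. (real k + 1) ^ 3"])
  finally have "(\<Sum>k<n. (real n - real k) ^ 3 + (real k + 1) ^ 3) = (real n)\<^sup>2 * (real n + 1)\<^sup>2 / 2"
    by (simp add: sum.distrib sum_cubes)
  then have "(\<Sum>k<n. ((real n - real k) ^ 3 + (real k + 1) ^ 3) / (3 * (real n + 1) * (real n) ^ 3))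
     = (real n)\<^sup>2 * (real n + 1)\<^sup>2 / 2 / (3 * (real n + 1) * (real n) ^ 3)"
    by (simp only: sum_divide_distrib[symmetric])
  also have "\<dots> = (real n + 1) / (6 * real n)"
    using assms by (simp add: divide_simps power2_eq_square power3_eq_cube)
  finally show ?thesis .
qed

lemma sum_mean_shift_sq:
  assumes "0 < n"
  shows "(\<Sum>k<n. (1 / 2 - (real k + 1 / 2) / real n)\<^sup>2) \<le> real n / 12"
proof -
  \<comment> \<open>The centre c is independent of the limit m for the sake of the induction; it is
    set to n/2 afterwards.\<close>
  have "(\<Sum>k<m. (real k + 1 / 2 - c)\<^sup>2) = real m * (4 * (real m)\<^sup>2 - 1) / 12 - c * (real m)\<^sup>2 + real m * c\<^sup>2" for c m
    by (induction m) (auto simp: field_simps power2_eq_square)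
  from this[of "real n / 2" n]
  have "(\<Sum>k<n. (real k + 1 / 2 - real n / 2)\<^sup>2) = real n * ((real n)\<^sup>2 - 1) / 12"
    by (simp add: power2_eq_square field_simps)
  moreover have "(1 / 2 - (real k + 1 / 2) / real n)\<^sup>2 = (real k + 1 / 2 - real n / 2)\<^sup>2 / (real n)\<^sup>2" for k
    using assms by (simp add: power_divide[symmetric] diff_divide_distrib power2_commute)
  ultimately have "(\<Sum>k<n. (1 / 2 - (real k + 1 / 2) / real n)\<^sup>2) = real n * ((real n)\<^sup>2 - 1) / 12 / (real n)\<^sup>2"
    by (simp only: sum_divide_distrib[symmetric])
  also have "\<dots> \<le> real n * (real n)\<^sup>2 / 12 / (real n)\<^sup>2"
    by (intro divide_right_mono mult_left_mono) auto
  finally show ?thesis using assms by simp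
qed

definition qs_cost :: "nat \<Rightarrow> (real \<times> real) measure \<Rightarrow> ennreal" where
  "qs_cost n Q = (\<integral>\<^sup>+\<omega>. ennreal ((qs_dev n \<omega>)\<^sup>2) \<partial>Q)"

lemma qs_cost_eq:
  assumes "quicksort_limit_law M" "qs_coupling M n Q"
  shows "qs_cost n Q = ennreal (\<integral>\<omega>. (qs_dev n \<omega>)\<^sup>2 \<partial>Q)"
  unfolding qs_cost_def using qs_coupling_dev(7)[OF assms] by (intro nn_integral_eq_integral) auto

text \<open>Given k and u, \<open>qs_dev_glue\<close> is a sum of two independent centred variables
  and a constant, so the squares add. Expanding the first two and integrating over the cell leaves r
  k times the bias as the only interaction, and Cauchy-Schwarz bounds the modulus of r k by sqrt (v
  e_k).\<close>

lemma qs_cost_join_le: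
  assumes M: "quicksort_limit_law M" and n: "0 < n"
    and Q: "\<And>k. prob_space (Q k)" "\<And>k. sets (Q k) = sets (borel \<Otimes>\<^sub>M borel)"
    and coup: "\<And>k. k < n \<Longrightarrow> qs_coupling M k (Q k)"
    and e: "\<And>k. k < n \<Longrightarrow> 0 \<le> e k" "\<And>k. k < n \<Longrightarrow> qs_cost k (Q k) \<le> ennreal (e k)"
  defines "v \<equiv> \<integral>y. y\<^sup>2 \<partial>M"
  shows "qs_cost n (qs_join n Q) \<le> ennreal (2 / real n * (\<Sum>k<n. e k)
    + 4 / real n * sqrt v * (\<Sum>k<n. \<bar>1 / 2 - (real k + 1 / 2) / real n\<bar> * sqrt (e k))
    + v * (real n + 1) / (3 * real n) + 112 / 27)"
proof -
  define N where "N = real n + 1"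
  define E where "E k = (\<integral>\<omega>. (qs_dev k \<omega>)\<^sup>2 \<partial>Q k)" for k
  define r where "r k = (\<integral>\<omega>. qs_dev k \<omega> * snd \<omega> \<partial>Q k)" for k
  define m where "m k = 1 / 2 - (real k + 1 / 2) / real n" for k
  define \<delta> where "\<delta> k u = real (Suc k) - N * u" for k u
  \<comment> \<open>The second moment of the glued deviation given the pivot index k and the value
    u.\<close>
  define G where "G k u = (E k + 2 * \<delta> k u * r k + (\<delta> k u)\<^sup>2 * v) + (E (n - Suc k) + 2 * (- \<delta> k u) * r (n - Suc k) + (- \<delta> k u)\<^sup>2 * v)
     + (N * (qs_toll n k - qs_C u))\<^sup>2" for k u
  define D2 where "D2 k = ((real n - real k) ^ 3 + (real k + 1) ^ 3) / (3 * (real n + 1) * (real n) ^ 3)" for k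
  define T where "T k = integral (qs_cell n k) (\<lambda>u. (N * (qs_toll n k - qs_C u))\<^sup>2)" for k
  define I where "I k = (E k + E (n - Suc k)) / real n + 2 * (r k - r (n - Suc k)) * (m k / real n) + 2 * v * D2 k + T k" for k
  have v: "0 \<le> v" by (simp add: v_def)
  have Ee: "0 \<le> E k" "E k \<le> e k" "\<bar>r k\<bar> \<le> sqrt v * sqrt (e k)" if k: "k < n" for k
  proof -
    show E0: "0 \<le> E k" by (simp add: E_def)
    show Ele: "E k \<le> e k" using e(2)[OF k] e(1)[OF k] unfolding qs_cost_eq[OF M coup[OF k]] E_def by simp
    have "\<bar>r k\<bar> \<le> sqrt (E k) * sqrt v" using qs_coupling_dev(9)[OF M coup[OF k]] by (simp add: r_def E_def v_def)
    also have "\<dots> \<le> sqrt (e k) * sqrt v" using Ele v by (intro mult_right_mono) auto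
    finally show "\<bar>r k\<bar> \<le> sqrt v * sqrt (e k)" by (simp add: mult.commute)
  qed
  have "qs_cost n (qs_join n Q) = (\<Sum>k<n. \<integral>\<^sup>+u. (\<integral>\<^sup>+\<omega>. \<integral>\<^sup>+\<omega>'. ennreal ((qs_dev n (qs_glue n (u, \<omega>, \<omega>')))\<^sup>2) \<partial>Q (n - Suc k) \<partial>Q k)
         * indicator (qs_cell n k) u \<partial>lborel)"
    unfolding qs_cost_def by (rule nn_integral_qs_join[OF n Q]) measurable
  also have "\<dots> = (\<Sum>k<n. ennreal (I k))"
  proof (intro sum.cong refl)
    fix k assume "k \<in> {..<n}"
    then have k: "k < n" "n - Suc k < n" by auto
    have inner: "(\<integral>\<^sup>+\<omega>. \<integral>\<^sup>+\<omega>'. ennreal ((qs_dev n (qs_glue n (u, \<omega>, \<omega>')))\<^sup>2) \<partial>Q (n - Suc k) \<partial>Q k) = ennreal (G k u)"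
      and G0: "0 \<le> G k u" for u
    proof -
      note S = qs_coupling_dev_shift[OF M coup[OF k(1)], of "\<delta> k u"] and S' = qs_coupling_dev_shift[OF M coup[OF k(2)], of "- \<delta> k u"]
      have G: "G k u = (\<integral>\<omega>. (qs_dev k \<omega> + \<delta> k u * snd \<omega>)\<^sup>2 \<partial>Q k)
         + (\<integral>\<omega>. (qs_dev (n - Suc k) \<omega> + - \<delta> k u * snd \<omega>)\<^sup>2 \<partial>Q (n - Suc k)) + (N * (qs_toll n k - qs_C u))\<^sup>2"
        unfolding S(4) S'(4) by (simp add: G_def E_def r_def v_def)
      then show "0 \<le> G k u" by (simp add: add_nonneg_nonneg)
      show "(\<integral>\<^sup>+\<omega>. \<integral>\<^sup>+\<omega>'. ennreal ((qs_dev n (qs_glue n (u, \<omega>, \<omega>')))\<^sup>2) \<partial>Q (n - Suc k) \<partial>Q k) = ennreal (G k u)"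
      proof -
        have eq: "qs_dev n (qs_glue n (u, \<omega>, \<omega>')) = (qs_dev k \<omega> + \<delta> k u * snd \<omega>)
           + (qs_dev (n - Suc k) \<omega>' + - \<delta> k u * snd \<omega>') + N * (qs_toll n k - qs_C u)" for \<omega> \<omega>'
          by (simp add: qs_dev_glue[OF k(1)] \<delta>_def N_def) (simp add: algebra_simps)
        show ?thesis unfolding eq G
          by (rule nn_integral_sum_centered_sq[OF Q(1) S(1,3,2) Q(1) S'(1,3,2)])
      qed
    qed
    have "(\<integral>\<^sup>+u. ennreal (G k u) * indicator (qs_cell n k) u \<partial>lborel) = ennreal (I k)"
    proof (rule nn_integral_qs_cell)
      show "G k \<in> borel_measurable borel" unfolding G_def[abs_def] \<delta>_def[abs_def] by measurable
      show "0 \<le> G k u" for u by (rule G0)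
      have c: "((\<lambda>u. E k + E (n - Suc k)) has_integral (E k + E (n - Suc k)) / real n) (qs_cell n k)"
        using has_integral_const_real[of "E k + E (n - Suc k)" "real k / real n" "real (Suc k) / real n"] n
        unfolding qs_cell_def by (simp add: divide_right_mono add_divide_distrib)
      have d: "(\<delta> k has_integral m k / real n) (qs_cell n k)" "((\<lambda>u. (\<delta> k u)\<^sup>2) has_integral D2 k) (qs_cell n k)"
        using qs_cell_shift_integrals[OF n, of k] by (simp_all add: \<delta>_def[abs_def] N_def m_def D2_def)
      have t: "((\<lambda>u. (N * (qs_toll n k - qs_C u))\<^sup>2) has_integral T k) (qs_cell n k)"
        unfolding T_def by (intro integrable_integral integrable_on_qs_cell continuous_intros continuous_on_qs_cell_qs_C k(1))
      have "((\<lambda>u. E k + E (n - Suc k) + 2 * (r k - r (n - Suc k)) * \<delta> k u + 2 * v * (\<delta> k u)\<^sup>2 + (N * (qs_toll n k - qs_C u))\<^sup>2) has_integral I k) (qs_cell n k)"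
        unfolding I_def by (intro has_integral_add has_integral_mult_right c d t)
      moreover have "G k = (\<lambda>u. E k + E (n - Suc k) + 2 * (r k - r (n - Suc k)) * \<delta> k u + 2 * v * (\<delta> k u)\<^sup>2 + (N * (qs_toll n k - qs_C u))\<^sup>2)"
        unfolding G_def by (rule ext) (simp add: algebra_simps)
      ultimately show "(G k has_integral I k) (qs_cell n k)" by simp
    qed
    then show "(\<integral>\<^sup>+u. (\<integral>\<^sup>+\<omega>. \<integral>\<^sup>+\<omega>'. ennreal ((qs_dev n (qs_glue n (u, \<omega>, \<omega>')))\<^sup>2) \<partial>Q (n - Suc k) \<partial>Q k)
         * indicator (qs_cell n k) u \<partial>lborel) = ennreal (I k)" unfolding inner .
  qed
  also have "\<dots> \<le> (\<Sum>k<n. ennreal ((e k + e (n - Suc k)) / real n + 2 / real n * sqrt v * (\<bar>m k\<bar> * sqrt (e k) + \<bar>m (n - Suc k)\<bar> * sqrt (e (n - Suc k))) + 2 * v * D2 k + T k))"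
  proof (intro sum_mono ennreal_leI)
    fix k assume "k \<in> {..<n}"
    then have k: "k < n" "n - Suc k < n" by auto
    \<comment> \<open>The bias is odd under the reflection of k to n-1-k, so its modulus serves both
      subproblems and the two sums coincide.\<close>
    have mk: "\<bar>m (n - Suc k)\<bar> = \<bar>m k\<bar>"
      using k n by (simp add: m_def of_nat_diff diff_divide_distrib add_divide_distrib)
    have "(r k - r (n - Suc k)) * m k \<le> \<bar>r k - r (n - Suc k)\<bar> * \<bar>m k\<bar>"
      unfolding abs_mult[symmetric] by (rule abs_ge_self)
    also have "\<dots> \<le> (sqrt v * sqrt (e k) + sqrt v * sqrt (e (n - Suc k))) * \<bar>m k\<bar>"
      using Ee(3)[OF k(1)] Ee(3)[OF k(2)] by (intro mult_right_mono) auto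
    finally have "2 / real n * ((r k - r (n - Suc k)) * m k) \<le> 2 / real n * ((sqrt v * sqrt (e k) + sqrt v * sqrt (e (n - Suc k))) * \<bar>m k\<bar>)"
      by (intro mult_left_mono) auto
    moreover have "(E k + E (n - Suc k)) / real n \<le> (e k + e (n - Suc k)) / real n"
      using Ee(2)[OF k(1)] Ee(2)[OF k(2)] by (intro divide_right_mono) auto
    ultimately show "I k \<le> (e k + e (n - Suc k)) / real n + 2 / real n * sqrt v * (\<bar>m k\<bar> * sqrt (e k) + \<bar>m (n - Suc k)\<bar> * sqrt (e (n - Suc k))) + 2 * v * D2 k + T k"
      unfolding mk I_def by (simp add: algebra_simps)
  qed
  also have "\<dots> = ennreal (\<Sum>k<n. (e k + e (n - Suc k)) / real n + 2 / real n * sqrt v * (\<bar>m k\<bar> * sqrt (e k) + \<bar>m (n - Suc k)\<bar> * sqrt (e (n - Suc k))) + 2 * v * D2 k + T k)"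
  proof (rule sum_ennreal)
    fix k assume "k \<in> {..<n}"
    then have k: "k < n" "n - Suc k < n" by auto
    have "0 \<le> D2 k" using k by (auto simp: D2_def intro!: divide_nonneg_nonneg add_nonneg_nonneg)
    moreover have "0 \<le> T k" unfolding T_def
      by (intro integral_nonneg integrable_on_qs_cell continuous_intros continuous_on_qs_cell_qs_C k) auto
    ultimately show "0 \<le> (e k + e (n - Suc k)) / real n + 2 / real n * sqrt v * (\<bar>m k\<bar> * sqrt (e k) + \<bar>m (n - Suc k)\<bar> * sqrt (e (n - Suc k))) + 2 * v * D2 k + T k"
      using e(1)[OF k(1)] e(1)[OF k(2)] v
      by (intro add_nonneg_nonneg mult_nonneg_nonneg divide_nonneg_nonneg) auto
  qed
  also have "(\<Sum>k<n. (e k + e (n - Suc k)) / real n + 2 / real n * sqrt v * (\<bar>m k\<bar> * sqrt (e k) + \<bar>m (n - Suc k)\<bar> * sqrt (e (n - Suc k))) + 2 * v * D2 k + T k)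
     = ((\<Sum>k<n. e k) + (\<Sum>k<n. e (n - Suc k))) / real n + 2 / real n * sqrt v * ((\<Sum>k<n. \<bar>m k\<bar> * sqrt (e k)) + (\<Sum>k<n. \<bar>m (n - Suc k)\<bar> * sqrt (e (n - Suc k))))
       + 2 * v * (\<Sum>k<n. D2 k) + (\<Sum>k<n. T k)"
    by (simp only: sum.distrib sum_distrib_left[symmetric] sum_divide_distrib[symmetric])
  also have "(\<Sum>k<n. e (n - Suc k)) = (\<Sum>k<n. e k)" by (rule sum.nat_diff_reindex)
  also have "(\<Sum>k<n. \<bar>m (n - Suc k)\<bar> * sqrt (e (n - Suc k))) = (\<Sum>k<n. \<bar>m k\<bar> * sqrt (e k))"
    by (rule sum.nat_diff_reindex[of "\<lambda>k. \<bar>m k\<bar> * sqrt (e k)"])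
  also have "(\<Sum>k<n. D2 k) = (real n + 1) / (6 * real n)" unfolding D2_def by (rule sum_shift_sq[OF n])
  finally have "qs_cost n (qs_join n Q) \<le> ennreal (((\<Sum>k<n. e k) + (\<Sum>k<n. e k)) / real n
     + 2 / real n * sqrt v * ((\<Sum>k<n. \<bar>m k\<bar> * sqrt (e k)) + (\<Sum>k<n. \<bar>m k\<bar> * sqrt (e k))) + 2 * v * ((real n + 1) / (6 * real n)) + (\<Sum>k<n. T k))" .
  also have "\<dots> \<le> ennreal (2 / real n * (\<Sum>k<n. e k) + 4 / real n * sqrt v * (\<Sum>k<n. \<bar>m k\<bar> * sqrt (e k)) + v * (real n + 1) / (3 * real n) + 112 / 27)"
  proof (rule ennreal_leI)
    have eqs: "(x + x) / real n = 2 / real n * x" "2 / real n * sqrt v * (x + x) = 4 / real n * sqrt v * x"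
      "2 * v * ((real n + 1) / (6 * real n)) = v * (real n + 1) / (3 * real n)" for x
      by simp_all
    have "(\<Sum>k<n. T k) \<le> 112 / 27" unfolding T_def N_def by (rule sum_integral_toll_diff_le[OF n])
    then show "((\<Sum>k<n. e k) + (\<Sum>k<n. e k)) / real n
     + 2 / real n * sqrt v * ((\<Sum>k<n. \<bar>m k\<bar> * sqrt (e k)) + (\<Sum>k<n. \<bar>m k\<bar> * sqrt (e k))) + 2 * v * ((real n + 1) / (6 * real n)) + (\<Sum>k<n. T k)
     \<le> 2 / real n * (\<Sum>k<n. e k) + 4 / real n * sqrt v * (\<Sum>k<n. \<bar>m k\<bar> * sqrt (e k)) + v * (real n + 1) / (3 * real n) + 112 / 27"
      unfolding eqs by simp
  qed
  finally show ?thesis by (simp add: m_def)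
qed

text \<open>Second moments in the fixed point equation give v = (2/3) v + E C(U)^2, as U^2 and
  (1-U)^2 both have mean 1/3. Hence v = 3 E C(U)^2 <= 15/27.\<close>

lemma limit_law_variance_le:
  assumes M: "quicksort_limit_law M"
  shows "(\<integral>y. y\<^sup>2 \<partial>M) \<le> 5 / 9"
proof -
  define v where "v = (\<integral>y. y\<^sup>2 \<partial>M)"
  note L = quicksort_limit_lawD[OF M]
  interpret M: prob_space M by (rule L(1))
  have v: "0 \<le> v" by (simp add: v_def)
  define G where "G u = u\<^sup>2 * v + (1 - u)\<^sup>2 * v + (qs_C u)\<^sup>2" for u
  have "ennreal v = (\<integral>\<^sup>+y. ennreal (y\<^sup>2) \<partial>M)"
    unfolding v_def using L(4) by (intro nn_integral_eq_integral[symmetric]) auto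
  also have "\<dots> = (\<integral>\<^sup>+u. (\<integral>\<^sup>+y. \<integral>\<^sup>+y'. ennreal ((u * y + (1 - u) * y' + qs_C u)\<^sup>2) \<partial>M \<partial>M) * indicator {0<..<1} u \<partial>lborel)"
    by (rule nn_integral_limit_law[OF M]) measurable
  also have "\<dots> = (\<integral>\<^sup>+u. ennreal (G u) * indicator {0<..<1} u \<partial>lborel)"
  proof -
    have "(\<integral>\<^sup>+y. \<integral>\<^sup>+y'. ennreal ((u * y + (1 - u) * y' + qs_C u)\<^sup>2) \<partial>M \<partial>M) = ennreal (G u)" for u
    proof -
      have "(\<integral>\<^sup>+y. \<integral>\<^sup>+y'. ennreal ((u * y + (1 - u) * y' + qs_C u)\<^sup>2) \<partial>M \<partial>M)
        = ennreal ((\<integral>y. (u * y)\<^sup>2 \<partial>M) + (\<integral>y. ((1 - u) * y)\<^sup>2 \<partial>M) + (qs_C u)\<^sup>2)"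
        using L(1,3,4,5) by (intro nn_integral_sum_centered_sq) (auto simp: power_mult_distrib)
      then show ?thesis by (simp add: power_mult_distrib G_def v_def)
    qed
    then show ?thesis by simp
  qed
  \<comment> \<open>The single cell for n = 1 is the closed unit interval, on which the integrals of
    C were computed.\<close>
  also have "\<dots> = (\<Sum>k<1. \<integral>\<^sup>+u. ennreal (G u) * indicator (qs_cell 1 k) u \<partial>lborel)"
    by (rule sum_nn_integral_qs_cell[symmetric]) (auto simp: G_def[abs_def])
  also have "\<dots> = (\<integral>\<^sup>+u. ennreal (G u) * indicator (qs_cell 1 0) u \<partial>lborel)" by simp
  also have "\<dots> = ennreal (1 / 3 * v + 1 / 3 * v + integral {0..1} (\<lambda>u. (qs_C u)\<^sup>2))"
  proof (rule nn_integral_qs_cell)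
    show "G \<in> borel_measurable borel" unfolding G_def[abs_def] by measurable
    show "0 \<le> G u" for u using v by (simp add: G_def)
    have "((\<lambda>u::real. u\<^sup>2) has_integral 1 ^ 3 / 3 - 0 ^ 3 / 3) {0..1}"
      by (rule has_integral_real_FTC[of 0 1 "\<lambda>u. u ^ 3 / 3" "\<lambda>u. u\<^sup>2"]) (auto intro!: derivative_eq_intros)
    then have 1: "((\<lambda>u::real. u\<^sup>2) has_integral 1 / 3) {0..1}" by simp
    have 2: "((\<lambda>u::real. (1 - u)\<^sup>2) has_integral 1 / 3) {0..1}"
      using has_integral_reflect_01[OF 1] by simp
    have 3: "((\<lambda>u. (qs_C u)\<^sup>2) has_integral integral {0..1} (\<lambda>u. (qs_C u)\<^sup>2)) {0..1}"
      by (intro integrable_integral integrable_continuous_real continuous_intros continuous_on_qs_C)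
    show "(G has_integral 1 / 3 * v + 1 / 3 * v + integral {0..1} (\<lambda>u. (qs_C u)\<^sup>2)) (qs_cell 1 0)"
      unfolding G_def[abs_def] qs_cell_def using has_integral_add[OF has_integral_add[OF has_integral_mult_left[OF 1, of v] has_integral_mult_left[OF 2, of v]] 3] by simp
  qed
  finally have "v = 1 / 3 * v + 1 / 3 * v + integral {0..1} (\<lambda>u. (qs_C u)\<^sup>2)"
    using v by (subst (asm) ennreal_inj) (auto intro!: add_nonneg_nonneg integral_nonneg integrable_continuous_real continuous_intros continuous_on_qs_C)
  then show ?thesis using integral_qs_C_sq_le by (simp add: v_def)
qed

section \<open>Solving the recursion for the L2 distance\<close>

text \<open>The kappa of the recursion: 4 sqrt (5/9) from the cross term times sqrt (1/12) from
  \<open>sum_mean_shift_sq\<close>.\<close>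

definition cross_const :: real where "cross_const = sqrt (20 / 27)"

text \<open>Multiples of n(n+1) solve the homogeneous recursion S_(n+1) = S_n + (2/n) S_n, so the
  factor 4 is free: large enough for the start at n = 2, small enough that 2 * 4 < 3^2. The other
  terms pay for kappa and for 122/27 = 112/27 + 10/27.\<close>

definition dev_mean_bound :: "nat \<Rightarrow> real" where
  "dev_mean_bound n = 4 - 4 * cross_const / sqrt (real n + 1) - 122 / 27 / (real n + 1)"

text \<open>An upper bound for $e_n$; the values at $0$ and $1$ are the exact ones up to $\mathbf{E} Y^2 \le 5/9$. Here \<^term>\<open>dev_mean_bound n\<close> bounds $S_n / (n (n+1))$ for $n \ge 2$ and is chosen such that the recursion telescopes.\<close>

definition dev_bound :: "nat \<Rightarrow> real" where
  "dev_bound n = (if n = 0 then 5 / 9 else if n = 1 then 20 / 9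
     else 8 * (real n + 1) - 6 * cross_const * sqrt (real n + 1) - 122 / 27)"

lemma cross_const_nonneg: "0 \<le> cross_const"
  by (simp add: cross_const_def)

text \<open>After multiplication by (n+1)(n+2) the last terms of the bound differ by exactly 122/27.
  The square root terms differ by 4 kappa a b (b - a), where b - a = 1/(a+b) >= 1/(2b).\<close>

lemma dev_mean_bound_step: "(real n + 1) * (real n + 2) * dev_mean_bound n + 2 * cross_const * sqrt (real n + 1) + 122 / 27
   \<le> (real n + 1) * (real n + 2) * dev_mean_bound (Suc n)"
proof -
  define a b where "a = sqrt (real n + 1)" and "b = sqrt (real n + 2)"
  have ab: "0 < a" "0 < b" "a\<^sup>2 = real n + 1" "b\<^sup>2 = real n + 2" "a \<le> b" by (auto simp: a_def b_def)
  have s: "dev_mean_bound n = 4 - 4 * cross_const / a - 122 / 27 / a\<^sup>2" "dev_mean_bound (Suc n) = 4 - 4 * cross_const / b - 122 / 27 / b\<^sup>2"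
    by (simp_all add: dev_mean_bound_def a_def b_def add.commute)
  have "a\<^sup>2 * b\<^sup>2 * (dev_mean_bound (Suc n) - dev_mean_bound n) = 4 * cross_const * (a * b * (b - a)) + 122 / 27 * (b\<^sup>2 - a\<^sup>2)"
    unfolding s using ab(1,2) by (simp add: field_simps power2_eq_square)
  also have "b\<^sup>2 - a\<^sup>2 = 1" using ab by simp
  finally have eq: "a\<^sup>2 * b\<^sup>2 * (dev_mean_bound (Suc n) - dev_mean_bound n) = 4 * cross_const * (a * b * (b - a)) + 122 / 27" by simp
  have "a * b * (b - a) \<ge> a / 2"
  proof -
    have "1 = (b - a) * (b + a)" using ab by (simp add: power2_eq_square algebra_simps)
    also have "\<dots> \<le> (b - a) * (2 * b)" using ab by (intro mult_left_mono) auto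
    finally have "a * 1 \<le> a * ((b - a) * (2 * b))" using ab by (intro mult_left_mono) auto
    then show ?thesis by (simp add: algebra_simps)
  qed
  then have "4 * cross_const * (a * b * (b - a)) \<ge> 4 * cross_const * (a / 2)"
    using cross_const_nonneg by (intro mult_left_mono) auto
  then have "2 * cross_const * a + 122 / 27 \<le> a\<^sup>2 * b\<^sup>2 * (dev_mean_bound (Suc n) - dev_mean_bound n)" unfolding eq by simp
  then show ?thesis unfolding a_def[symmetric] ab(3)[symmetric] ab(4)[symmetric]
    using ab(1) by (simp add: algebra_simps)
qed

lemma dev_mean_bound_le_4: "dev_mean_bound n \<le> 4"
proof -
  have "0 \<le> 4 * cross_const / sqrt (real n + 1)" "0 \<le> 122 / 27 / (real n + 1)"
    using cross_const_nonneg by simp_all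
  then show ?thesis unfolding dev_mean_bound_def by linarith
qed

lemma dev_bound_eq:
  assumes "2 \<le> n"
  shows "dev_bound n = 2 * (real n + 1) * dev_mean_bound n + 2 * cross_const * sqrt (real n + 1) + 122 / 27"
proof -
  define a where "a = sqrt (real n + 1)"
  have a: "0 < a" "real n + 1 = a\<^sup>2" by (auto simp: a_def)
  have "2 * a\<^sup>2 * (4 - 4 * cross_const / a - 122 / 27 / a\<^sup>2) = 8 * a\<^sup>2 - 8 * cross_const * a - 244 / 27"
    using a(1) by (simp add: field_simps power2_eq_square)
  then show ?thesis using assms a(1) unfolding dev_mean_bound_def dev_bound_def a_def[symmetric] unfolding a(2) by simp
qed

lemma sqrt5_le: "sqrt 5 \<le> 2237 / 1000"
  by (rule real_le_lsqrt) (auto simp: power2_eq_square)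

lemma kappa_sqrt3: "cross_const * sqrt 3 = 2 / 3 * sqrt 5"
proof -
  have "sqrt (20 / 27) * sqrt 3 = sqrt (20 / 9)" by (simp add: real_sqrt_mult[symmetric])
  also have "20 / 9 = (2 / 3)\<^sup>2 * (5::real)" by (simp add: power2_eq_square)
  finally show ?thesis by (simp add: cross_const_def real_sqrt_mult)
qed

lemma sum_dev_bound_le: "2 \<le> n \<Longrightarrow> (\<Sum>k<n. dev_bound k) \<le> real n * (real n + 1) * dev_mean_bound n"
proof (induction n rule: dec_induct)
  case base
  have k: "4 * cross_const / sqrt 3 = 8 / 9 * sqrt 5"
  proof -
    have "sqrt 3 * sqrt 3 = (3::real)" by simp
    then have "3 * cross_const = cross_const * sqrt 3 * sqrt 3" by (metis mult.assoc mult.commute)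
    also have "\<dots> = 2 / 3 * sqrt 5 * sqrt 3" by (simp only: kappa_sqrt3)
    finally have "4 * cross_const = 8 / 9 * sqrt 5 * sqrt 3" by linarith
    then show ?thesis by (subst nonzero_divide_eq_eq) auto
  qed
  \<comment> \<open>The starting value 5/9 + 20/9 meets about 3.04 on the right; this limits how
    small the factor 4 in \<open>dev_mean_bound\<close> could be.\<close>
  have "(\<Sum>k<2. dev_bound k) = 25 / 9" by (simp add: numeral_2_eq_2 dev_bound_def)
  also have "\<dots> \<le> 6 * (4 - 8 / 9 * sqrt 5 - 122 / 81)" using sqrt5_le by simp
  also have "\<dots> = real 2 * (real 2 + 1) * dev_mean_bound 2" using k by (simp add: dev_mean_bound_def)
  finally show ?case .
next
  case (step n)
  have "(\<Sum>k<Suc n. dev_bound k) \<le> real n * (real n + 1) * dev_mean_bound n + (2 * (real n + 1) * dev_mean_bound n + 2 * cross_const * sqrt (real n + 1) + 122 / 27)"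
    using step.IH dev_bound_eq[OF step.hyps(1)] by simp
  also have "\<dots> = (real n + 1) * (real n + 2) * dev_mean_bound n + 2 * cross_const * sqrt (real n + 1) + 122 / 27"
    by (simp add: algebra_simps)
  also have "\<dots> \<le> (real n + 1) * (real n + 2) * dev_mean_bound (Suc n)" by (rule dev_mean_bound_step)
  finally show ?case by (simp add: algebra_simps)
qed

text \<open>Under the square root the crude \<open>dev_mean_bound_le_4\<close> suffices; it produces
  the term 2 kappa sqrt (n+1) that \<open>dev_mean_bound_step\<close> absorbs.\<close>

lemma dev_bound_rec_le:
  assumes n: "2 \<le> n" and nonneg: "0 \<le> (\<Sum>k<n. dev_bound k)"
  shows "2 / real n * (\<Sum>k<n. dev_bound k) + cross_const * sqrt ((\<Sum>k<n. dev_bound k) / real n) + 122 / 27 \<le> dev_bound n"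
proof -
  define S where "S = (\<Sum>k<n. dev_bound k)"
  have S: "S / real n \<le> (real n + 1) * dev_mean_bound n"
    using sum_dev_bound_le[OF n] n by (simp add: S_def field_simps)
  also have "\<dots> \<le> (real n + 1) * 4" using dev_mean_bound_le_4 by (intro mult_left_mono) auto
  finally have "sqrt (S / real n) \<le> sqrt ((real n + 1) * 4)" by (rule real_sqrt_le_mono)
  then have "sqrt (S / real n) \<le> 2 * sqrt (real n + 1)" unfolding real_sqrt_mult by simp
  then have "cross_const * sqrt (S / real n) \<le> cross_const * (2 * sqrt (real n + 1))"
    using cross_const_nonneg by (rule mult_left_mono)
  moreover have "2 / real n * S = 2 * (S / real n)" by simp
  ultimately show ?thesis using S unfolding dev_bound_eq[OF n] S_def[symmetric] by linarith
qed

text \<open>The closed form has negative terms, but the recursive inequality exhibits each value as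
  an upper bound of a nonnegative quantity.\<close>

lemma dev_bound_nonneg: "0 \<le> dev_bound n"
proof (induction n rule: less_induct)
  case (less n)
  show ?case
  proof (cases "2 \<le> n")
    case True
    have S: "0 \<le> (\<Sum>k<n. dev_bound k)" using less by (intro sum_nonneg) auto
    then have "0 \<le> 2 / real n * (\<Sum>k<n. dev_bound k) + cross_const * sqrt ((\<Sum>k<n. dev_bound k) / real n) + 122 / 27"
      using cross_const_nonneg by (intro add_nonneg_nonneg mult_nonneg_nonneg) auto
    then show ?thesis using dev_bound_rec_le[OF True S] by linarith
  next
    case False
    then have "n = 0 \<or> n = 1" by linarith
    then show ?thesis by (auto simp: dev_bound_def)
  qed
qed

lemma dev_bound_le: "dev_bound n \<le> 8 * (real n + 1)"
proof -
  have "0 \<le> 6 * cross_const * sqrt (real n + 1)" using cross_const_nonneg by simp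
  then show ?thesis by (auto simp: dev_bound_def)
qed

text \<open>For n >= 2 and x = sqrt n the claim follows from \<open>dev_bound n\<close> <= (3x -
  sqrt 5 / 3)^2 = 9n - 2 sqrt 5 x + 5/9. As 8 < 9 a whole n is to spare, but for n = 2 the constant
  8 - 122/27 also calls for the surplus of 6 kappa over 2 sqrt 5.\<close>

lemma dev_bound_final:
  assumes "1 \<le> n"
  shows "sqrt (dev_bound n) + sqrt (5 / 9) \<le> 3 * sqrt (real n)"
proof (cases "n = 1")
  case True
  have "sqrt (20 / 9) = 2 * sqrt (5 / 9)" by (rule real_sqrt_unique) (auto simp: power_mult_distrib)
  moreover have "sqrt (5 / 9) \<le> sqrt (1::real)" by (rule real_sqrt_le_mono) simp
  ultimately show ?thesis using True by (simp add: dev_bound_def)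
next
  case False
  with assms have n: "2 \<le> n" by simp
  define x where "x = sqrt (real n)"
  have x: "x\<^sup>2 = real n" "1 \<le> x" using n by (auto simp: x_def)
  have s5: "sqrt (5 / 9) = sqrt 5 / 3" "(sqrt 5)\<^sup>2 = (5::real)" by (simp_all add: real_sqrt_divide)
  \<comment> \<open>The surplus 3/5 times sqrt (n+1) >= 17/10 gives the 51/50 below.\<close>
  have k: "6 * cross_const \<ge> 2 * sqrt 5 + 3 / 5"
  proof -
    have "(2 * sqrt 5 + 3 / 5)\<^sup>2 = 20 + 12 / 5 * sqrt 5 + (9 / 25 :: real)" by (simp add: power2_eq_square algebra_simps)
    also have "\<dots> \<le> 36 * (20 / 27)" using sqrt5_le by simp
    also have "\<dots> = (6 * cross_const)\<^sup>2" by (simp add: cross_const_def power_mult_distrib)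
    finally show ?thesis by (rule power2_le_imp_le) (simp add: cross_const_nonneg)
  qed
  have "(2 * sqrt 5 + 3 / 5) * sqrt (real n + 1) \<le> 6 * cross_const * sqrt (real n + 1)"
    using k by (intro mult_right_mono) auto
  moreover have "2 * sqrt 5 * x \<le> 2 * sqrt 5 * sqrt (real n + 1)" unfolding x_def by (intro mult_left_mono) auto
  moreover have "17 / 10 \<le> sqrt (real n + 1)" using n by (intro real_le_rsqrt) (auto simp: power2_eq_square)
  ultimately have "2 * sqrt 5 * x + 51 / 50 \<le> 6 * cross_const * sqrt (real n + 1)"
    unfolding distrib_right by linarith
  moreover have "2 \<le> real n" using n by simp
  ultimately have "dev_bound n \<le> 9 * real n - 2 * sqrt 5 * x + 5 / 9"
    using n by (simp add: dev_bound_def)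
  also have "\<dots> = (3 * x - sqrt 5 / 3)\<^sup>2"
    unfolding power2_diff power_mult_distrib power_divide x(1) s5(2) by simp
  finally have "sqrt (dev_bound n) \<le> sqrt ((3 * x - sqrt 5 / 3)\<^sup>2)" by (rule real_sqrt_le_mono)
  also have "\<dots> = 3 * x - sqrt 5 / 3" using x(2) sqrt5_le by simp
  finally show ?thesis by (simp add: s5 x_def)
qed

section \<open>A good coupling for every n\<close>

lemma quicksort_pmf_le_1: "n \<le> 1 \<Longrightarrow> quicksort_pmf n = return_pmf 0"
proof -
  have "{..<Suc 0} = {0}" by auto
  then have "quicksort_pmf (Suc 0) = return_pmf 0"
    by (simp add: quicksort_pmf_Suc pmf_of_set_singleton bind_return_pmf pair_return_pmf1)
  then show "n \<le> 1 \<Longrightarrow> quicksort_pmf n = return_pmf 0" by (cases n) auto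
qed

text \<open>With at most one key there is no comparison, so the count is constantly 0 and the
  deviation is -(n+1) Y.\<close>

lemma qs_coupling_le_1:
  assumes M: "quicksort_limit_law M" and n: "n \<le> 1"
  defines "Q \<equiv> distr M (borel \<Otimes>\<^sub>M borel) (\<lambda>y. (0 :: real, y))"
  shows "qs_coupling M n Q" "qs_cost n Q = ennreal ((real n + 1)\<^sup>2 * (\<integral>y. y\<^sup>2 \<partial>M))"
proof -
  note L = quicksort_limit_lawD[OF M]
  note [measurable_cong] = L(2)
  interpret M: prob_space M by (rule L(1))
  have [measurable]: "(\<lambda>y. (0 :: real, y)) \<in> M \<rightarrow>\<^sub>M borel \<Otimes>\<^sub>M borel" by measurable
  have "distr Q borel fst = distr M borel (\<lambda>y. 0)"
    unfolding Q_def by (subst distr_distr) (auto simp: comp_def)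
  also have "\<dots> = distr (measure_pmf (quicksort_pmf n)) borel real"
  proof (rule measure_eqI)
    fix A :: "real set" assume "A \<in> sets (distr M borel (\<lambda>y. 0))"
    then have [measurable]: "A \<in> sets borel" by simp
    show "emeasure (distr M borel (\<lambda>y. 0)) A = emeasure (distr (measure_pmf (quicksort_pmf n)) borel real) A"
      by (simp add: emeasure_distr quicksort_pmf_le_1[OF n] M.emeasure_space_1 vimage_def split: if_splits)
        (simp add: indicator_def)
  qed simp
  finally have 1: "distr Q borel fst = distr (measure_pmf (quicksort_pmf n)) borel real" .
  have "distr Q borel snd = distr M borel (\<lambda>y. y)"
    unfolding Q_def by (subst distr_distr) (auto simp: comp_def)
  also have "\<dots> = M" using L(2) by (intro distr_id2) auto
  finally show "qs_coupling M n Q"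
    using 1 by (auto simp: qs_coupling_def Q_def intro!: M.prob_space_distr)
  have mu: "qs_mean n = 0"
    using expectation_quicksort_pmf[of n] by (simp add: quicksort_pmf_le_1[OF n])
  have "qs_cost n Q = (\<integral>\<^sup>+y. ennreal ((real n + 1)\<^sup>2 * y\<^sup>2) \<partial>M)"
    unfolding qs_cost_def Q_def by (subst nn_integral_distr) (auto simp: qs_dev_def mu power_mult_distrib)
  also have "\<dots> = ennreal ((real n + 1)\<^sup>2 * (\<integral>y. y\<^sup>2 \<partial>M))"
    using L by (subst nn_integral_eq_integral) auto
  finally show "qs_cost n Q = ennreal ((real n + 1)\<^sup>2 * (\<integral>y. y\<^sup>2 \<partial>M))" .
qed

lemma qs_coupling_exists:
  assumes M: "quicksort_limit_law M"
  shows "\<exists>Q. qs_coupling M n Q \<and> qs_cost n Q \<le> ennreal (dev_bound n)"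
proof (induction n rule: less_induct)
  case (less n)
  define v where "v = (\<integral>y. y\<^sup>2 \<partial>M)"
  have v: "0 \<le> v" "v \<le> 5 / 9" using limit_law_variance_le[OF M] by (simp_all add: v_def)
  show ?case
  proof (cases "2 \<le> n")
    case False
    then have n: "n = 0 \<or> n = 1" by linarith
    then have "(real n + 1)\<^sup>2 * v \<le> dev_bound n" using v by (auto simp: dev_bound_def)
    then show ?thesis using qs_coupling_le_1[OF M, of n] n unfolding v_def by (metis ennreal_leI le_refl zero_le_one)
  next
    case True
    \<comment> \<open>\<open>qs_join\<close> takes a law at every index, so k >= n is filled with
      some probability law.\<close>
    have "\<forall>k. \<exists>Q. prob_space Q \<and> sets Q = sets (borel \<Otimes>\<^sub>M borel) \<and>
       (k < n \<longrightarrow> qs_coupling M k Q \<and> qs_cost k Q \<le> ennreal (dev_bound k))"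
      using less.IH qs_coupling_le_1(1)[OF M, of 0] unfolding qs_coupling_def by (metis le0)
    then obtain Q where Q: "\<And>k. prob_space (Q k)" "\<And>k. sets (Q k) = sets (borel \<Otimes>\<^sub>M borel)"
      "\<And>k. k < n \<Longrightarrow> qs_coupling M k (Q k)" "\<And>k. k < n \<Longrightarrow> qs_cost k (Q k) \<le> ennreal (dev_bound k)"
      by metis
    have n: "0 < n" using True by simp
    define S where "S = (\<Sum>k<n. dev_bound k)"
    have S: "0 \<le> S" by (simp add: S_def sum_nonneg dev_bound_nonneg)
    have "qs_cost n (qs_join n Q) \<le> ennreal (2 / real n * S
      + 4 / real n * sqrt v * (\<Sum>k<n. \<bar>1 / 2 - (real k + 1 / 2) / real n\<bar> * sqrt (dev_bound k))
      + v * (real n + 1) / (3 * real n) + 112 / 27)"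
      unfolding S_def v_def by (rule qs_cost_join_le[OF M n Q(1,2,3) dev_bound_nonneg Q(4)])
    also have "\<dots> \<le> ennreal (dev_bound n)"
    proof (rule ennreal_leI)
      \<comment> \<open>Cauchy-Schwarz over k separates the bias, whose mean square is at most 1/12,
        from the errors of the subproblems.\<close>
      have "(\<Sum>k<n. \<bar>1 / 2 - (real k + 1 / 2) / real n\<bar> * sqrt (dev_bound k))\<^sup>2
         \<le> (\<Sum>k<n. \<bar>1 / 2 - (real k + 1 / 2) / real n\<bar>\<^sup>2) * (\<Sum>k<n. (sqrt (dev_bound k))\<^sup>2)"
        by (rule Cauchy_Schwarz_ineq_sum)
      also have "\<dots> = (\<Sum>k<n. (1 / 2 - (real k + 1 / 2) / real n)\<^sup>2) * S"
        by (simp add: S_def dev_bound_nonneg)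
      also have "\<dots> \<le> real n / 12 * S"
        using sum_mean_shift_sq[OF n] S by (rule mult_right_mono)
      finally have "(\<Sum>k<n. \<bar>1 / 2 - (real k + 1 / 2) / real n\<bar> * sqrt (dev_bound k)) \<le> sqrt (real n / 12 * S)"
        by (intro real_le_rsqrt)
      moreover have "sqrt v \<le> sqrt (5 / 9)" using v by (intro real_sqrt_le_mono)
      ultimately have "4 / real n * sqrt v * (\<Sum>k<n. \<bar>1 / 2 - (real k + 1 / 2) / real n\<bar> * sqrt (dev_bound k))
        \<le> 4 / real n * sqrt (5 / 9) * sqrt (real n / 12 * S)"
        by (intro mult_mono mult_left_mono) (auto intro!: sum_nonneg simp: dev_bound_nonneg v)
      also have "\<dots> = sqrt ((4 / real n)\<^sup>2 * (5 / 9) * (real n / 12 * S))"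
        by (simp only: real_sqrt_mult real_sqrt_abs) simp
      also have "(4 / real n)\<^sup>2 * (5 / 9) * (real n / 12 * S) = 20 / 27 * (S / real n)"
        using n by (simp add: power2_eq_square)
      also have "sqrt (20 / 27 * (S / real n)) = cross_const * sqrt (S / real n)"
        by (simp only: real_sqrt_mult cross_const_def)
      finally have 1: "4 / real n * sqrt v * (\<Sum>k<n. \<bar>1 / 2 - (real k + 1 / 2) / real n\<bar> * sqrt (dev_bound k))
         \<le> cross_const * sqrt (S / real n)" .
      \<comment> \<open>Together with 112/27 the resulting 10/27 makes the constant 122/27 of
        \<open>dev_bound_rec_le\<close>.\<close>
      have "v * ((real n + 1) / (3 * real n)) \<le> 5 / 9 * (2 / 3)"
        using v n by (intro mult_mono) (auto simp: divide_simps)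
      then have 2: "v * (real n + 1) / (3 * real n) \<le> 10 / 27" by simp
      show "2 / real n * S + 4 / real n * sqrt v * (\<Sum>k<n. \<bar>1 / 2 - (real k + 1 / 2) / real n\<bar> * sqrt (dev_bound k))
        + v * (real n + 1) / (3 * real n) + 112 / 27 \<le> dev_bound n"
        using 1 2 dev_bound_rec_le[OF True] S unfolding S_def by linarith
    qed
    finally show ?thesis using qs_coupling_join[OF M n Q(1,2,3)] by blast
  qed
qed

section \<open>The error estimate\<close>

text \<open>Division by e^a + 1 turns this into tanh (a/2) <= a/2; equivalently, the trapezoidal
  rule overestimates the integral of the convex exp over [0, a].\<close>

lemma half_tanh_le:
  fixes a :: real
  assumes "0 \<le> a"
  shows "exp a - 1 \<le> a * (exp a + 1) / 2"
proof -
  define \<phi> where "\<phi> x = x * (exp x + 1) / 2 - (exp x - 1)" for x :: real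
  have "\<phi> 0 \<le> \<phi> a"
  proof (rule DERIV_nonneg_imp_nondecreasing[OF assms])
    fix x assume x: "0 \<le> x" "x \<le> a"
    have "(\<phi> has_real_derivative (exp x + 1 + x * exp x) / 2 - exp x) (at x)"
      unfolding \<phi>_def by (auto intro!: derivative_eq_intros simp: field_simps)
    moreover have "0 \<le> (exp x + 1 + x * exp x) / 2 - exp x"
    proof -
      have "exp x * (1 - x) \<le> exp x * exp (- x)"
        using exp_ge_add_one_self[of "- x"] by (intro mult_left_mono) auto
      then show ?thesis by (simp add: exp_add[symmetric] algebra_simps)
    qed
    ultimately show "\<exists>y. (\<phi> has_real_derivative y) (at x) \<and> 0 \<le> y" by blast
  qed
  then show ?thesis by (simp add: \<phi>_def)
qed

lemma abs_half_tanh_le: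
  fixes a :: real
  shows "\<bar>exp a - 1\<bar> \<le> \<bar>a\<bar> * (exp a + 1) / 2"
proof (cases "0 \<le> a")
  case True
  then show ?thesis using half_tanh_le[of a] by simp
next
  case False
  have "exp (- a) - 1 \<le> - a * (exp (- a) + 1) / 2" using False by (intro half_tanh_le) auto
  then have "exp a * (exp (- a) - 1) \<le> exp a * (- a * (exp (- a) + 1) / 2)" by (intro mult_left_mono) auto
  moreover have "exp a * exp (- a) = 1" by (simp add: exp_add[symmetric])
  moreover have "exp a < 1" using False by simp
  ultimately show ?thesis using False by (simp add: algebra_simps)
qed

text \<open>Up to the factor e^w, with z - w = a + ib, the squared modulus is (e^a - 1)^2 + 2 e^a (1
  - cos b). The first part is the tanh estimate; the second uses 1 - cos b <= b^2/2 and e^a <= (e^a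
  + 1)^2 / 4. Having the average of the two exponentials instead of their sum is what makes the
  final constant 3 and not 6.\<close>

lemma cmod_exp_diff_le:
  "cmod (exp z - exp w) \<le> cmod (z - w) * ((exp (Re z) + exp (Re w)) / 2)"
proof -
  define a b where "a = Re (z - w)" and "b = Im (z - w)"
  have "cmod (exp (z - w) - 1) \<le> cmod (z - w) * ((exp a + 1) / 2)"
  proof (rule power2_le_imp_le)
    have "(cmod (exp (z - w) - 1))\<^sup>2 = (exp a * cos b - 1)\<^sup>2 + (exp a * sin b)\<^sup>2"
      by (simp add: cmod_power2 Re_exp Im_exp a_def b_def)
    also have "\<dots> = (exp a)\<^sup>2 * ((cos b)\<^sup>2 + (sin b)\<^sup>2) - 2 * exp a * cos b + 1"
      by algebra
    also have "\<dots> = (exp a - 1)\<^sup>2 + 2 * exp a * (1 - cos b)"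
    proof -
      have "(cos b)\<^sup>2 + (sin b)\<^sup>2 = 1" by simp
      then show ?thesis by (simp only:) (simp add: power2_eq_square algebra_simps)
    qed
    also have "\<dots> \<le> (\<bar>a\<bar> * (exp a + 1) / 2)\<^sup>2 + (exp a + 1)\<^sup>2 / 4 * b\<^sup>2"
    proof (rule add_mono)
      have "\<bar>exp a - 1\<bar>\<^sup>2 \<le> (\<bar>a\<bar> * (exp a + 1) / 2)\<^sup>2"
        by (rule power_mono[OF abs_half_tanh_le]) simp
      then show "(exp a - 1)\<^sup>2 \<le> (\<bar>a\<bar> * (exp a + 1) / 2)\<^sup>2" by simp
      have "1 - cos b = 2 * (sin (b / 2))\<^sup>2" using cos_double_sin[of "b / 2"] by simp
      also have "\<dots> \<le> 2 * (b / 2)\<^sup>2"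
        using abs_sin_x_le_abs_x[of "b / 2"] unfolding abs_le_square_iff by (rule mult_left_mono) simp
      finally have 1: "1 - cos b \<le> b\<^sup>2 / 2" by (simp add: power_divide)
      have "0 \<le> (exp a - 1)\<^sup>2" by simp
      then have 2: "exp a \<le> (exp a + 1)\<^sup>2 / 4" by (simp add: power2_eq_square algebra_simps)
      have "2 * exp a * (1 - cos b) \<le> 2 * exp a * (b\<^sup>2 / 2)" using 1 by (intro mult_left_mono) auto
      also have "\<dots> = exp a * b\<^sup>2" by simp
      also have "\<dots> \<le> (exp a + 1)\<^sup>2 / 4 * b\<^sup>2" using 2 by (intro mult_right_mono) auto
      finally show "2 * exp a * (1 - cos b) \<le> (exp a + 1)\<^sup>2 / 4 * b\<^sup>2" .
    qed
    also have "\<dots> = (a\<^sup>2 + b\<^sup>2) * ((exp a + 1) / 2)\<^sup>2"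
      unfolding power_divide power_mult_distrib power2_abs by (simp add: field_simps)
    also have "\<dots> = (cmod (z - w) * ((exp a + 1) / 2))\<^sup>2"
      by (simp only: power_mult_distrib cmod_power2 a_def b_def)
    finally show "(cmod (exp (z - w) - 1))\<^sup>2 \<le> (cmod (z - w) * ((exp a + 1) / 2))\<^sup>2" .
  qed simp
  then have "cmod (exp w) * cmod (exp (z - w) - 1) \<le> cmod (exp w) * (cmod (z - w) * ((exp a + 1) / 2))"
    by (intro mult_left_mono) auto
  moreover have "cmod (exp z - exp w) = cmod (exp w) * cmod (exp (z - w) - 1)"
    unfolding norm_mult[symmetric] by (simp add: exp_diff algebra_simps)
  moreover have "exp (Re z) = exp (Re w) * exp a" by (simp add: a_def exp_add[symmetric])
  ultimately show ?thesis by (simp add: algebra_simps)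
qed

lemma abs_exp_diff_le:
  fixes p q :: real
  assumes "p \<le> c" "q \<le> c"
  shows "\<bar>exp p - exp q\<bar> \<le> exp c * \<bar>p - q\<bar>"
proof -
  have *: "exp p - exp q \<le> exp c * \<bar>p - q\<bar>" if "p \<le> c" for p q :: real
  proof (cases "q \<le> p")
    case True
    have "exp p - exp q = exp p * (1 - exp (q - p))" by (simp add: exp_diff algebra_simps)
    also have "\<dots> \<le> exp p * (p - q)"
    proof (rule mult_left_mono)
      show "1 - exp (q - p) \<le> p - q" using exp_ge_add_one_self[of "q - p"] by linarith
    qed simp
    also have "\<dots> \<le> exp c * (p - q)" using that True by (intro mult_right_mono) auto
    finally show ?thesis using True by simp
  next
    case False
    then have "exp p - exp q \<le> 0" by simp
    also have "0 \<le> exp c * \<bar>p - q\<bar>" by simp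
    finally show ?thesis .
  qed
  from *[OF assms(1), of q] *[OF assms(2), of p] show ?thesis by (simp add: abs_minus_commute abs_le_iff)
qed

section \<open>The moment generating function of the limit law\<close>

lemma qs_coupling_dev_sq_le:
  assumes M: "quicksort_limit_law M" and Q: "qs_coupling M n Q" "qs_cost n Q \<le> ennreal e" and e: "0 \<le> e"
  shows "(\<integral>\<omega>. (qs_dev n \<omega>)\<^sup>2 \<partial>Q) \<le> e"
  using Q(2) e unfolding qs_cost_eq[OF M Q(1)] by simp

text \<open>Only a finite variance is assumed of $Y$. The truncated exponential is Lipschitz, so the coupling bounds its expectation by those for $Z_n$.\<close>

lemma limit_law_truncated_mgf_le:
  assumes M: "quicksort_limit_law M"
  shows "(\<integral>y. exp (min (s * y) c) \<partial>M) \<le> exp (log_mgf_bound s)"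
proof -
  define f where "f y = exp (min (s * y) c)" for y :: real
  have f_meas: "f \<in> borel_measurable borel" unfolding f_def[abs_def] by measurable
  have f_bound: "\<bar>f y\<bar> \<le> exp c" for y by (simp add: f_def)
  have f_lip: "\<bar>f x - f y\<bar> \<le> exp c * (\<bar>s\<bar> * \<bar>x - y\<bar>)" for x y
  proof -
    have "\<bar>f x - f y\<bar> \<le> exp c * \<bar>min (s * x) c - min (s * y) c\<bar>"
      unfolding f_def by (rule abs_exp_diff_le) auto
    also have "\<dots> \<le> exp c * \<bar>s * x - s * y\<bar>" by (intro mult_left_mono) auto
    also have "\<bar>s * x - s * y\<bar> = \<bar>s\<bar> * \<bar>x - y\<bar>" by (simp add: right_diff_distrib[symmetric] abs_mult)
    finally show ?thesis .
  qed
  have "(\<integral>y. f y \<partial>M) \<le> exp (log_mgf_bound s) + exp c * \<bar>s\<bar> * sqrt 8 / sqrt (real n + 1)" for n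
  proof -
    obtain Q where Q: "qs_coupling M n Q" "qs_cost n Q \<le> ennreal (dev_bound n)"
      using qs_coupling_exists[OF M] by blast
    note [measurable_cong] = qs_couplingD(2)[OF Q(1)]
    interpret Q: prob_space Q by (rule qs_couplingD(1)[OF Q(1)])
    note D = qs_coupling_dev[OF M Q(1)]
    define Z where "Z \<omega> = (fst \<omega> - qs_mean n) / (real n + 1)" for \<omega> :: "real \<times> real"
    have [measurable]: "f \<in> borel_measurable borel" by (rule f_meas)
    have Zs: "Z \<omega> - snd \<omega> = qs_dev n \<omega> / (real n + 1)" for \<omega>
      by (simp add: Z_def qs_dev_def field_simps)
    have int_f: "integrable Q (\<lambda>\<omega>. f (snd \<omega>))"
      by (rule Q.integrable_const_bound[where B = "exp c"]) (use f_bound in auto)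
    have int_d: "integrable Q (\<lambda>\<omega>. \<bar>qs_dev n \<omega>\<bar>)" using D(5) by simp
    have Zm: "(\<lambda>x. exp (s * ((x - qs_mean n) / (real n + 1)))) \<in> borel_measurable borel" by measurable
    have int_Z: "integrable Q (\<lambda>\<omega>. exp (s * Z \<omega>))" "(\<integral>\<omega>. exp (s * Z \<omega>) \<partial>Q) = centered_mgf n s"
      using integral_qs_coupling_fst[OF Q(1) Zm] by (simp_all add: Z_def centered_mgf_def add.commute)
    have "(\<integral>y. f y \<partial>M) = (\<integral>\<omega>. f (snd \<omega>) \<partial>Q)"
      by (rule integral_qs_coupling_snd(2)[OF Q(1) f_meas, symmetric])
    also have "\<dots> \<le> (\<integral>\<omega>. exp (s * Z \<omega>) + exp c * \<bar>s\<bar> / (real n + 1) * \<bar>qs_dev n \<omega>\<bar> \<partial>Q)"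
    proof (rule integral_mono)
      fix \<omega> assume "\<omega> \<in> space Q"
      \<comment> \<open>The cap stays in place for the Lipschitz step and is dropped for Z alone,
        whose exponential moments are already bounded.\<close>
      have "f (snd \<omega>) \<le> f (Z \<omega>) + exp c * (\<bar>s\<bar> * \<bar>Z \<omega> - snd \<omega>\<bar>)"
        using f_lip[of "Z \<omega>" "snd \<omega>"] by linarith
      also have "f (Z \<omega>) \<le> exp (s * Z \<omega>)" by (simp add: f_def)
      finally show "f (snd \<omega>) \<le> exp (s * Z \<omega>) + exp c * \<bar>s\<bar> / (real n + 1) * \<bar>qs_dev n \<omega>\<bar>"
        unfolding Zs by simp
    qed (use int_f int_Z int_d in simp_all)
    also have "\<dots> = centered_mgf n s + exp c * \<bar>s\<bar> / (real n + 1) * (\<integral>\<omega>. \<bar>qs_dev n \<omega>\<bar> \<partial>Q)"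
      using int_Z int_d by simp
    also have "\<dots> \<le> exp (log_mgf_bound s) + exp c * \<bar>s\<bar> / (real n + 1) * sqrt (8 * (real n + 1))"
    proof (intro add_mono mult_left_mono centered_mgf_le)
      have "(\<integral>\<omega>. \<bar>qs_dev n \<omega>\<bar> \<partial>Q) \<le> sqrt (\<integral>\<omega>. (qs_dev n \<omega>)\<^sup>2 \<partial>Q)"
        using integral_mult_sq_le(2)[of "\<lambda>\<omega>. \<bar>qs_dev n \<omega>\<bar>" Q "\<lambda>_. 1"] D(7) by (simp add: Q.prob_space)
      also have "\<dots> \<le> sqrt (8 * (real n + 1))"
        using qs_coupling_dev_sq_le[OF M Q dev_bound_nonneg] dev_bound_le[of n] by (intro real_sqrt_le_mono) linarith
      finally show "(\<integral>\<omega>. \<bar>qs_dev n \<omega>\<bar> \<partial>Q) \<le> sqrt (8 * (real n + 1))" .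
    qed simp
    also have "exp c * \<bar>s\<bar> / (real n + 1) * sqrt (8 * (real n + 1)) = exp c * \<bar>s\<bar> * sqrt 8 / sqrt (real n + 1)"
    proof -
      have "sqrt (real n + 1) / (real n + 1) = 1 / sqrt (real n + 1)" by (simp add: sqrt_divide_self_eq inverse_eq_divide)
      moreover have "exp c * \<bar>s\<bar> / (real n + 1) * sqrt (8 * (real n + 1))
         = exp c * \<bar>s\<bar> * sqrt 8 * (sqrt (real n + 1) / (real n + 1))"
        unfolding real_sqrt_mult by simp
      ultimately show ?thesis by simp
    qed
    finally show ?thesis .
  qed
  then have ub: "\<forall>n. (\<integral>y. f y \<partial>M) \<le> exp (log_mgf_bound s) + exp c * \<bar>s\<bar> * sqrt 8 / sqrt (real n + 1)" by blast
  have "(\<lambda>n. exp (log_mgf_bound s) + exp c * \<bar>s\<bar> * sqrt 8 / sqrt (real n + 1)) \<longlonglongrightarrow> exp (log_mgf_bound s)" by real_asymp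
  then have "(\<integral>y. f y \<partial>M) \<le> exp (log_mgf_bound s)"
    by (rule LIMSEQ_le_const) (use ub in blast)
  then show ?thesis by (simp add: f_def)
qed

text \<open>The truncated bound does not depend on the cap, so monotone convergence along the caps
  0, 1, 2, ... removes it; finiteness of the nonnegative integral then gives integrability.\<close>

lemma limit_law_mgf:
  assumes M: "quicksort_limit_law M"
  shows "integrable M (\<lambda>y. exp (s * y))" "(\<integral>y. exp (s * y) \<partial>M) \<le> exp (log_mgf_bound s)"
proof -
  note [measurable_cong] = quicksort_limit_lawD(2)[OF M]
  interpret M: prob_space M by (rule quicksort_limit_lawD(1)[OF M])
  define f where "f j y = ennreal (exp (min (s * y) (real j)))" for j y
  have "(\<integral>\<^sup>+y. ennreal (exp (s * y)) \<partial>M) \<le> (\<integral>\<^sup>+y. (SUP j. f j y) \<partial>M)"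
  proof (rule nn_integral_mono)
    fix y
    obtain j where "s * y \<le> real j" using real_arch_simple by blast
    then have "ennreal (exp (s * y)) = f j y" by (simp add: f_def)
    also have "\<dots> \<le> (SUP j. f j y)" by (rule SUP_upper) simp
    finally show "ennreal (exp (s * y)) \<le> (SUP j. f j y)" .
  qed
  also have "\<dots> = (SUP j. \<integral>\<^sup>+y. f j y \<partial>M)"
  proof (rule nn_integral_monotone_convergence_SUP)
    show "incseq f" by (auto simp: incseq_def le_fun_def f_def intro!: ennreal_leI)
    show "f j \<in> borel_measurable M" for j unfolding f_def[abs_def] by measurable
  qed
  also have "\<dots> \<le> ennreal (exp (log_mgf_bound s))"
  proof (rule SUP_least)
    fix j
    have int: "integrable M (\<lambda>y. exp (min (s * y) (real j)))"
      by (rule M.integrable_const_bound[where B = "exp (real j)"]) auto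
    have "(\<integral>\<^sup>+y. f j y \<partial>M) = ennreal (\<integral>y. exp (min (s * y) (real j)) \<partial>M)"
      unfolding f_def by (rule nn_integral_eq_integral[OF int]) auto
    also have "\<dots> \<le> ennreal (exp (log_mgf_bound s))" by (intro ennreal_leI limit_law_truncated_mgf_le[OF M])
    finally show "(\<integral>\<^sup>+y. f j y \<partial>M) \<le> ennreal (exp (log_mgf_bound s))" .
  qed
  finally have le: "(\<integral>\<^sup>+y. ennreal (exp (s * y)) \<partial>M) \<le> ennreal (exp (log_mgf_bound s))" .
  show int: "integrable M (\<lambda>y. exp (s * y))"
  proof (rule integrableI_nonneg)
    show "(\<integral>\<^sup>+y. ennreal (exp (s * y)) \<partial>M) < \<infinity>" using le by (rule le_less_trans) simp
  qed auto
  show "(\<integral>y. exp (s * y) \<partial>M) \<le> exp (log_mgf_bound s)"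
    using le by (subst (asm) nn_integral_eq_integral[OF int]) auto
qed

lemma log_mgf_bound_le: "log_mgf_bound x \<le> max (12 * x\<^sup>2) (2 * exp x)"
  by (simp add: log_mgf_bound_def)

theorem theorem7p5:
  fixes M :: "real measure" and l :: complex and n :: nat
  assumes "quicksort_limit_law M"
    and "n \<ge> 1"
  shows "cmod (qs_mgf n l - (\<integral>y. exp (l * complex_of_real y) \<partial>M))
    \<le> 3 * cmod l
       * exp (max (24 * ((real n + 1) / real n)\<^sup>2 * (Re l)\<^sup>2)
                  (exp (2 * ((real n + 1) / real n) * Re l)))
       * real n powr (-1/2)"
proof -
  note M = assms(1)
  define \<rho> where "\<rho> = (real n + 1) / real n"
  \<comment> \<open>Since Y_n = \<rho> Z_n and Cauchy-Schwarz squares the exponential of Re l * Y_n,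
    this is the argument at which \<open>centered_mgf\<close> is needed.\<close>
  define t where "t = 2 * \<rho> * Re l"
  define W where "W = max (24 * \<rho>\<^sup>2 * (Re l)\<^sup>2) (exp (2 * \<rho> * Re l))"
  have n: "0 < real n" "1 \<le> \<rho>" using assms(2) by (auto simp: \<rho>_def)
  \<comment> \<open>W is half of the exponent bound at t because square roots of second moments are
    taken.\<close>
  have W: "max (12 * t\<^sup>2) (2 * exp t) = 2 * W"
    by (simp add: W_def t_def power_mult_distrib max_def)
  have b1: "log_mgf_bound t \<le> 2 * W" using log_mgf_bound_le[of t] W by simp
  have b2: "log_mgf_bound (2 * Re l) \<le> 2 * W"
  proof -
    have "(Re l)\<^sup>2 * 1 \<le> (Re l)\<^sup>2 * \<rho>\<^sup>2" using n by (intro mult_left_mono) (auto simp: one_le_power)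
    then have quad: "12 * (2 * Re l)\<^sup>2 \<le> 12 * t\<^sup>2" by (simp add: t_def power_mult_distrib algebra_simps)
    show ?thesis
    \<comment> \<open>For Re l < 0 passing from 2 Re l to t decreases the exponential term, but then
      2 Re l lies in the quadratic branch.\<close>
    proof (cases "0 \<le> Re l")
      case True
      then have "2 * Re l \<le> t" using mult_right_mono[OF n(2) True] by (simp add: t_def)
      then have "2 * exp (2 * Re l) \<le> 2 * exp t" by simp
      then show ?thesis using quad log_mgf_bound_le[of "2 * Re l"] unfolding W[symmetric] by linarith
    next
      case False
      then show ?thesis using quad unfolding W[symmetric] by (simp add: log_mgf_bound_def)
    qed
  qed
  obtain Q where Q: "qs_coupling M n Q" "qs_cost n Q \<le> ennreal (dev_bound n)"
    using qs_coupling_exists[OF M] by blast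
  note [measurable_cong] = qs_couplingD(2)[OF Q(1)]
  interpret Q: prob_space Q by (rule qs_couplingD(1)[OF Q(1)])
  define Y where "Y \<omega> = (fst \<omega> - qs_mean n) / real n" for \<omega> :: "real \<times> real"
  define d where "d \<omega> = Y \<omega> - snd \<omega>" for \<omega>
  have [measurable]: "Y \<in> borel_measurable (borel \<Otimes>\<^sub>M borel)" "d \<in> borel_measurable (borel \<Otimes>\<^sub>M borel)"
    unfolding Y_def[abs_def] d_def[abs_def] by measurable
  have expY: "(\<lambda>x. exp (l * complex_of_real ((x - qs_mean n) / real n))) \<in> borel_measurable borel" by measurable
  have int_Y: "integrable Q (\<lambda>\<omega>. exp (l * complex_of_real (Y \<omega>)))" "(\<integral>\<omega>. exp (l * complex_of_real (Y \<omega>)) \<partial>Q) = qs_mgf n l"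
    using integral_qs_coupling_fst[OF Q(1) expY] by (simp_all add: Y_def qs_mgf_def)
  have expy: "(\<lambda>y. exp (l * complex_of_real y)) \<in> borel_measurable borel" by measurable
  have int_M: "integrable M (\<lambda>y. exp (l * complex_of_real y))"
  proof (rule Bochner_Integration.integrable_bound[OF limit_law_mgf(1)[OF M, of "Re l"]])
    show "(\<lambda>y. exp (l * complex_of_real y)) \<in> borel_measurable M"
      using expy by (simp only: measurable_cong_sets[OF quicksort_limit_lawD(2)[OF M] refl])
  qed simp
  have int_y: "integrable Q (\<lambda>\<omega>. exp (l * complex_of_real (snd \<omega>)))"
    "(\<integral>\<omega>. exp (l * complex_of_real (snd \<omega>)) \<partial>Q) = (\<integral>y. exp (l * complex_of_real y) \<partial>M)"
    using integral_qs_coupling_snd[OF Q(1) expy] int_M by simp_all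
  \<comment> \<open>Here n (Y_n - Y) is the deviation plus one further Y; Minkowski's inequality for
    these two is written out through the cross term.\<close>
  have d2: "integrable Q (\<lambda>\<omega>. (d \<omega>)\<^sup>2)" "sqrt (\<integral>\<omega>. (d \<omega>)\<^sup>2 \<partial>Q) \<le> 3 / sqrt (real n)"
  proof -
    note S = qs_coupling_dev_shift[OF M Q(1), of 1]
    have eq: "(d \<omega>)\<^sup>2 = (qs_dev n \<omega> + 1 * snd \<omega>)\<^sup>2 / (real n)\<^sup>2" for \<omega>
    proof -
      have "d \<omega> = (qs_dev n \<omega> + 1 * snd \<omega>) / real n"
        using n by (simp add: d_def Y_def qs_dev_def field_simps)
      then show ?thesis by (simp add: power_divide)
    qed
    show "integrable Q (\<lambda>\<omega>. (d \<omega>)\<^sup>2)" unfolding eq using S(3) by simp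
    define E v where "E = (\<integral>\<omega>. (qs_dev n \<omega>)\<^sup>2 \<partial>Q)" and "v = (\<integral>y. y\<^sup>2 \<partial>M)"
    have E: "0 \<le> E" "E \<le> dev_bound n" "0 \<le> v" "v \<le> 5 / 9"
      using qs_coupling_dev_sq_le[OF M Q dev_bound_nonneg] limit_law_variance_le[OF M] by (auto simp: E_def v_def)
    have "(\<integral>\<omega>. (qs_dev n \<omega> + 1 * snd \<omega>)\<^sup>2 \<partial>Q) = E + 2 * (\<integral>\<omega>. qs_dev n \<omega> * snd \<omega> \<partial>Q) + v"
      unfolding S(4) by (simp add: E_def v_def)
    also have "\<dots> \<le> E + 2 * (sqrt E * sqrt v) + v"
      using qs_coupling_dev(9)[OF M Q(1)] by (simp add: E_def v_def)
    also have "\<dots> = (sqrt E + sqrt v)\<^sup>2"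
      unfolding power2_sum using E by simp
    also have "\<dots> \<le> (3 * sqrt (real n))\<^sup>2"
    proof (rule power_mono)
      have "sqrt E + sqrt v \<le> sqrt (dev_bound n) + sqrt (5 / 9)" using E by (intro add_mono real_sqrt_le_mono)
      also have "\<dots> \<le> 3 * sqrt (real n)" by (rule dev_bound_final[OF assms(2)])
      finally show "sqrt E + sqrt v \<le> 3 * sqrt (real n)" .
    qed (use E in simp)
    also have "\<dots> = 9 * real n" by (simp add: power_mult_distrib)
    finally have "(\<integral>\<omega>. (d \<omega>)\<^sup>2 \<partial>Q) \<le> 9 * real n / (real n)\<^sup>2"
      unfolding eq by (simp add: divide_right_mono)
    also have "\<dots> = 9 / real n" using n by (simp add: power2_eq_square)
    finally have "sqrt (\<integral>\<omega>. (d \<omega>)\<^sup>2 \<partial>Q) \<le> sqrt (9 / real n)" by (rule real_sqrt_le_mono)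
    also have "\<dots> = 3 / sqrt (real n)" by (simp add: real_sqrt_divide)
    finally show "sqrt (\<integral>\<omega>. (d \<omega>)\<^sup>2 \<partial>Q) \<le> 3 / sqrt (real n)" .
  qed
  have Y2: "integrable Q (\<lambda>\<omega>. (exp (Re l * Y \<omega>))\<^sup>2)" "sqrt (\<integral>\<omega>. (exp (Re l * Y \<omega>))\<^sup>2 \<partial>Q) \<le> exp W"
  proof -
    have eq: "(exp (Re l * Y \<omega>))\<^sup>2 = exp (t * ((fst \<omega> - qs_mean n) / real (Suc n)))" for \<omega>
    proof -
      have "2 * (Re l * Y \<omega>) = t * ((fst \<omega> - qs_mean n) / real (Suc n))"
        using n by (simp add: Y_def t_def \<rho>_def divide_simps)
      then show ?thesis by (simp only: exp_double[symmetric])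
    qed
    have Zm: "(\<lambda>x. exp (t * ((x - qs_mean n) / real (Suc n)))) \<in> borel_measurable borel" by measurable
    show "integrable Q (\<lambda>\<omega>. (exp (Re l * Y \<omega>))\<^sup>2)"
      unfolding eq by (rule integral_qs_coupling_fst(1)[OF Q(1) Zm])
    have "(\<integral>\<omega>. (exp (Re l * Y \<omega>))\<^sup>2 \<partial>Q) = centered_mgf n t"
      unfolding eq integral_qs_coupling_fst(2)[OF Q(1) Zm] centered_mgf_def ..
    also have "\<dots> \<le> exp (2 * W)" using centered_mgf_le[of n t] b1 by (meson exp_le_cancel_iff order_trans)
    also have "\<dots> = (exp W)\<^sup>2" by (rule exp_double)
    finally show "sqrt (\<integral>\<omega>. (exp (Re l * Y \<omega>))\<^sup>2 \<partial>Q) \<le> exp W" by (intro real_le_lsqrt) auto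
  qed
  have y2: "integrable Q (\<lambda>\<omega>. (exp (Re l * snd \<omega>))\<^sup>2)" "sqrt (\<integral>\<omega>. (exp (Re l * snd \<omega>))\<^sup>2 \<partial>Q) \<le> exp W"
  proof -
    have eq: "(exp (Re l * y))\<^sup>2 = exp (2 * Re l * y)" for y by (simp add: exp_double[symmetric] mult.assoc)
    have ym: "(\<lambda>y. exp (2 * Re l * y)) \<in> borel_measurable borel" by measurable
    show "integrable Q (\<lambda>\<omega>. (exp (Re l * snd \<omega>))\<^sup>2)"
      unfolding eq integral_qs_coupling_snd(1)[OF Q(1) ym] by (rule limit_law_mgf(1)[OF M])
    have "(\<integral>\<omega>. (exp (Re l * snd \<omega>))\<^sup>2 \<partial>Q) \<le> exp (log_mgf_bound (2 * Re l))"
      unfolding eq integral_qs_coupling_snd(2)[OF Q(1) ym] by (rule limit_law_mgf(2)[OF M])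
    also have "\<dots> \<le> exp (2 * W)" using b2 by simp
    also have "\<dots> = (exp W)\<^sup>2" by (rule exp_double)
    finally show "sqrt (\<integral>\<omega>. (exp (Re l * snd \<omega>))\<^sup>2 \<partial>Q) \<le> exp W" by (intro real_le_lsqrt) auto
  qed
  have absd2: "integrable Q (\<lambda>\<omega>. \<bar>d \<omega>\<bar>\<^sup>2)" using d2(1) by simp
  have cs: "integrable Q (\<lambda>\<omega>. \<bar>d \<omega>\<bar> * g \<omega>)" "(\<integral>\<omega>. \<bar>d \<omega>\<bar> * g \<omega> \<partial>Q) \<le> 3 / sqrt (real n) * exp W"
    if [measurable]: "g \<in> borel_measurable Q" and g: "integrable Q (\<lambda>\<omega>. (g \<omega>)\<^sup>2)" "sqrt (\<integral>\<omega>. (g \<omega>)\<^sup>2 \<partial>Q) \<le> exp W" for g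
  proof -
    note C = integral_mult_sq_le[OF _ _ absd2 g(1)]
    show "integrable Q (\<lambda>\<omega>. \<bar>d \<omega>\<bar> * g \<omega>)" by (rule C(1)) measurable
    have "(\<integral>\<omega>. \<bar>d \<omega>\<bar> * g \<omega> \<partial>Q) \<le> \<bar>\<integral>\<omega>. \<bar>d \<omega>\<bar> * g \<omega> \<partial>Q\<bar>" by (rule abs_ge_self)
    also have "\<dots> \<le> sqrt (\<integral>\<omega>. \<bar>d \<omega>\<bar>\<^sup>2 \<partial>Q) * sqrt (\<integral>\<omega>. (g \<omega>)\<^sup>2 \<partial>Q)" by (rule C(2)) measurable
    also have "\<dots> \<le> 3 / sqrt (real n) * exp W" using d2(2) g(2) by (intro mult_mono) auto
    finally show "(\<integral>\<omega>. \<bar>d \<omega>\<bar> * g \<omega> \<partial>Q) \<le> 3 / sqrt (real n) * exp W" .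
  qed
  have "(\<lambda>\<omega>. exp (Re l * Y \<omega>)) \<in> borel_measurable Q" by measurable
  note cY = cs[OF this Y2]
  have "(\<lambda>\<omega>. exp (Re l * snd \<omega>)) \<in> borel_measurable Q" by measurable
  note cy = cs[OF this y2]
  have "cmod (qs_mgf n l - (\<integral>y. exp (l * complex_of_real y) \<partial>M))
     = cmod (\<integral>\<omega>. exp (l * complex_of_real (Y \<omega>)) - exp (l * complex_of_real (snd \<omega>)) \<partial>Q)"
    using int_Y int_y by simp
  also have "\<dots> \<le> (\<integral>\<omega>. cmod l / 2 * (\<bar>d \<omega>\<bar> * exp (Re l * Y \<omega>) + \<bar>d \<omega>\<bar> * exp (Re l * snd \<omega>)) \<partial>Q)"
  proof (rule Bochner_Integration.integral_norm_bound_integral)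
    fix \<omega> assume "\<omega> \<in> space Q"
    have "cmod (l * complex_of_real (Y \<omega>) - l * complex_of_real (snd \<omega>)) = cmod l * \<bar>d \<omega>\<bar>"
      unfolding right_diff_distrib[symmetric] of_real_diff[symmetric] norm_mult d_def norm_of_real ..
    then show "cmod (exp (l * complex_of_real (Y \<omega>)) - exp (l * complex_of_real (snd \<omega>)))
       \<le> cmod l / 2 * (\<bar>d \<omega>\<bar> * exp (Re l * Y \<omega>) + \<bar>d \<omega>\<bar> * exp (Re l * snd \<omega>))"
      using cmod_exp_diff_le[of "l * complex_of_real (Y \<omega>)" "l * complex_of_real (snd \<omega>)"]
      by (simp add: algebra_simps)
  qed (use int_Y int_y cY cy in simp_all)
  also have "\<dots> = cmod l / 2 * ((\<integral>\<omega>. \<bar>d \<omega>\<bar> * exp (Re l * Y \<omega>) \<partial>Q) + (\<integral>\<omega>. \<bar>d \<omega>\<bar> * exp (Re l * snd \<omega>) \<partial>Q))"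
    using cY(1) cy(1) by simp
  \<comment> \<open>The factor 1/2 of the averaged exponentials is used up by the two equal
    bounds.\<close>
  also have "\<dots> \<le> cmod l / 2 * (3 / sqrt (real n) * exp W + 3 / sqrt (real n) * exp W)"
    using cY(2) cy(2) by (intro mult_left_mono add_mono) auto
  also have "\<dots> = 3 * cmod l * exp W * real n powr (-1/2)"
    using n by (simp add: powr_minus_divide powr_half_sqrt[symmetric])
  finally show ?thesis by (simp add: W_def \<rho>_def)
qed

end
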